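(* Let $\mathfrak d$ be a finite-dimensional Lie algebra over $\mathbf k$. Let $r\in\mathfrak d\wedge\mathfrak d$ be nondegenerate and $s\in\mathfrak d$; write $r=\sum r^{ij}\partial_i\otimes\partial_j$ in a basis $\{\partial_i\}$ of $\mathfrak d$, let $\omega\in\bigwedge^2\mathfrak d^*$ be the $2$-form with $\omega(\partial_i\wedge\partial_j)=\omega_{ij}$, $(\omega_{ij})$ being the matrix inverse to $(r^{ij})$, and let $\chi:=\iota_s\omega\in\mathfrak d^*$. Then the equations $$[r,\Delta(s)]=0,\qquad([r_{12},r_{13}]+r_{12}s_3)+\text{cyclic}=0$$ are equivalent to the identities $$\mathrm d\omega+\chi\wedge\omega=0,\qquad\mathrm d\chi=0$$ (which mean that $\omega$ is a $2$-cocycle for $\mathfrak d$ in the $1$-dimensional $\mathfrak d$-module defined by $\chi$). This establishes a one-to-one correspondence between solutions $(r,s)$ of the first two equations with nondegenerate $r$ and solutions $(\omega,\chi)$ of the last two equations with nondegenerate $\omega$.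
   Context: $\mathbf k$ is an algebraically closed field of characteristic $0$. $\mathfrak d$ is viewed inside $H=U(\mathfrak d)$, $\Delta(s)=s\otimes1+1\otimes s$; the first equation is in $H^{\otimes2}$ and the second in $H^{\otimes3}$, with $r_{12}=r\otimes1$, $s_3=1\otimes1\otimes s$, etc.; "cyclic" means adding the images under the two nontrivial cyclic permutations of the three tensor factors. Elements of $\mathfrak d\wedge\mathfrak d$ are skew-symmetric tensors in $\mathfrak d\otimes\mathfrak d$; $r$ is nondegenerate if the matrix $(r^{ij})$ is invertible. $(\iota_s\omega)(a)=\omega(s\wedge a)$. $\mathrm d$ is the Lie algebra cohomology differential with trivial coefficients: $(\mathrm d\chi)(a\wedge b)=-\chi([a,b])$, $(\mathrm d\omega)(a\wedge b\wedge c)=-\omega([a,b]\wedge c)-\omega([b,c]\wedge a)-\omega([c,a]\wedge b)$; $(\chi\wedge\omega)(a\wedge b\wedge c)=\chi(a)\omega(b\wedge c)+\chi(b)\omega(c\wedge a)+\chi(c)\omega(a\wedge b)$. *)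

theory Defs
  imports
    "HOL-Algebra.QuotRing"
    "HOL-Algebra.Module"
    "HOL-Computational_Algebra.Polynomial"
    "Jordan_Normal_Form.Matrix"
begin

section \<open>Lie algebras, their modules and cochains\<close>

locale lie_algebra = vector_space scale
  for scale :: "'k::field \<Rightarrow> 'd::ab_group_add \<Rightarrow> 'd" +
  fixes bracket :: "'d \<Rightarrow> 'd \<Rightarrow> 'd"
  assumes bracket_add_left: "bracket (a + b) c = bracket a c + bracket b c"
    and bracket_add_right: "bracket a (b + c) = bracket a b + bracket a c"
    and bracket_scale_left: "bracket (scale x a) b = scale x (bracket a b)"
    and bracket_scale_right: "bracket a (scale x b) = scale x (bracket a b)"
    and bracket_self: "bracket a a = 0"
    and jacobi: "bracket a (bracket b c) + bracket b (bracket c a) + bracket c (bracket a b) = 0"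

definition finite_basis :: "('k::field \<Rightarrow> 'd::ab_group_add \<Rightarrow> 'd) \<Rightarrow> nat \<Rightarrow> (nat \<Rightarrow> 'd) \<Rightarrow> bool" where
  "finite_basis scale n e \<longleftrightarrow>
     inj_on e {..<n} \<and> \<not> module.dependent scale (e ` {..<n}) \<and> module.span scale (e ` {..<n}) = UNIV"

text \<open>Elements of the second exterior power of the dual space are alternating bilinear forms;
  the value of such a form on the bivector of \<open>a\<close> and \<open>b\<close> is \<open>\<omega> a b\<close>.\<close>

definition one_form :: "('k::field \<Rightarrow> 'd::ab_group_add \<Rightarrow> 'd) \<Rightarrow> ('d \<Rightarrow> 'k) \<Rightarrow> bool" where
  "one_form scale \<chi> \<longleftrightarrow> Vector_Spaces.linear scale (*) \<chi>"

definition alternating_form ::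
  "('k::field \<Rightarrow> 'd::ab_group_add \<Rightarrow> 'd) \<Rightarrow> ('k \<Rightarrow> 'v::ab_group_add \<Rightarrow> 'v) \<Rightarrow> ('d \<Rightarrow> 'd \<Rightarrow> 'v) \<Rightarrow> bool" where
  "alternating_form scale scaleV \<omega> \<longleftrightarrow>
     (\<forall>b. Vector_Spaces.linear scale scaleV (\<lambda>a. \<omega> a b)) \<and>
     (\<forall>a. Vector_Spaces.linear scale scaleV (\<omega> a)) \<and>
     (\<forall>a. \<omega> a a = 0)"

abbreviation two_form :: "('k::field \<Rightarrow> 'd::ab_group_add \<Rightarrow> 'd) \<Rightarrow> ('d \<Rightarrow> 'd \<Rightarrow> 'k) \<Rightarrow> bool" where
  "two_form scale \<omega> \<equiv> alternating_form scale (*) \<omega>"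

definition nondegenerate_form :: "('d::ab_group_add \<Rightarrow> 'd \<Rightarrow> 'k::field) \<Rightarrow> bool" where
  "nondegenerate_form \<omega> \<longleftrightarrow> (\<forall>a. (\<forall>b. \<omega> a b = 0) \<longrightarrow> a = 0)"

definition contract :: "'d \<Rightarrow> ('d \<Rightarrow> 'd \<Rightarrow> 'k) \<Rightarrow> 'd \<Rightarrow> 'k" where
  "contract s \<omega> = (\<lambda>a. \<omega> s a)"

definition diff1 :: "('d \<Rightarrow> 'd \<Rightarrow> 'd) \<Rightarrow> ('d \<Rightarrow> 'k::field) \<Rightarrow> 'd \<Rightarrow> 'd \<Rightarrow> 'k" where
  "diff1 bracket \<chi> a b = - \<chi> (bracket a b)"

definition diff2 :: "('d \<Rightarrow> 'd \<Rightarrow> 'd) \<Rightarrow> ('d \<Rightarrow> 'd \<Rightarrow> 'k::field) \<Rightarrow> 'd \<Rightarrow> 'd \<Rightarrow> 'd \<Rightarrow> 'k" where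
  "diff2 bracket \<omega> a b c = - \<omega> (bracket a b) c - \<omega> (bracket b c) a - \<omega> (bracket c a) b"

definition wedge12 :: "('d \<Rightarrow> 'k::field) \<Rightarrow> ('d \<Rightarrow> 'd \<Rightarrow> 'k) \<Rightarrow> 'd \<Rightarrow> 'd \<Rightarrow> 'd \<Rightarrow> 'k" where
  "wedge12 \<chi> \<omega> a b c = \<chi> a * \<omega> b c + \<chi> b * \<omega> c a + \<chi> c * \<omega> a b"

definition form_equations :: "('d \<Rightarrow> 'd \<Rightarrow> 'd) \<Rightarrow> ('d \<Rightarrow> 'd \<Rightarrow> 'k::field) \<Rightarrow> ('d \<Rightarrow> 'k) \<Rightarrow> bool" where
  "form_equations bracket \<omega> \<chi> \<longleftrightarrow>
     (\<forall>a b c. diff2 bracket \<omega> a b c + wedge12 \<chi> \<omega> a b c = 0) \<and>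
     (\<forall>a b. diff1 bracket \<chi> a b = 0)"

definition lie_module ::
  "('k::field \<Rightarrow> 'd::ab_group_add \<Rightarrow> 'd) \<Rightarrow> ('d \<Rightarrow> 'd \<Rightarrow> 'd) \<Rightarrow>
   ('k \<Rightarrow> 'v::ab_group_add \<Rightarrow> 'v) \<Rightarrow> ('d \<Rightarrow> 'v \<Rightarrow> 'v) \<Rightarrow> bool" where
  "lie_module scale bracket scaleV act \<longleftrightarrow>
     (\<forall>v. Vector_Spaces.linear scale scaleV (\<lambda>a. act a v)) \<and>
     (\<forall>a. Vector_Spaces.linear scaleV scaleV (act a)) \<and>
     (\<forall>a b v. act (bracket a b) v = act a (act b v) - act b (act a v))"

text \<open>Chevalley--Eilenberg 2-cocycles with values in a module.\<close>

definition two_cocycle ::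
  "('k::field \<Rightarrow> 'd::ab_group_add \<Rightarrow> 'd) \<Rightarrow> ('d \<Rightarrow> 'd \<Rightarrow> 'd) \<Rightarrow>
   ('k \<Rightarrow> 'v::ab_group_add \<Rightarrow> 'v) \<Rightarrow> ('d \<Rightarrow> 'v \<Rightarrow> 'v) \<Rightarrow> ('d \<Rightarrow> 'd \<Rightarrow> 'v) \<Rightarrow> bool" where
  "two_cocycle scale bracket scaleV act \<omega> \<longleftrightarrow>
     alternating_form scale scaleV \<omega> \<and>
     (\<forall>a b c. act a (\<omega> b c) - act b (\<omega> a c) + act c (\<omega> a b)
        - \<omega> (bracket a b) c + \<omega> (bracket a c) b - \<omega> (bracket b c) a = 0)"


section \<open>Associative algebras over a field\<close>

text \<open>Algebras over the field type \<open>'k\<close> are records of type \<open>('k, 'a) module\<close>: a ring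
  together with a scalar multiplication.\<close>

definition commutator :: "('a, 'b) ring_scheme \<Rightarrow> 'a \<Rightarrow> 'a \<Rightarrow> 'a" where
  "commutator A x y = (x \<otimes>\<^bsub>A\<^esub> y) \<ominus>\<^bsub>A\<^esub> (y \<otimes>\<^bsub>A\<^esub> x)"

definition monoid_algebra :: "('m, 'b) monoid_scheme \<Rightarrow> ('k::field, 'm \<Rightarrow> 'k) module" where
  "monoid_algebra M =
     \<lparr>carrier = {f. finite {m. f m \<noteq> 0} \<and> {m. f m \<noteq> 0} \<subseteq> carrier M},
      monoid.mult = (\<lambda>f g m. \<Sum>(a, b) \<in> {(a, b). f a \<noteq> 0 \<and> g b \<noteq> 0 \<and> a \<otimes>\<^bsub>M\<^esub> b = m}. f a * g b),
      one = (\<lambda>m. if m = \<one>\<^bsub>M\<^esub> then 1 else 0),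
      zero = (\<lambda>m. 0),
      add = (\<lambda>f g m. f m + g m),
      module.smult = (\<lambda>c f m. c * f m)\<rparr>"

definition single :: "'m \<Rightarrow> 'm \<Rightarrow> 'k::field" where
  "single m = (\<lambda>m'. if m' = m then 1 else 0)"

text \<open>The linear extension of a map of monoid elements.\<close>

definition pushforward :: "('m \<Rightarrow> 'n) \<Rightarrow> ('m \<Rightarrow> 'k::field) \<Rightarrow> 'n \<Rightarrow> 'k" where
  "pushforward p f = (\<lambda>m'. \<Sum>m \<in> {m. f m \<noteq> 0 \<and> p m = m'}. f m)"

text \<open>The quotient ring \<open>A Quot I\<close>, retaining the scalar multiplication.\<close>

definition alg_quot :: "('k, 'a) module \<Rightarrow> 'a set \<Rightarrow> ('k, 'a set) module" where
  "alg_quot A I = ring.extend (A Quot I) (module.fields (\<lambda>c X. \<Union>x\<in>X. I +>\<^bsub>A\<^esub> (c \<odot>\<^bsub>A\<^esub> x)))"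


section \<open>The universal enveloping algebra\<close>

definition word_monoid :: "'d list monoid" where
  "word_monoid = \<lparr>carrier = UNIV, monoid.mult = (@), one = []\<rparr>"

abbreviation free_algebra :: "('k::field, 'd list \<Rightarrow> 'k) module" where
  "free_algebra \<equiv> monoid_algebra word_monoid"

text \<open>The generators of the free algebra are indexed by all vectors; the first two families of
  relations impose linearity (they cut out the tensor algebra).\<close>

definition env_relations ::
  "('k::field \<Rightarrow> 'd::ab_group_add \<Rightarrow> 'd) \<Rightarrow> ('d \<Rightarrow> 'd \<Rightarrow> 'd) \<Rightarrow> ('d list \<Rightarrow> 'k) set" where
  "env_relations scale bracket =
     {single [a + b] \<ominus>\<^bsub>free_algebra\<^esub> (single [a] \<oplus>\<^bsub>free_algebra\<^esub> single [b]) | a b. True} \<union>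
     {single [scale c a] \<ominus>\<^bsub>free_algebra\<^esub> (c \<odot>\<^bsub>free_algebra\<^esub> single [a]) | c a. True} \<union>
     {commutator free_algebra (single [a]) (single [b]) \<ominus>\<^bsub>free_algebra\<^esub> single [bracket a b] | a b. True}"

definition env_ideal ::
  "('k::field \<Rightarrow> 'd::ab_group_add \<Rightarrow> 'd) \<Rightarrow> ('d \<Rightarrow> 'd \<Rightarrow> 'd) \<Rightarrow> ('d list \<Rightarrow> 'k) set" where
  "env_ideal scale bracket = Idl\<^bsub>free_algebra\<^esub> (env_relations scale bracket)"

definition env_algebra ::
  "('k::field \<Rightarrow> 'd::ab_group_add \<Rightarrow> 'd) \<Rightarrow> ('d \<Rightarrow> 'd \<Rightarrow> 'd) \<Rightarrow> ('k, ('d list \<Rightarrow> 'k) set) module" where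
  "env_algebra scale bracket = alg_quot free_algebra (env_ideal scale bracket)"

definition env_emb ::
  "('k::field \<Rightarrow> 'd::ab_group_add \<Rightarrow> 'd) \<Rightarrow> ('d \<Rightarrow> 'd \<Rightarrow> 'd) \<Rightarrow> 'd \<Rightarrow> ('d list \<Rightarrow> 'k) set" where
  "env_emb scale bracket a = env_ideal scale bracket +>\<^bsub>free_algebra\<^esub> single [a]"


section \<open>Tensor powers of an algebra\<close>

text \<open>The \<open>n\<close>-th tensor power of \<open>A\<close> is the free vector space on the \<open>n\<close>-tuples (lists of length
  \<open>n\<close>) over \<open>A\<close> modulo the multilinearity relations. With componentwise multiplication of tuples
  the free vector space is a monoid algebra. The product of a multilinearity relation and a tuple
  is again a multilinearity relation, so the ideal generated by the relations is their linear span
  and the quotient is the tensor power as an algebra.\<close>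

definition tuple_monoid :: "('a, 'b) monoid_scheme \<Rightarrow> nat \<Rightarrow> 'a list monoid" where
  "tuple_monoid A n =
     \<lparr>carrier = {xs. length xs = n \<and> set xs \<subseteq> carrier A},
      monoid.mult = map2 (\<lambda>x y. x \<otimes>\<^bsub>A\<^esub> y),
      one = replicate n \<one>\<^bsub>A\<^esub>\<rparr>"

definition tuple_algebra :: "('k::field, 'a) module \<Rightarrow> nat \<Rightarrow> ('k, 'a list \<Rightarrow> 'k) module" where
  "tuple_algebra A n = monoid_algebra (tuple_monoid A n)"

definition tensor_relations :: "('k::field, 'a) module \<Rightarrow> nat \<Rightarrow> ('a list \<Rightarrow> 'k) set" where
  "tensor_relations A n =
     {single (xs[i := x \<oplus>\<^bsub>A\<^esub> y]) \<ominus>\<^bsub>tuple_algebra A n\<^esub>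
        (single (xs[i := x]) \<oplus>\<^bsub>tuple_algebra A n\<^esub> single (xs[i := y]))
      | xs i x y. xs \<in> carrier (tuple_monoid A n) \<and> i < n \<and> x \<in> carrier A \<and> y \<in> carrier A} \<union>
     {single (xs[i := c \<odot>\<^bsub>A\<^esub> x]) \<ominus>\<^bsub>tuple_algebra A n\<^esub>
        (c \<odot>\<^bsub>tuple_algebra A n\<^esub> single (xs[i := x]))
      | xs i c x. xs \<in> carrier (tuple_monoid A n) \<and> i < n \<and> x \<in> carrier A}"

definition tensor_ideal :: "('k::field, 'a) module \<Rightarrow> nat \<Rightarrow> ('a list \<Rightarrow> 'k) set" where
  "tensor_ideal A n = Idl\<^bsub>tuple_algebra A n\<^esub> (tensor_relations A n)"

definition tensor_power :: "('k::field, 'a) module \<Rightarrow> nat \<Rightarrow> ('k, ('a list \<Rightarrow> 'k) set) module" where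
  "tensor_power A n = alg_quot (tuple_algebra A n) (tensor_ideal A n)"

text \<open>The tensor \<open>x\<^sub>1 \<otimes> \<dots> \<otimes> x\<^sub>n\<close>.\<close>

definition pure :: "('k::field, 'a) module \<Rightarrow> 'a list \<Rightarrow> ('a list \<Rightarrow> 'k) set" where
  "pure A xs = tensor_ideal A (length xs) +>\<^bsub>tuple_algebra A (length xs)\<^esub> single xs"

text \<open>The linear map into the \<open>n\<close>-th tensor power that maps \<open>pure A xs\<close> to \<open>pure A (p xs)\<close>. It is
  used only for maps \<open>p\<close> that permute the entries or insert units, for which it is well defined.\<close>

definition tensor_map ::
  "('k::field, 'a) module \<Rightarrow> nat \<Rightarrow> ('a list \<Rightarrow> 'a list) \<Rightarrow> ('a list \<Rightarrow> 'k) set \<Rightarrow> ('a list \<Rightarrow> 'k) set" where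
  "tensor_map A n p X = (\<Union>f\<in>X. tensor_ideal A n +>\<^bsub>tuple_algebra A n\<^esub> pushforward p f)"


section \<open>The equations for \<open>r\<close> and \<open>s\<close>\<close>

context
  fixes scale :: "'k::field \<Rightarrow> 'd::ab_group_add \<Rightarrow> 'd"
    and bracket :: "'d \<Rightarrow> 'd \<Rightarrow> 'd"
begin

private abbreviation (input) "H \<equiv> env_algebra scale bracket"
private abbreviation (input) "H2 \<equiv> tensor_power (env_algebra scale bracket) 2"
private abbreviation (input) "H3 \<equiv> tensor_power (env_algebra scale bracket) 3"
private abbreviation (input) "emb \<equiv> env_emb scale bracket"

text \<open>The subspace of \<open>H \<otimes> H\<close> spanned by the tensors of two elements of the Lie algebra, and the
  skew-symmetric elements in it.\<close>

definition lie_tensors :: "(('d list \<Rightarrow> 'k) set list \<Rightarrow> 'k) set set" where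
  "lie_tensors = {\<Oplus>\<^bsub>H2\<^esub>i\<in>{..<m}. pure H [emb (a i), emb (b i)] | (m::nat) a b. True}"

definition skew_tensors :: "(('d list \<Rightarrow> 'k) set list \<Rightarrow> 'k) set set" where
  "skew_tensors = {r \<in> lie_tensors. tensor_map H 2 rev r = \<ominus>\<^bsub>H2\<^esub> r}"

definition has_coords :: "nat \<Rightarrow> (nat \<Rightarrow> 'd) \<Rightarrow> (('d list \<Rightarrow> 'k) set list \<Rightarrow> 'k) set \<Rightarrow> 'k mat \<Rightarrow> bool" where
  "has_coords n e r R \<longleftrightarrow> R \<in> carrier_mat n n \<and>
     r = (\<Oplus>\<^bsub>H2\<^esub>p\<in>{..<n} \<times> {..<n}. R $$ p \<odot>\<^bsub>H2\<^esub> pure H [emb (e (fst p)), emb (e (snd p))])"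

definition nondegenerate_tensor :: "nat \<Rightarrow> (nat \<Rightarrow> 'd) \<Rightarrow> (('d list \<Rightarrow> 'k) set list \<Rightarrow> 'k) set \<Rightarrow> bool" where
  "nondegenerate_tensor n e r \<longleftrightarrow> (\<exists>R. has_coords n e r R \<and> invertible_mat R)"

definition is_inverse_form ::
  "nat \<Rightarrow> (nat \<Rightarrow> 'd) \<Rightarrow> (('d list \<Rightarrow> 'k) set list \<Rightarrow> 'k) set \<Rightarrow> ('d \<Rightarrow> 'd \<Rightarrow> 'k) \<Rightarrow> bool" where
  "is_inverse_form n e r \<omega> \<longleftrightarrow> two_form scale \<omega> \<and>
     (\<exists>R. has_coords n e r R \<and>
        inverts_mat R (mat n n (\<lambda>(i, j). \<omega> (e i) (e j))) \<and>
        inverts_mat (mat n n (\<lambda>(i, j). \<omega> (e i) (e j))) R)"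

definition inverse_form ::
  "nat \<Rightarrow> (nat \<Rightarrow> 'd) \<Rightarrow> (('d list \<Rightarrow> 'k) set list \<Rightarrow> 'k) set \<Rightarrow> 'd \<Rightarrow> 'd \<Rightarrow> 'k" where
  "inverse_form n e r = (THE \<omega>. is_inverse_form n e r \<omega>)"

definition coproduct :: "'d \<Rightarrow> (('d list \<Rightarrow> 'k) set list \<Rightarrow> 'k) set" where
  "coproduct s = pure H [emb s, \<one>\<^bsub>H\<^esub>] \<oplus>\<^bsub>H2\<^esub> pure H [\<one>\<^bsub>H\<^esub>, emb s]"

definition place12 :: "(('d list \<Rightarrow> 'k) set list \<Rightarrow> 'k) set \<Rightarrow> (('d list \<Rightarrow> 'k) set list \<Rightarrow> 'k) set" where
  "place12 = tensor_map H 3 (\<lambda>xs. [xs ! 0, xs ! 1, \<one>\<^bsub>H\<^esub>])"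

definition place13 :: "(('d list \<Rightarrow> 'k) set list \<Rightarrow> 'k) set \<Rightarrow> (('d list \<Rightarrow> 'k) set list \<Rightarrow> 'k) set" where
  "place13 = tensor_map H 3 (\<lambda>xs. [xs ! 0, \<one>\<^bsub>H\<^esub>, xs ! 1])"

definition place3 :: "'d \<Rightarrow> (('d list \<Rightarrow> 'k) set list \<Rightarrow> 'k) set" where
  "place3 s = pure H [\<one>\<^bsub>H\<^esub>, \<one>\<^bsub>H\<^esub>, emb s]"

definition plus_cyclic :: "(('d list \<Rightarrow> 'k) set list \<Rightarrow> 'k) set \<Rightarrow> (('d list \<Rightarrow> 'k) set list \<Rightarrow> 'k) set" where
  "plus_cyclic t = t \<oplus>\<^bsub>H3\<^esub> tensor_map H 3 rotate1 t \<oplus>\<^bsub>H3\<^esub> tensor_map H 3 (rotate 2) t"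

definition rs_equations :: "(('d list \<Rightarrow> 'k) set list \<Rightarrow> 'k) set \<Rightarrow> 'd \<Rightarrow> bool" where
  "rs_equations r s \<longleftrightarrow>
     commutator H2 r (coproduct s) = \<zero>\<^bsub>H2\<^esub> \<and>
     plus_cyclic (commutator H3 (place12 r) (place13 r) \<oplus>\<^bsub>H3\<^esub> (place12 r \<otimes>\<^bsub>H3\<^esub> place3 s)) = \<zero>\<^bsub>H3\<^esub>"

end

end

theory Submission
  imports Defs "Jordan_Normal_Form.Determinant"
begin

text \<open>Let \<open>\<Omega>\<close> be the matrix of \<open>\<omega>\<close> and \<open>R\<close> its inverse, the matrix of \<open>r\<close>. Contracting one factor of \<open>r\<close>
with a form \<open>\<omega>(a, _)\<close> gives back a vector: \<open>\<Sum> R\<^sub>i\<^sub>j \<omega>(a, e\<^sub>i) e\<^sub>j = a\<close> and, by skew symmetry,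
\<open>\<Sum> R\<^sub>i\<^sub>j \<omega>(b, e\<^sub>j) e\<^sub>i = - b\<close> (\<open>pairing_form_left\<close>, \<open>pairing_form_right\<close>). So the value of
\<open>\<omega>(a, _) \<otimes> \<omega>(b, _) \<otimes> \<omega>(c, _)\<close> on \<open>[r\<^sub>1\<^sub>2, r\<^sub>1\<^sub>3] + r\<^sub>1\<^sub>2 s\<^sub>3\<close> is \<open>\<omega>(a, [b, c]) + \<omega>(b, a) \<omega>(c, s)\<close>, and
the cyclic sum of these numbers is the value of \<open>d\<omega> + \<chi> \<and> \<omega>\<close> at \<open>a, b, c\<close>. In the same way
\<open>[r, \<Delta>(s)]\<close> has the values \<open>\<omega>(b, [a, s]) - \<omega>(a, [b, s])\<close>. If \<open>d\<omega> + \<chi> \<and> \<omega> = 0\<close>, its value at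
\<open>s, a, b\<close>, where the contributions of \<open>\<chi> \<and> \<omega>\<close> cancel, identifies this number with \<open>\<chi>([a, b])\<close>, so
that the first equation turns into \<open>d\<chi> = 0\<close>. As \<open>\<omega>\<close> is nondegenerate, every linear form is some
\<open>\<omega>(a, _)\<close>, and nothing is lost by testing on these forms. This is \<open>rs_equations_iff_form_equations\<close>;
the correspondence then only needs that \<open>R\<close> and \<open>\<Omega>\<close> determine each other, as do \<open>s\<close> and \<open>\<chi>\<close>.

The equations hold in tensor powers of the enveloping algebra, so one has to know that a tensor of
Lie algebra elements is zero there as soon as all products of one-forms vanish on it. This rests on
a linear left inverse of the embedding of the Lie algebra into its enveloping algebra, which is the
part of the Poincare-Birkhoff-Witt theorem that enters. It comes from a multilinear map \<open>P\<close> from words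
to vectors with \<open>P(x) = x\<close> and \<open>P(u x y v) - P(u y x v) = P(u [x, y] v)\<close>. On words in a basis \<open>P\<close>
is defined by recursion on the length: \<open>P\<close> of a sorted word of length at least two is \<open>0\<close>, and every
exchange made while sorting a word costs a value of \<open>P\<close> on a word that is shorter by one letter.
Insertion sort fixes one order of the exchanges; that the cost does not depend on it is the Jacobi
identity (\<open>insert_corr_diamond\<close>).

Linear maps on the quotients by the defining ideals are obtained from \<open>annihilator_ideal\<close>: the common
kernel of a family of linear maps on a monoid algebra is an ideal if the family is closed under
translation. For the enveloping algebra the family consists of the translates of \<open>P\<close>, for a
tensor power of all multilinear functionals.\<close>

section \<open>Coordinates and multilinear maps\<close>

lemma vector_space_linearI:
  assumes "vector_space s1" "vector_space s2" "\<And>x y. f (x + y) = f x + f y" "\<And>c x. f (s1 c x) = s2 c (f x)"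
  shows "Vector_Spaces.linear s1 s2 f"
  using assms by (simp add: Vector_Spaces.linear_iff)

locale based_lie_algebra = lie_algebra scale bracket
  for scale :: "'k::field \<Rightarrow> 'd::ab_group_add \<Rightarrow> 'd" and bracket +
  fixes n :: nat and e :: "nat \<Rightarrow> 'd"
  assumes basis: "finite_basis scale n e"
begin

lemma bracket_swap: "bracket a b = - bracket b a"
proof -
  have "bracket (a + b) (a + b) = (bracket a a + bracket b b) + (bracket a b + bracket b a)"
    by (simp add: bracket_add_left bracket_add_right algebra_simps)
  then have "bracket a b + bracket b a = 0" by (simp add: bracket_self)
  then show ?thesis by (simp add: eq_neg_iff_add_eq_0)
qed

lemma linear_endoI:
  assumes "\<And>x y. f (x + y) = f x + f y" "\<And>c x. f (scale c x) = scale c (f x)"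
  shows "Vector_Spaces.linear scale scale f"
  using assms by (intro vector_space_linearI) unfold_locales

definition coord :: "'d \<Rightarrow> nat \<Rightarrow> 'k" where
  "coord x i = representation (e ` {..<n}) x (e i)"

lemma basis_facts:
  shows "inj_on e {..<n}" "independent (e ` {..<n})" "span (e ` {..<n}) = UNIV"
  using basis unfolding finite_basis_def by auto

lemma coord_add: "coord (x + y) i = coord x i + coord y i"
  unfolding coord_def by (rule fun_cong[OF representation_add]) (simp_all add: basis_facts)

lemma coord_scale: "coord (scale c x) i = c * coord x i"
  unfolding coord_def
  by (subst representation_scale) (simp_all add: basis_facts)

lemma coord_basis: "i < n \<Longrightarrow> j < n \<Longrightarrow> coord (e i) j = (if i = j then 1 else 0)"
  unfolding coord_def
  by (subst representation_basis) (auto simp: basis_facts inj_on_eq_iff[OF basis_facts(1)])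

lemma coord_expand: "x = (\<Sum>i<n. scale (coord x i) (e i))"
proof -
  have "(\<Sum>b\<in>e ` {..<n}. scale (representation (e ` {..<n}) x b) b) = x"
    by (rule sum_representation_eq) (simp_all add: basis_facts)
  then show ?thesis
    unfolding coord_def by (simp add: sum.reindex[OF basis_facts(1)])
qed

lemma linear_expand:
  assumes "Vector_Spaces.linear scale s2 f"
  shows "f x = (\<Sum>i<n. s2 (coord x i) (f (e i)))"
proof -
  interpret f: Vector_Spaces.linear scale s2 f by fact
  have "f x = f (\<Sum>i<n. scale (coord x i) (e i))" using coord_expand by metis
  then show ?thesis by (simp add: f.sum f.scale)
qed

lemma linear_eq_on_basis:
  assumes "Vector_Spaces.linear scale s2 f" "Vector_Spaces.linear scale s2 g" "\<And>i. i < n \<Longrightarrow> f (e i) = g (e i)"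
  shows "f x = g x"
  using linear_expand[OF assms(1), of x] linear_expand[OF assms(2), of x] assms(3) by simp

definition multilinear_on :: "nat \<Rightarrow> ('d list \<Rightarrow> 'd) \<Rightarrow> bool" where
  "multilinear_on N K \<longleftrightarrow> (\<forall>u v. length u + length v + 1 = N \<longrightarrow> Vector_Spaces.linear scale scale (\<lambda>x. K (u @ x # v)))"

lemma multilinear_onD:
  "multilinear_on N K \<Longrightarrow> length u + length v + 1 = N \<Longrightarrow> Vector_Spaces.linear scale scale (\<lambda>x. K (u @ x # v))"
  unfolding multilinear_on_def by blast

lemma multilinear_on_add:
  "multilinear_on N K \<Longrightarrow> length u + length v + 1 = N \<Longrightarrow> K (u @ (x + y) # v) = K (u @ x # v) + K (u @ y # v)"
  using module_hom.add[OF Vector_Spaces.linear.axioms(3)[OF multilinear_onD]] .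

lemma multilinear_on_minus:
  "multilinear_on N K \<Longrightarrow> length u + length v + 1 = N \<Longrightarrow> K (u @ (- x) # v) = - K (u @ x # v)"
  using module_hom.neg[OF Vector_Spaces.linear.axioms(3)[OF multilinear_onD]] .

lemma multilinear_on_prefix:
  "multilinear_on (length p + N) K \<Longrightarrow> multilinear_on N (\<lambda>v. K (p @ v))"
  using multilinear_onD[of "length p + N" K "p @ u" v for u v] by (simp add: multilinear_on_def)

lemma multilinear_on_suffix:
  "multilinear_on (N + length q) K \<Longrightarrow> multilinear_on N (\<lambda>u. K (u @ q))"
  using multilinear_onD[of "N + length q" K u "v @ q" for u v] by (simp add: multilinear_on_def)

lemma linear_diff: "Vector_Spaces.linear scale scale f \<Longrightarrow> Vector_Spaces.linear scale scale g \<Longrightarrow> Vector_Spaces.linear scale scale (\<lambda>x. f x - g x)"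
  by (simp add: Vector_Spaces.linear_iff scale_right_diff_distrib add_diff_add)

lemma multilinear_on_diff:
  "multilinear_on N K \<Longrightarrow> multilinear_on N L \<Longrightarrow> multilinear_on N (\<lambda>v. K v - L v)"
  unfolding multilinear_on_def by (auto intro: linear_diff)

text \<open>A multilinear map is determined by its values on the words in the basis, as the letters can be
expanded one after the other.\<close>

lemma multilinear_on_zeroI:
  assumes "multilinear_on N K" "\<And>w. length w = N \<Longrightarrow> set w \<subseteq> {..<n} \<Longrightarrow> K (map e w) = 0"
    and "length xs = N"
  shows "K xs = 0"
  using assms
proof (induction xs arbitrary: N K)
  case Nil
  then show ?case using Nil.prems(2)[of "[]"] by simp
next
  case (Cons x xs)
  have "K (e i # xs) = 0" if "i < n" for i
  proof (rule Cons.IH[of "length xs" "\<lambda>v. K ([e i] @ v)", simplified])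
    show "multilinear_on (length xs) (\<lambda>v. K (e i # v))"
      using multilinear_on_prefix[of "[e i]" "length xs" K] Cons.prems by simp
    show "K (e i # map e w) = 0" if "length w = length xs" "set w \<subseteq> {..<n}" for w
      using Cons.prems(2)[of "i # w"] Cons.prems(3) that \<open>i < n\<close> by simp
  qed
  moreover have "Vector_Spaces.linear scale scale (\<lambda>x. K (x # xs))"
    using multilinear_onD[OF Cons.prems(1), of "[]" xs] Cons.prems(3) by simp
  then have "K (x # xs) = (\<Sum>i<n. scale (coord x i) (K (e i # xs)))" by (rule linear_expand)
  ultimately show ?case by simp
qed

section \<open>A retraction of words onto the Lie algebra\<close>

text \<open>The total cost of moving the basis vector \<open>e x\<close> from the front of the sorted word \<open>v\<close> to its place
in \<open>v\<close>, with the prefix \<open>u\<close> in front of everything. Passing a smaller letter \<open>y\<close> costs the value of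
\<open>G\<close> on the word in which the pair \<open>x, y\<close> is replaced by its bracket, and lets \<open>y\<close> join the prefix.\<close>

fun insert_corr :: "('d list \<Rightarrow> 'd) \<Rightarrow> 'd list \<Rightarrow> nat \<Rightarrow> nat list \<Rightarrow> 'd" where
  "insert_corr G u x [] = 0"
| "insert_corr G u x (y # v) =
     (if x \<le> y then 0 else G (u @ bracket (e x) (e y) # map e v) + insert_corr G (u @ [e y]) x v)"

text \<open>The total cost of an insertion sort of \<open>w\<close>, which starts from the right end.\<close>

fun sort_corr :: "('d list \<Rightarrow> 'd) \<Rightarrow> 'd list \<Rightarrow> nat list \<Rightarrow> 'd" where
  "sort_corr G u [] = 0"
| "sort_corr G u (x # w) = sort_corr G (u @ [e x]) w + insert_corr G u x (sort w)"

text \<open>The commutation rule of the enveloping algebra on words of length \<open>N\<close>. The right hand side lives on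
words of length \<open>N - 1\<close> and is a separate map because the maps are constructed length by length.\<close>

definition exchanges :: "nat \<Rightarrow> ('d list \<Rightarrow> 'd) \<Rightarrow> ('d list \<Rightarrow> 'd) \<Rightarrow> bool" where
  "exchanges N G G' \<longleftrightarrow> (\<forall>u x y v. length u + length v + 2 = N \<longrightarrow>
     G (u @ x # y # v) - G (u @ y # x # v) = G' (u @ bracket x y # v))"

lemma exchangesD:
  "exchanges N G G' \<Longrightarrow> length u + length v + 2 = N \<Longrightarrow> G (u @ x # y # v) = G (u @ y # x # v) + G' (u @ bracket x y # v)"
  unfolding exchanges_def by (metis diff_add_cancel add.commute)

lemma insert_corr_eq:
  assumes "exchanges N G G'"
  shows "length p + length v + 1 = N \<Longrightarrow>
    G (p @ e x # map e v) = G (p @ map e (insort x v)) + insert_corr G' p x v"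
proof (induction v arbitrary: p)
  case Nil
  then show ?case by simp
next
  case (Cons y v)
  show ?case
    using Cons.IH[of "p @ [e y]"] Cons.prems exchangesD[OF assms, of p "map e v" "e x" "e y"]
    by simp
qed

text \<open>The costs of the single exchanges telescope.\<close>

lemma sort_corr_eq:
  assumes "exchanges N G G'"
  shows "length p + length w = N \<Longrightarrow> G (p @ map e w) = G (p @ map e (sort w)) + sort_corr G' p w"
proof (induction w arbitrary: p)
  case Nil
  then show ?case by simp
next
  case (Cons x w)
  show ?case
    using Cons.IH[of "p @ [e x]"] Cons.prems insert_corr_eq[OF assms, of p "sort w" x]
    by simp
qed

text \<open>The cost is a sum of values of \<open>G\<close> on words that all begin with the prefix, so it obeys the
exchange rule in the prefix.\<close>

lemma insert_corr_exchange:
  assumes "exchanges N G G'"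
  shows "length u + length t + length v + 2 = N \<Longrightarrow>
    insert_corr G (u @ a # b # t) y v - insert_corr G (u @ b # a # t) y v = insert_corr G' (u @ bracket a b # t) y v"
proof (induction v arbitrary: t)
  case Nil
  then show ?case by simp
next
  case (Cons z v)
  show ?case
    using Cons.IH[of "t @ [e z]"] Cons.prems
      exchangesD[OF assms, of u "t @ bracket (e y) (e z) # map e v" a b]
    by (simp add: algebra_simps)
qed

lemma sort_corr_exchange:
  assumes "exchanges N G G'"
  shows "length u + length t + length w + 1 = N \<Longrightarrow>
    sort_corr G (u @ a # b # t) w - sort_corr G (u @ b # a # t) w = sort_corr G' (u @ bracket a b # t) w"
proof (induction w arbitrary: t)
  case Nil
  then show ?case by simp
next
  case (Cons z w)
  show ?case
    using Cons.IH[of "t @ [e z]"] Cons.prems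
      insert_corr_exchange[OF assms, of u t "sort w" a b z]
    by (simp add: algebra_simps)
qed

lemma jacobi_commuted: "bracket x (bracket y z) + bracket (bracket x z) y = bracket (bracket x y) z"
proof -
  have "bracket (bracket x z) y = bracket y (bracket z x)"
    by (metis bracket_swap bracket_scale_right scale_minus_left scale_one)
  moreover have "bracket (bracket x y) z = - bracket z (bracket x y)" by (rule bracket_swap)
  ultimately show ?thesis using jacobi[of x y z] by (metis add_eq_0_iff neg_eq_iff_add_eq_0 minus_minus)
qed

text \<open>The confluence property of sorting. Let \<open>y < x\<close>. Sorting \<open>x y v\<close> inserts \<open>y\<close> into \<open>v\<close> behind
\<open>x\<close> and then inserts \<open>x\<close>; sorting \<open>y x v\<close> does it in the other order. The two costs differ by
exactly one exchange of \<open>x\<close> and \<open>y\<close>. If no letter of \<open>v\<close> is smaller than \<open>y\<close>, this exchange takes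
place at once and all other costs agree. Otherwise both \<open>x\<close> and \<open>y\<close> first have to pass the head
\<open>z\<close> of \<open>v\<close>. After that the induction hypothesis applies with \<open>z\<close> added to the prefix, and the
double brackets that are left over cancel by the Jacobi identity.\<close>

lemma insert_corr_diamond:
  assumes "exchanges N G G'" "y < x" "multilinear_on (N - 1) G'"
  shows "sorted v \<Longrightarrow> length u + length v + 1 = N \<Longrightarrow>
    insert_corr G (u @ [e x]) y v + insert_corr G u x (insort y v)
      - insert_corr G (u @ [e y]) x v - insert_corr G u y (insort x v)
    = G (u @ bracket (e x) (e y) # map e v)"
proof (induction v arbitrary: u)
  case Nil
  then show ?case using \<open>y < x\<close> by simp
next
  case (Cons z v)
  show ?case
  proof (cases "y \<le> z")
    case True
    then have "insert_corr G u y (insort x (z # v)) = 0" using \<open>y < x\<close> by auto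
    with True \<open>y < x\<close> show ?thesis by simp
  next
    case False
    let ?x = "e x" and ?y = "e y" and ?z = "e z" and ?v = "map e v"
    have len: "length u + length v + 2 = N" using Cons.prems by simp
    have IH: "insert_corr G (u @ [?z] @ [?x]) y v + insert_corr G (u @ [?z]) x (insort y v)
      - insert_corr G (u @ [?z] @ [?y]) x v - insert_corr G (u @ [?z]) y (insort x v)
      = G (u @ ?z # bracket ?x ?y # ?v)"
      using Cons.IH[of "u @ [?z]"] Cons.prems by simp
    have xz: "insert_corr G (u @ [?x, ?z]) y v - insert_corr G (u @ [?z, ?x]) y v = insert_corr G' (u @ [bracket ?x ?z]) y v"
      using insert_corr_exchange[OF assms(1), of u "[]" v ?x ?z y] len by simp
    have yz: "insert_corr G (u @ [?y, ?z]) x v - insert_corr G (u @ [?z, ?y]) x v = insert_corr G' (u @ [bracket ?y ?z]) x v"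
      using insert_corr_exchange[OF assms(1), of u "[]" v ?y ?z x] len by simp
    \<comment> \<open>The costs behind a bracket are differences of values of \<open>G\<close>; these brackets then trade places with the remaining letter, which produces the double brackets.\<close>
    have i1: "G (u @ bracket ?x ?z # ?y # ?v) = G (u @ bracket ?x ?z # map e (insort y v)) + insert_corr G' (u @ [bracket ?x ?z]) y v"
      using insert_corr_eq[OF assms(1), of "u @ [bracket ?x ?z]" v y] len by simp
    have i2: "G (u @ bracket ?y ?z # ?x # ?v) = G (u @ bracket ?y ?z # map e (insort x v)) + insert_corr G' (u @ [bracket ?y ?z]) x v"
      using insert_corr_eq[OF assms(1), of "u @ [bracket ?y ?z]" v x] len by simp
    have j1: "G (u @ ?x # bracket ?y ?z # ?v) = G (u @ bracket ?y ?z # ?x # ?v) + G' (u @ bracket ?x (bracket ?y ?z) # ?v)"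
      using exchangesD[OF assms(1), of u ?v ?x "bracket ?y ?z"] len by simp
    have j2: "G (u @ bracket ?x ?z # ?y # ?v) = G (u @ ?y # bracket ?x ?z # ?v) + G' (u @ bracket (bracket ?x ?z) ?y # ?v)"
      using exchangesD[OF assms(1), of u ?v "bracket ?x ?z" ?y] len by simp
    have j3: "G (u @ bracket ?x ?y # ?z # ?v) = G (u @ ?z # bracket ?x ?y # ?v) + G' (u @ bracket (bracket ?x ?y) ?z # ?v)"
      using exchangesD[OF assms(1), of u ?v "bracket ?x ?y" ?z] len by simp
    \<comment> \<open>The Jacobi identity on words of length \<open>N - 1\<close>.\<close>
    have jac: "G' (u @ bracket ?x (bracket ?y ?z) # ?v) + G' (u @ bracket (bracket ?x ?z) ?y # ?v) = G' (u @ bracket (bracket ?x ?y) ?z # ?v)"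
      using multilinear_on_add[OF assms(3), of u ?v "bracket ?x (bracket ?y ?z)" "bracket (bracket ?x ?z) ?y"] len
      by (simp add: jacobi_commuted)
    have "insort y (z # v) = z # insort y v" "insort x (z # v) = z # insort x v" "\<not> y \<le> z" "\<not> x \<le> z"
      using False \<open>y < x\<close> by auto
    then have "insert_corr G (u @ [?x]) y (z # v) + insert_corr G u x (insort y (z # v))
      - insert_corr G (u @ [?y]) x (z # v) - insert_corr G u y (insort x (z # v))
      = (G (u @ ?x # bracket ?y ?z # ?v) + insert_corr G (u @ [?x, ?z]) y v)
        + (G (u @ bracket ?x ?z # map e (insort y v)) + insert_corr G (u @ [?z]) x (insort y v))
        - (G (u @ ?y # bracket ?x ?z # ?v) + insert_corr G (u @ [?y, ?z]) x v)
        - (G (u @ bracket ?y ?z # map e (insort x v)) + insert_corr G (u @ [?z]) y (insort x v))"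
      by simp
    also have "\<dots> = G (u @ bracket ?x ?y # ?z # ?v)"
    proof -
      \<comment> \<open>A linear combination of the preceding equations, stated with variables for the values of \<open>G\<close>, \<open>G'\<close> and the costs.\<close>
      have *: "\<lbrakk>zx + c - zy - d = g1; xz - zx = c1; yz - zy = c2; h1 = k1 + c1; h2 = k2 + c2;
        l1 = h2 + p1; h1 = l2 + p2; l3 = g1 + p3; p1 + p2 = p3\<rbrakk>
        \<Longrightarrow> (l1 + xz) + (k1 + c) - (l2 + yz) - (k2 + d) = l3" for zx c zy d g1 xz c1 yz c2 h1 k1 h2 k2 l1 p1 l2 p2 l3 p3 :: 'd
      proof -
        assume a: "zx + c - zy - d = g1" "xz - zx = c1" "yz - zy = c2" "h1 = k1 + c1" "h2 = k2 + c2"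
          "l1 = h2 + p1" "h1 = l2 + p2" "l3 = g1 + p3" "p1 + p2 = p3"
        have b: "xz = c1 + zx" "yz = c2 + zy" "l2 = k1 + c1 - p2" "l1 = k2 + c2 + p1"
          "l3 = (zx + c - zy - d) + (p1 + p2)"
          using a by (metis diff_add_cancel, metis diff_add_cancel, metis add_diff_cancel, metis, metis)
        show "(l1 + xz) + (k1 + c) - (l2 + yz) - (k2 + d) = l3"
          unfolding b by (simp add: algebra_simps)
      qed
      show ?thesis
        using *[OF IH[simplified] xz yz i1 i2 j1 j2 j3 jac] .
    qed
    finally show ?thesis by simp
  qed
qed

text \<open>Both words have the same sorted tail, so that the difference splits into the difference for the
tail \<open>w\<close> behind two exchanged prefixes, which accounts for sorting \<open>w\<close> behind the bracket, and
the difference for inserting two letters into the sorted tail, which is \<open>insert_corr_diamond\<close>.\<close>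

lemma sort_corr_swap:
  assumes "exchanges N G G'" "multilinear_on N G" "multilinear_on (N - 1) G'"
  shows "length u + length w + 1 = N \<Longrightarrow>
    sort_corr G u (x # y # w) - sort_corr G u (y # x # w) = G (u @ bracket (e x) (e y) # map e w)"
proof (induction x y rule: linorder_wlog)
  case (sym x y)
  have "G (u @ (- bracket (e x) (e y)) # map e w) = - G (u @ bracket (e x) (e y) # map e w)"
    using sym.prems by (intro multilinear_on_minus[OF assms(2)]) simp
  moreover have "- bracket (e x) (e y) = bracket (e y) (e x)" by (rule bracket_swap[symmetric])
  ultimately show ?case using sym by (simp add: algebra_simps)
next
  case (le x y)
  show ?case
  proof (cases "x = y")
    case True
    have "G (u @ (0 + 0) # map e w) = G (u @ 0 # map e w) + G (u @ 0 # map e w)"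
      using le.prems by (intro multilinear_on_add[OF assms(2)]) simp
    then show ?thesis using True by (simp add: bracket_self)
  next
    case False
    have "sort_corr G (u @ [e y, e x]) w - sort_corr G (u @ [e x, e y]) w = sort_corr G' (u @ [bracket (e y) (e x)]) w"
      using sort_corr_exchange[OF assms(1), of u "[]" w "e y" "e x"] le.prems by simp
    moreover have "G (u @ bracket (e y) (e x) # map e w) = G (u @ bracket (e y) (e x) # map e (sort w)) + sort_corr G' (u @ [bracket (e y) (e x)]) w"
      using sort_corr_eq[OF assms(1), of "u @ [bracket (e y) (e x)]" w] le.prems by simp
    moreover have "insert_corr G (u @ [e y]) x (sort w) + insert_corr G u y (insort x (sort w))
      - insert_corr G (u @ [e x]) y (sort w) - insert_corr G u x (insort y (sort w))
      = G (u @ bracket (e y) (e x) # map e (sort w))"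
      using insert_corr_diamond[OF assms(1) _ assms(3), of x y "sort w" u] False le by simp
    ultimately have "sort_corr G u (y # x # w) - sort_corr G u (x # y # w) = G (u @ bracket (e y) (e x) # map e w)"
      by (simp add: algebra_simps)
    moreover have "G (u @ (- bracket (e y) (e x)) # map e w) = - G (u @ bracket (e y) (e x) # map e w)"
      using le.prems by (intro multilinear_on_minus[OF assms(2)]) simp
    moreover have "- bracket (e y) (e x) = bracket (e x) (e y)" by (rule bracket_swap[symmetric])
    ultimately show ?thesis by (simp add: algebra_simps del: sort_corr.simps)
  qed
qed

lemma sort_corr_swap_inside:
  assumes "exchanges N G G'" "multilinear_on N G" "multilinear_on (N - 1) G'"
  shows "length u + length p + length w + 1 = N \<Longrightarrow>
    sort_corr G u (p @ x # y # w) - sort_corr G u (p @ y # x # w) = G (u @ map e p @ bracket (e x) (e y) # map e w)"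
proof (induction p arbitrary: u)
  case Nil
  then show ?case using sort_corr_swap[OF assms] by simp
next
  case (Cons z p)
  have "sort (p @ x # y # w) = sort (p @ y # x # w)"
    by (intro properties_for_sort) simp_all
  then show ?case using Cons.IH[of "u @ [e z]"] Cons.prems by simp
qed

fun extend :: "(nat list \<Rightarrow> 'd) \<Rightarrow> 'd list \<Rightarrow> 'd" where
  "extend f [] = f []"
| "extend f (x # xs) = (\<Sum>i<n. scale (coord x i) (extend (\<lambda>w. f (i # w)) xs))"

lemma extend_basis: "set w \<subseteq> {..<n} \<Longrightarrow> extend f (map e w) = f w"
proof (induction w arbitrary: f)
  case Nil
  then show ?case by simp
next
  case (Cons i w)
  then show ?case
    by (simp add: coord_basis if_distrib[of "\<lambda>c. scale c _"] cong: if_cong)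
qed

lemma extend_linear: "Vector_Spaces.linear scale scale (\<lambda>x. extend f (u @ x # v))"
proof (induction u arbitrary: f)
  case Nil
  show ?case
    by (rule linear_endoI)
      (simp_all add: coord_add coord_scale scale_left_distrib sum.distrib scale_sum_right)
next
  case (Cons y u)
  then have "extend f' (u @ (a + b) # v) = extend f' (u @ a # v) + extend f' (u @ b # v)"
    "extend f' (u @ scale c a # v) = scale c (extend f' (u @ a # v))" for a b c f'
    unfolding Vector_Spaces.linear_iff by blast+
  then show ?case
    by (intro linear_endoI)
      (simp_all add: scale_right_distrib sum.distrib scale_sum_right mult.commute)
qed

text \<open>Sorted words of length at least two are sent to \<open>0\<close>, so that the value on a longer word is the cost
of sorting it. The value \<open>0\<close> in length zero is arbitrary: no word of length one has two letters to
exchange.\<close>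

primrec retract :: "nat \<Rightarrow> 'd list \<Rightarrow> 'd" where
  "retract 0 = (\<lambda>w. 0)"
| "retract (Suc N) = (if N = 0 then hd else extend (sort_corr (retract N) []))"

lemma multilinear_on_retract: "multilinear_on N (retract N)"
proof (cases N)
  case (Suc M)
  then show ?thesis
    unfolding multilinear_on_def by (auto simp: extend_linear intro: linear_endoI)
qed (simp add: multilinear_on_def)

text \<open>The defect of the exchange rule is linear in each of the two exchanged letters and multilinear in
the words around them, so it vanishes if it vanishes on basis vectors.\<close>

lemma exchanges_by_basis:
  assumes K: "multilinear_on (Suc N) K" and L: "multilinear_on N L"
    and *: "\<And>u x y v. length u + length v + 1 = N \<Longrightarrow> set (u @ x # y # v) \<subseteq> {..<n} \<Longrightarrow>
      K (map e u @ e x # e y # map e v) - K (map e u @ e y # e x # map e v) = L (map e u @ bracket (e x) (e y) # map e v)"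
  shows "exchanges (Suc N) K L"
proof -
  define D where "D u x y v = K (u @ x # y # v) - K (u @ y # x # v) - L (u @ bracket x y # v)" for u x y v
  have D_zero: "D u x y v = 0" if len: "length u + length v + 1 = N" for u x y v
  proof -
    have K1: "Vector_Spaces.linear scale scale (\<lambda>x. K (u @ x # y # v))"
      and K2: "Vector_Spaces.linear scale scale (\<lambda>x. K (u @ y # x # v))"
      and L1: "Vector_Spaces.linear scale scale (\<lambda>x. L (u @ x # v))"
      if "length u + length v + 1 = N" for u v y
      using that multilinear_onD[OF K, of u "y # v"] multilinear_onD[OF K, of "u @ [y]" v] multilinear_onD[OF L, of u v] by auto
    have linx: "Vector_Spaces.linear scale scale (\<lambda>x. D u x y v)" if "length u + length v + 1 = N" for u y v
      unfolding D_def
      by (intro linear_diff K1 K2 that linear_endoI)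
        (use L1[OF that] in \<open>auto simp: bracket_add_left bracket_scale_left Vector_Spaces.linear_iff\<close>)
    have liny: "Vector_Spaces.linear scale scale (\<lambda>y. D u x y v)" if "length u + length v + 1 = N" for u x v
      unfolding D_def
      by (intro linear_diff K1 K2 that linear_endoI)
        (use L1[OF that] in \<open>auto simp: bracket_add_right bracket_scale_right Vector_Spaces.linear_iff\<close>)
    have linv: "multilinear_on M (\<lambda>v. D u x y v)" if "length u + M + 1 = N" for u x y M
      unfolding D_def
      using that multilinear_on_prefix[of "u @ [x, y]" M K] multilinear_on_prefix[of "u @ [y, x]" M K]
        multilinear_on_prefix[of "u @ [bracket x y]" M L] K L
      by (intro multilinear_on_diff) (auto simp: add.commute)
    have linu: "multilinear_on M (\<lambda>u. D u x y v)" if "M + length v + 1 = N" for v x y M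
      unfolding D_def
      using that multilinear_on_suffix[of M "x # y # v" K] multilinear_on_suffix[of M "y # x # v" K]
        multilinear_on_suffix[of M "bracket x y # v" L] K L
      by (intro multilinear_on_diff) auto
    \<comment> \<open>Basis vectors are replaced by arbitrary ones in \<open>v\<close>, then in \<open>y\<close>, \<open>x\<close> and finally in \<open>u\<close>.\<close>
    have 1: "D (map e u) (e x) (e y) (map e v) = 0"
      if "length u + length v + 1 = N" "set (u @ x # y # v) \<subseteq> {..<n}" for u x y v
      using *[OF that] by (simp add: D_def)
    have 2: "D (map e u) (e x) (e y) v = 0"
      if "length u + length v + 1 = N" "set (u @ [x, y]) \<subseteq> {..<n}" for u x y v
      by (rule multilinear_on_zeroI[OF linv[of _ "length v"]]) (use that in simp, rule 1, use that in auto)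
    have lin0: "Vector_Spaces.linear scale scale (\<lambda>x. 0)" by (rule linear_endoI) simp_all
    have 3: "D (map e u) x y v = 0"
      if "length u + length v + 1 = N" "set u \<subseteq> {..<n}" for u x y v
    proof (rule linear_eq_on_basis[OF linx lin0])
      fix i assume "i < n"
      show "D (map e u) (e i) y v = 0"
        by (rule linear_eq_on_basis[OF liny lin0]) (use that in simp, rule 2, use that \<open>i < n\<close> in auto)
    qed (use that in auto)
    show ?thesis
      by (rule multilinear_on_zeroI[OF linu[of "length u"]]) (use len in simp, rule 3, use len in auto)
  qed
  show ?thesis
    unfolding exchanges_def using D_zero unfolding D_def by auto
qed

lemma exchanges_retract: "exchanges (Suc N) (retract (Suc N)) (retract N)"
proof (induction N)
  case 0
  show ?case by (simp add: exchanges_def)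
next
  case (Suc N)
  show ?case
  proof (rule exchanges_by_basis[OF multilinear_on_retract multilinear_on_retract])
    fix u x y v assume *: "length u + length v + 1 = Suc N" "set (u @ x # y # v) \<subseteq> {..<n}"
    have "retract (Suc (Suc N)) (map e w) = sort_corr (retract (Suc N)) [] w" if "set w \<subseteq> {..<n}" for w
      using extend_basis[OF that] by simp
    from this[of "u @ x # y # v"] this[of "u @ y # x # v"]
    show "retract (Suc (Suc N)) (map e u @ e x # e y # map e v) - retract (Suc (Suc N)) (map e u @ e y # e x # map e v)
        = retract (Suc N) (map e u @ bracket (e x) (e y) # map e v)"
      using sort_corr_swap_inside[OF Suc.IH multilinear_on_retract, of "[]" u v x y] * multilinear_on_retract[of N]
      by (simp del: retract.simps)
  qed
qed

definition word_retract :: "'d list \<Rightarrow> 'd" where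
  "word_retract w = retract (length w) w"

lemma word_retract_single: "word_retract [x] = x"
  by (simp add: word_retract_def)

lemma word_retract_linear: "Vector_Spaces.linear scale scale (\<lambda>x. word_retract (u @ x # v))"
  using multilinear_onD[OF multilinear_on_retract, of u v] by (simp add: word_retract_def del: retract.simps)

lemma word_retract_exchange:
  "word_retract (u @ x # y # v) - word_retract (u @ y # x # v) = word_retract (u @ bracket x y # v)"
  using exchanges_retract[of "Suc (length u + length v)"]
  by (auto simp: word_retract_def exchanges_def simp del: retract.simps)

end

section \<open>Algebras over a field\<close>

text \<open>The scalars are the elements of a type of class \<open>field\<close>, while the algebra, which may be
noncommutative, has a carrier set.\<close>

locale field_algebra = ring A for A :: "('k::field, 'a) module" (structure) +
  assumes smult_closed [intro, simp]: "x \<in> carrier A \<Longrightarrow> c \<odot> x \<in> carrier A"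
    and smult_add_left: "x \<in> carrier A \<Longrightarrow> (c + d) \<odot> x = c \<odot> x \<oplus> d \<odot> x"
    and smult_add_right: "x \<in> carrier A \<Longrightarrow> y \<in> carrier A \<Longrightarrow> c \<odot> (x \<oplus> y) = c \<odot> x \<oplus> c \<odot> y"
    and smult_smult: "x \<in> carrier A \<Longrightarrow> c \<odot> (d \<odot> x) = (c * d) \<odot> x"
    and smult_one [simp]: "x \<in> carrier A \<Longrightarrow> 1 \<odot> x = x"
    and smult_mult_left: "x \<in> carrier A \<Longrightarrow> y \<in> carrier A \<Longrightarrow> (c \<odot> x) \<otimes> y = c \<odot> (x \<otimes> y)"
    and smult_mult_right: "x \<in> carrier A \<Longrightarrow> y \<in> carrier A \<Longrightarrow> x \<otimes> (c \<odot> y) = c \<odot> (x \<otimes> y)"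
begin

lemma smult_zero_left [simp]: "x \<in> carrier A \<Longrightarrow> 0 \<odot> x = \<zero>"
  using smult_add_left[of x 0 0] by (metis add.l_cancel_one' add.one_closed add_0 smult_closed)

lemma smult_zero_right [simp]: "c \<odot> \<zero> = \<zero>"
  using smult_add_right[of \<zero> \<zero> c] by (metis add.l_cancel_one' add.one_closed smult_closed l_zero)

lemma smult_minus_one: "x \<in> carrier A \<Longrightarrow> (- 1) \<odot> x = \<ominus> x"
  using smult_add_left[of x "- 1" 1] by (simp add: minus_equality)

lemma smult_finsum:
  "finite S \<Longrightarrow> f \<in> S \<rightarrow> carrier A \<Longrightarrow> c \<odot> (\<Oplus>i\<in>S. f i) = (\<Oplus>i\<in>S. c \<odot> f i)"
  by (induction S rule: finite_induct) (simp_all add: smult_add_right Pi_def)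

end

lemma (in ring) commutator_closed [simp]:
  "x \<in> carrier R \<Longrightarrow> y \<in> carrier R \<Longrightarrow> commutator R x y \<in> carrier R"
  by (simp add: commutator_def)

definition algebra_linear :: "('k::field, 'a) module \<Rightarrow> ('k, 'b) module \<Rightarrow> ('a \<Rightarrow> 'b) \<Rightarrow> bool" where
  "algebra_linear A B T \<longleftrightarrow> T \<in> carrier A \<rightarrow> carrier B \<and>
     (\<forall>x\<in>carrier A. \<forall>y\<in>carrier A. T (x \<oplus>\<^bsub>A\<^esub> y) = T x \<oplus>\<^bsub>B\<^esub> T y) \<and>
     (\<forall>c. \<forall>x\<in>carrier A. T (c \<odot>\<^bsub>A\<^esub> x) = c \<odot>\<^bsub>B\<^esub> T x)"

lemma algebra_linearD:
  assumes "algebra_linear A B T" "x \<in> carrier A"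
  shows "T x \<in> carrier B" "y \<in> carrier A \<Longrightarrow> T (x \<oplus>\<^bsub>A\<^esub> y) = T x \<oplus>\<^bsub>B\<^esub> T y" "T (c \<odot>\<^bsub>A\<^esub> x) = c \<odot>\<^bsub>B\<^esub> T x"
  using assms unfolding algebra_linear_def by auto

lemma algebra_linear_finsum:
  assumes A: "field_algebra A" and B: "field_algebra B" and T: "algebra_linear A B T"
    and S: "finite S" "f \<in> S \<rightarrow> carrier A"
  shows "T (\<Oplus>\<^bsub>A\<^esub>i\<in>S. f i) = (\<Oplus>\<^bsub>B\<^esub>i\<in>S. T (f i))"
proof -
  interpret A: field_algebra A by fact
  interpret B: field_algebra B by fact
  have "T \<zero>\<^bsub>A\<^esub> = \<zero>\<^bsub>B\<^esub>"
    using algebra_linearD(3)[OF T A.zero_closed, of 0] algebra_linearD(1)[OF T A.zero_closed] by simp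
  with S show ?thesis
    by (induction S rule: finite_induct) (simp_all add: algebra_linearD[OF T] Pi_def)
qed

lemma algebra_linear_minus:
  assumes A: "field_algebra A" and B: "field_algebra B" and T: "algebra_linear A B T"
    and "x \<in> carrier A" "y \<in> carrier A"
  shows "T (x \<ominus>\<^bsub>A\<^esub> y) = T x \<ominus>\<^bsub>B\<^esub> T y"
proof -
  interpret A: field_algebra A by fact
  interpret B: field_algebra B by fact
  show ?thesis using assms(4,5)
    by (simp add: a_minus_def algebra_linearD[OF T] flip: A.smult_minus_one B.smult_minus_one)
qed

lemma algebra_linear_compose:
  "algebra_linear A B F \<Longrightarrow> algebra_linear B C G \<Longrightarrow> algebra_linear A C (\<lambda>x. G (F x))"
  unfolding algebra_linear_def by (simp add: Pi_def)

lemma algebra_linear_add: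
  assumes B: "field_algebra B" and F: "algebra_linear A B F" and G: "algebra_linear A B G"
  shows "algebra_linear A B (\<lambda>x. F x \<oplus>\<^bsub>B\<^esub> G x)"
proof -
  interpret B: field_algebra B by fact
  show ?thesis
    unfolding algebra_linear_def
    by (auto simp: algebra_linearD[OF F] algebra_linearD[OF G] B.smult_add_right B.a_ac)
qed

lemma algebra_linear_id: "algebra_linear A A (\<lambda>x. x)"
  unfolding algebra_linear_def by simp

context field_algebra
begin

lemma mult_linear_left:
  "y \<in> carrier A \<Longrightarrow> algebra_linear A A (\<lambda>x. x \<otimes> y)"
  unfolding algebra_linear_def by (auto simp: l_distr smult_mult_left)

lemma commutator_linear_left:
  assumes y: "y \<in> carrier A"
  shows "algebra_linear A A (\<lambda>x. commutator A x y)"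
  unfolding algebra_linear_def commutator_def a_minus_def using y
  by (auto simp: l_distr r_distr minus_add a_ac smult_mult_left smult_mult_right smult_add_right smult_smult
      simp flip: smult_minus_one)

lemma commutator_linear_right:
  assumes y: "y \<in> carrier A"
  shows "algebra_linear A A (\<lambda>x. commutator A y x)"
  unfolding algebra_linear_def commutator_def a_minus_def using y
  by (auto simp: l_distr r_distr minus_add a_ac smult_mult_left smult_mult_right smult_add_right smult_smult
      simp flip: smult_minus_one)

end

section \<open>Linear extension\<close>

text \<open>A function \<open>f\<close> of finite support stands for the formal linear combination of points with
coefficients \<open>f w\<close>; then \<open>lin s F\<close> is the linear extension of \<open>F\<close>.\<close>

definition lin :: "('k::field \<Rightarrow> 'v::ab_group_add \<Rightarrow> 'v) \<Rightarrow> ('m \<Rightarrow> 'v) \<Rightarrow> ('m \<Rightarrow> 'k) \<Rightarrow> 'v" where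
  "lin s F f = (\<Sum>w | f w \<noteq> 0. s (f w) (F w))"

lemma vector_space_field: "vector_space ((*) :: 'k::field \<Rightarrow> 'k \<Rightarrow> 'k)"
  by unfold_locales (simp_all add: algebra_simps)

context vector_space
begin

lemma lin_superset:
  assumes "finite S" "{w. f w \<noteq> 0} \<subseteq> S"
  shows "lin scale F f = (\<Sum>w\<in>S. scale (f w) (F w))"
  unfolding lin_def using assms by (intro sum.mono_neutral_left) auto

lemma lin_add:
  assumes "finite {w. f w \<noteq> 0}" "finite {w. g w \<noteq> 0}"
  shows "lin scale F (\<lambda>w. f w + g w) = lin scale F f + lin scale F g"
proof -
  let ?S = "{w. f w \<noteq> 0} \<union> {w. g w \<noteq> 0}"
  have "finite ?S" using assms by simp
  then have "lin scale F (\<lambda>w. f w + g w) = (\<Sum>w\<in>?S. scale (f w + g w) (F w))"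
    "lin scale F f = (\<Sum>w\<in>?S. scale (f w) (F w))" "lin scale F g = (\<Sum>w\<in>?S. scale (g w) (F w))"
    by (auto intro!: lin_superset)
  then show ?thesis by (simp add: scale_left_distrib sum.distrib)
qed

lemma lin_smult: "lin scale F (\<lambda>w. c * f w) = scale c (lin scale F f)"
  unfolding lin_def by (cases "c = 0") (simp_all add: scale_sum_right)

lemma lin_zero: "lin scale F (\<lambda>w. 0) = 0"
  unfolding lin_def by simp

lemma lin_single: "lin scale F (single m) = F m"
  using lin_superset[of "{m}" "single m" F] by (auto simp: single_def split: if_splits)

lemma lin_swap:
  "lin scale (\<lambda>a. lin scale (\<lambda>b. F a b) g) f = lin scale (\<lambda>b. lin scale (\<lambda>a. F a b) f) g"
  unfolding lin_def scale_sum_right scale_scale by (subst sum.swap) (simp add: mult.commute)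

lemma lin_cong: "(\<And>w. f w \<noteq> 0 \<Longrightarrow> F w = G w) \<Longrightarrow> lin scale F f = lin scale G f"
  unfolding lin_def by (intro sum.cong) auto

lemma lin_add_fun: "lin scale (\<lambda>w. F w + G w) f = lin scale F f + lin scale G f"
  unfolding lin_def by (simp add: scale_right_distrib sum.distrib)

lemma lin_scale_fun: "lin scale (\<lambda>w. scale c (F w)) f = scale c (lin scale F f)"
  unfolding lin_def by (simp add: scale_sum_right mult.commute)

lemma lin_pushforward:
  assumes "finite {m. f m \<noteq> 0}"
  shows "lin scale F (pushforward p f) = lin scale (\<lambda>m. F (p m)) f"
proof -
  let ?S = "{m. f m \<noteq> 0}"
  have supp: "{m'. pushforward p f m' \<noteq> 0} \<subseteq> p ` ?S"
    unfolding pushforward_def by (auto elim!: sum.not_neutral_contains_not_neutral)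
  have "lin scale F (pushforward p f) = (\<Sum>m'\<in>p ` ?S. scale (pushforward p f m') (F m'))"
    using assms supp by (intro lin_superset) auto
  also have "\<dots> = (\<Sum>m'\<in>p ` ?S. \<Sum>m | m \<in> ?S \<and> p m = m'. scale (f m) (F (p m)))"
    unfolding pushforward_def by (intro sum.cong) (simp_all add: scale_sum_left)
  also have "\<dots> = lin scale (\<lambda>m. F (p m)) f"
    unfolding lin_def using assms by (intro sum.group) auto
  finally show ?thesis .
qed

text \<open>Linear extensions turn the convolution product into an iterated sum. All sums over the fibres of
the multiplication disappear here, and associativity becomes that of the monoid.\<close>

lemma lin_mult:
  assumes "finite {m. f m \<noteq> 0}" "finite {m. g m \<noteq> 0}"
  shows "lin scale F (f \<otimes>\<^bsub>monoid_algebra M\<^esub> g)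
    = lin scale (\<lambda>a. lin scale (\<lambda>b. F (a \<otimes>\<^bsub>M\<^esub> b)) g) f"
proof -
  let ?A = "{m. f m \<noteq> 0}" and ?B = "{m. g m \<noteq> 0}" and ?p = "\<lambda>(a, b). a \<otimes>\<^bsub>M\<^esub> b"
  have fg: "(f \<otimes>\<^bsub>monoid_algebra M\<^esub> g) m = (\<Sum>x | x \<in> ?A \<times> ?B \<and> ?p x = m. f (fst x) * g (snd x))" for m
    unfolding monoid_algebra_def by (auto intro!: sum.cong)
  have supp: "{m. (f \<otimes>\<^bsub>monoid_algebra M\<^esub> g) m \<noteq> 0} \<subseteq> ?p ` (?A \<times> ?B)"
    unfolding fg by (auto elim!: sum.not_neutral_contains_not_neutral)
  have "lin scale F (f \<otimes>\<^bsub>monoid_algebra M\<^esub> g)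
      = (\<Sum>m\<in>?p ` (?A \<times> ?B). scale ((f \<otimes>\<^bsub>monoid_algebra M\<^esub> g) m) (F m))"
    using assms supp by (intro lin_superset) auto
  also have "\<dots> = (\<Sum>m\<in>?p ` (?A \<times> ?B). \<Sum>x | x \<in> ?A \<times> ?B \<and> ?p x = m. scale (f (fst x) * g (snd x)) (F (?p x)))"
    unfolding fg by (intro sum.cong) (simp_all add: scale_sum_left)
  also have "\<dots> = (\<Sum>x\<in>?A \<times> ?B. scale (f (fst x) * g (snd x)) (F (?p x)))"
    using assms by (intro sum.group) auto
  also have "\<dots> = lin scale (\<lambda>a. lin scale (\<lambda>b. F (a \<otimes>\<^bsub>M\<^esub> b)) g) f"
    unfolding lin_def by (simp add: sum.cartesian_product scale_sum_right split_beta)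
  finally show ?thesis .
qed

end

section \<open>Monoid algebras\<close>

lemma monoid_algebra_simps:
  "carrier (monoid_algebra M) = {f. finite {m. f m \<noteq> 0} \<and> {m. f m \<noteq> 0} \<subseteq> carrier M}"
  "\<one>\<^bsub>monoid_algebra M\<^esub> = single \<one>\<^bsub>M\<^esub>"
  "\<zero>\<^bsub>monoid_algebra M\<^esub> = (\<lambda>m. 0)"
  "f \<oplus>\<^bsub>monoid_algebra M\<^esub> g = (\<lambda>m. f m + g m)"
  "c \<odot>\<^bsub>monoid_algebra M\<^esub> f = (\<lambda>m. c * f m)"
  by (simp_all add: monoid_algebra_def single_def)

lemma single_closed: "m \<in> carrier M \<Longrightarrow> single m \<in> carrier (monoid_algebra M)"
  by (auto simp: monoid_algebra_simps single_def)

text \<open>Indicator functions \<open>F\<close> pick out the single coefficients.\<close>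

lemma lin_eqI:
  fixes f g :: "'m \<Rightarrow> 'k::field"
  assumes "f \<in> carrier (monoid_algebra M)" "g \<in> carrier (monoid_algebra M)"
    and "\<And>F. lin (*) F f = lin (*) F g"
  shows "f = g"
proof
  fix m
  have "lin (*) (\<lambda>w. single w m) h = h m" if "finite {w. h w \<noteq> 0}" for h :: "'m \<Rightarrow> 'k"
  proof -
    have "lin (*) (\<lambda>w. single w m) h = (\<Sum>w | h w \<noteq> 0. if w = m then h w else 0)"
      unfolding lin_def single_def by (intro sum.cong) auto
    then show ?thesis using that by (cases "h m = 0") simp_all
  qed
  from this[of f] this[of g] show "f m = g m" using assms by (auto simp: monoid_algebra_simps)
qed

lemma finite_support: "f \<in> carrier (monoid_algebra M) \<Longrightarrow> finite {m. f m \<noteq> 0}"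
  by (simp add: monoid_algebra_simps)

lemma support_closed: "f \<in> carrier (monoid_algebra M) \<Longrightarrow> f m \<noteq> 0 \<Longrightarrow> m \<in> carrier M"
  by (auto simp: monoid_algebra_simps)

lemma (in monoid) monoid_algebra_mult_closed:
  assumes "f \<in> carrier (monoid_algebra G)" "g \<in> carrier (monoid_algebra G)"
  shows "f \<otimes>\<^bsub>monoid_algebra G\<^esub> g \<in> carrier (monoid_algebra G)"
proof -
  let ?A = "{m. f m \<noteq> 0}" and ?B = "{m. g m \<noteq> 0}" and ?p = "\<lambda>(a, b). a \<otimes> b"
  have "{m. (f \<otimes>\<^bsub>monoid_algebra G\<^esub> g) m \<noteq> 0} \<subseteq> ?p ` (?A \<times> ?B)"
    unfolding monoid_algebra_def by (auto elim!: sum.not_neutral_contains_not_neutral)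
  moreover have "finite (?p ` (?A \<times> ?B))" "?p ` (?A \<times> ?B) \<subseteq> carrier G"
    using assms by (auto simp: monoid_algebra_simps)
  ultimately have "finite {m. (f \<otimes>\<^bsub>monoid_algebra G\<^esub> g) m \<noteq> 0}"
    "{m. (f \<otimes>\<^bsub>monoid_algebra G\<^esub> g) m \<noteq> 0} \<subseteq> carrier G"
    by (auto intro: finite_subset)
  then show ?thesis by (simp add: monoid_algebra_simps)
qed

lemmas field_lin_add_fun = vector_space.lin_add_fun[OF vector_space_field]
lemmas field_lin_cong = vector_space.lin_cong[OF vector_space_field]
lemmas field_lin_pushforward = vector_space.lin_pushforward[OF vector_space_field]
lemmas field_lin_scale_fun = vector_space.lin_scale_fun[OF vector_space_field]
lemmas field_lin_single = vector_space.lin_single[OF vector_space_field]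

lemma monoid_algebra_add_closed:
  assumes "f \<in> carrier (monoid_algebra M)" "g \<in> carrier (monoid_algebra M)"
  shows "f \<oplus>\<^bsub>monoid_algebra M\<^esub> g \<in> carrier (monoid_algebra M)"
proof -
  have "{m. f m + g m \<noteq> 0} \<subseteq> {m. f m \<noteq> 0} \<union> {m. g m \<noteq> 0}" by auto
  with assms show ?thesis
    unfolding monoid_algebra_simps by (auto intro: finite_subset)
qed

lemma lin_alg_add:
  "vector_space s \<Longrightarrow> f \<in> carrier (monoid_algebra M) \<Longrightarrow> g \<in> carrier (monoid_algebra M) \<Longrightarrow>
    lin s F (f \<oplus>\<^bsub>monoid_algebra M\<^esub> g) = lin s F f + lin s F g"
  by (simp add: monoid_algebra_simps vector_space.lin_add)

lemma lin_alg_smult: "vector_space s \<Longrightarrow> lin s F (c \<odot>\<^bsub>monoid_algebra M\<^esub> f) = s c (lin s F f)"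
  by (simp add: monoid_algebra_simps vector_space.lin_smult)

lemma lin_alg_mult:
  "vector_space s \<Longrightarrow> f \<in> carrier (monoid_algebra M) \<Longrightarrow> g \<in> carrier (monoid_algebra M) \<Longrightarrow>
    lin s F (f \<otimes>\<^bsub>monoid_algebra M\<^esub> g) = lin s (\<lambda>a. lin s (\<lambda>b. F (a \<otimes>\<^bsub>M\<^esub> b)) g) f"
  by (simp add: finite_support vector_space.lin_mult)

theorem (in monoid) field_algebra_monoid_algebra: "field_algebra (monoid_algebra G :: ('k::field, _) module)"
proof -
  let ?R = "monoid_algebra G :: ('k, _) module"
  note closed = monoid_algebra_mult_closed monoid_algebra_add_closed single_closed
  note lin = lin_alg_add[OF vector_space_field] lin_alg_smult[OF vector_space_field]
    lin_alg_mult[OF vector_space_field] field_lin_single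
  have smult_closed: "c \<odot>\<^bsub>?R\<^esub> f \<in> carrier ?R" if "f \<in> carrier ?R" for c f
  proof -
    have "{m. c * f m \<noteq> 0} \<subseteq> {m. f m \<noteq> 0}" by auto
    with that show ?thesis unfolding monoid_algebra_simps by (auto intro: finite_subset)
  qed
  have ring: "ring ?R"
  proof (rule ringI)
    show "abelian_group ?R"
    proof (rule abelian_groupI)
      fix f assume f: "f \<in> carrier ?R"
      show "\<exists>g\<in>carrier ?R. g \<oplus>\<^bsub>?R\<^esub> f = \<zero>\<^bsub>?R\<^esub>"
        by (rule bexI[OF _ smult_closed[OF f, of "- 1"]]) (simp add: monoid_algebra_simps)
    next
      show "\<zero>\<^bsub>?R\<^esub> \<in> carrier ?R" by (simp add: monoid_algebra_simps)
    qed (rule closed(2), assumption+, simp_all add: monoid_algebra_simps(3,4) ac_simps)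
    show "Group.monoid ?R"
    proof (rule monoidI)
      fix f g h assume *: "f \<in> carrier ?R" "g \<in> carrier ?R" "h \<in> carrier ?R"
      show "f \<otimes>\<^bsub>?R\<^esub> g \<otimes>\<^bsub>?R\<^esub> h = f \<otimes>\<^bsub>?R\<^esub> (g \<otimes>\<^bsub>?R\<^esub> h)"
        using * by (intro lin_eqI[of _ G] closed)
          (auto simp: lin closed m_assoc[OF *(1,2,3)[THEN support_closed]] intro!: field_lin_cong)
    next
      fix f assume f: "f \<in> carrier ?R"
      have one: "single \<one> \<in> carrier ?R" by (rule closed(3)) simp
      show "\<one>\<^bsub>?R\<^esub> \<otimes>\<^bsub>?R\<^esub> f = f" unfolding monoid_algebra_simps(2)
      proof (rule lin_eqI[of _ G])
        show "lin (*) F (single \<one> \<otimes>\<^bsub>?R\<^esub> f) = lin (*) F f" for F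
          unfolding lin(3)[OF one f] lin(4) by (rule field_lin_cong) (simp add: support_closed[OF f])
      qed (rule closed(1) one f)+
      show "f \<otimes>\<^bsub>?R\<^esub> \<one>\<^bsub>?R\<^esub> = f" unfolding monoid_algebra_simps(2)
      proof (rule lin_eqI[of _ G])
        show "lin (*) F (f \<otimes>\<^bsub>?R\<^esub> single \<one>) = lin (*) F f" for F
          unfolding lin(3)[OF f one] lin(4) by (rule field_lin_cong) (simp add: support_closed[OF f])
      qed (rule closed(1) one f)+
    next
      show "\<one>\<^bsub>?R\<^esub> \<in> carrier ?R" unfolding monoid_algebra_simps(2) by (rule closed(3)) simp
    qed (rule closed(1))
    fix f g h assume *: "f \<in> carrier ?R" "g \<in> carrier ?R" "h \<in> carrier ?R"
    show "(f \<oplus>\<^bsub>?R\<^esub> g) \<otimes>\<^bsub>?R\<^esub> h = f \<otimes>\<^bsub>?R\<^esub> h \<oplus>\<^bsub>?R\<^esub> g \<otimes>\<^bsub>?R\<^esub> h"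
      by (rule lin_eqI[of _ G]) (simp_all add: lin closed *)
    show "h \<otimes>\<^bsub>?R\<^esub> (f \<oplus>\<^bsub>?R\<^esub> g) = h \<otimes>\<^bsub>?R\<^esub> f \<oplus>\<^bsub>?R\<^esub> h \<otimes>\<^bsub>?R\<^esub> g"
      by (rule lin_eqI[of _ G]) (simp_all add: lin closed * field_lin_add_fun)
  qed
  show ?thesis
  proof (intro field_algebra.intro ring field_algebra_axioms.intro smult_closed)
    fix f g and c d :: 'k assume *: "f \<in> carrier ?R" "g \<in> carrier ?R"
    show "(c \<odot>\<^bsub>?R\<^esub> f) \<otimes>\<^bsub>?R\<^esub> g = c \<odot>\<^bsub>?R\<^esub> (f \<otimes>\<^bsub>?R\<^esub> g)"
      by (rule lin_eqI[of _ G]) (simp_all add: lin closed smult_closed *)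
    show "f \<otimes>\<^bsub>?R\<^esub> (c \<odot>\<^bsub>?R\<^esub> g) = c \<odot>\<^bsub>?R\<^esub> (f \<otimes>\<^bsub>?R\<^esub> g)"
      by (rule lin_eqI[of _ G]) (simp_all add: lin closed smult_closed * field_lin_scale_fun)
    show "(c + d) \<odot>\<^bsub>?R\<^esub> f = c \<odot>\<^bsub>?R\<^esub> f \<oplus>\<^bsub>?R\<^esub> d \<odot>\<^bsub>?R\<^esub> f"
      by (simp add: monoid_algebra_simps(4,5) distrib_right)
    show "c \<odot>\<^bsub>?R\<^esub> (f \<oplus>\<^bsub>?R\<^esub> g) = c \<odot>\<^bsub>?R\<^esub> f \<oplus>\<^bsub>?R\<^esub> c \<odot>\<^bsub>?R\<^esub> g"
      by (simp add: monoid_algebra_simps(4,5) distrib_left)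
    show "c \<odot>\<^bsub>?R\<^esub> (d \<odot>\<^bsub>?R\<^esub> f) = (c * d) \<odot>\<^bsub>?R\<^esub> f"
      by (simp add: monoid_algebra_simps(5) mult.assoc)
    show "1 \<odot>\<^bsub>?R\<^esub> f = f"
      by (simp add: monoid_algebra_simps(5))
  qed
qed

lemma (in monoid) single_mult:
  assumes "a \<in> carrier G" "b \<in> carrier G"
  shows "single a \<otimes>\<^bsub>monoid_algebra G\<^esub> single b = (single (a \<otimes> b) :: _ \<Rightarrow> 'k::field)"
  by (rule lin_eqI[of _ G])
    (simp_all add: lin_alg_mult[OF vector_space_field] single_closed assms field_lin_single monoid_algebra_mult_closed)

lemma monoid_algebra_minus:
  assumes "Group.monoid M" "f \<in> carrier (monoid_algebra M)" "g \<in> carrier (monoid_algebra M :: ('k::field, _) module)"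
  shows "f \<ominus>\<^bsub>monoid_algebra M\<^esub> g = f \<oplus>\<^bsub>monoid_algebra M\<^esub> ((- 1) \<odot>\<^bsub>monoid_algebra M\<^esub> g)"
proof -
  interpret field_algebra "monoid_algebra M :: ('k, _) module"
    by (rule monoid.field_algebra_monoid_algebra) fact
  show ?thesis unfolding smult_minus_one[OF assms(3)] a_minus_def ..
qed

lemma lin_alg_minus:
  assumes s: "vector_space (s :: 'k::field \<Rightarrow> 'v::ab_group_add \<Rightarrow> 'v)" and M: "Group.monoid M"
    and f: "f \<in> carrier (monoid_algebra M)" and g: "g \<in> carrier (monoid_algebra M)"
  shows "lin s F (f \<ominus>\<^bsub>monoid_algebra M\<^esub> g) = lin s F f - lin s F g"
proof -
  interpret vector_space s by fact
  interpret field_algebra "monoid_algebra M :: ('k, _) module"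
    by (rule monoid.field_algebra_monoid_algebra) fact
  have "lin s F (f \<ominus>\<^bsub>monoid_algebra M\<^esub> g) = lin s F f + s (- 1) (lin s F g)"
    unfolding monoid_algebra_minus[OF M f g] lin_alg_add[OF s f smult_closed[OF g]] lin_alg_smult[OF s] ..
  then show ?thesis by simp
qed

lemma pushforward_single: "pushforward p (single m) = (single (p m) :: _ \<Rightarrow> 'k::field)"
proof
  fix m'
  have "{x. (single m x :: 'k) \<noteq> 0 \<and> p x = m'} = (if p m = m' then {m} else {})" by (auto simp: single_def)
  then show "pushforward p (single m) m' = (single (p m) m' :: 'k)"
    by (simp add: pushforward_def single_def)
qed

lemma pushforward_closed:
  assumes "f \<in> carrier (monoid_algebra M)" "\<And>m. m \<in> carrier M \<Longrightarrow> p m \<in> carrier N"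
  shows "pushforward p f \<in> carrier (monoid_algebra N)"
proof -
  have "{m'. pushforward p f m' \<noteq> 0} \<subseteq> p ` {m. f m \<noteq> 0}"
    unfolding pushforward_def by (auto elim!: sum.not_neutral_contains_not_neutral)
  moreover have "finite (p ` {m. f m \<noteq> 0})" "p ` {m. f m \<noteq> 0} \<subseteq> carrier N"
    using assms by (auto simp: monoid_algebra_simps)
  ultimately have "finite {m'. pushforward p f m' \<noteq> 0}" "{m'. pushforward p f m' \<noteq> 0} \<subseteq> carrier N"
    by (auto intro: finite_subset)
  then show ?thesis by (simp add: monoid_algebra_simps)
qed

lemma pushforward_hom:
  assumes p: "p \<in> hom M N" and one: "p \<one>\<^bsub>M\<^esub> = \<one>\<^bsub>N\<^esub>" and M: "Group.monoid M" and N: "Group.monoid N"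
  shows "pushforward p \<in> Ring.ring_hom (monoid_algebra M :: ('k::field, _) module) (monoid_algebra N)"
    and "f \<in> carrier (monoid_algebra M :: ('k::field, _) module) \<Longrightarrow>
      pushforward p (c \<odot>\<^bsub>monoid_algebra M\<^esub> f) = c \<odot>\<^bsub>monoid_algebra N\<^esub> pushforward p f"
proof -
  let ?R = "monoid_algebra M :: ('k, _) module" and ?S = "monoid_algebra N :: ('k, _) module"
  interpret field_algebra ?R
    by (rule monoid.field_algebra_monoid_algebra) fact
  interpret S: field_algebra ?S
    by (rule monoid.field_algebra_monoid_algebra) fact
  have p_closed: "p m \<in> carrier N" if "m \<in> carrier M" for m
    using p that by (auto simp: hom_def)
  have closed: "pushforward p f \<in> carrier ?S" if "f \<in> carrier ?R" for f
    using that p_closed by (rule pushforward_closed)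
  note lin = lin_alg_add[OF vector_space_field] lin_alg_smult[OF vector_space_field]
    lin_alg_mult[OF vector_space_field] field_lin_single field_lin_pushforward[OF finite_support]
  show "pushforward p \<in> Ring.ring_hom ?R ?S"
  proof (rule ring_hom_memI)
    fix f g assume *: "f \<in> carrier ?R" "g \<in> carrier ?R"
    show "pushforward p (f \<otimes>\<^bsub>?R\<^esub> g) = pushforward p f \<otimes>\<^bsub>?S\<^esub> pushforward p g"
    proof (rule lin_eqI[of _ N])
      fix F :: "_ \<Rightarrow> 'k"
      have "lin (*) F (pushforward p (f \<otimes>\<^bsub>?R\<^esub> g)) = lin (*) (\<lambda>a. lin (*) (\<lambda>b. F (p (a \<otimes>\<^bsub>M\<^esub> b))) g) f"
        using * by (subst field_lin_pushforward[OF finite_support[of _ M]]) (simp_all add: lin)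
      also have "\<dots> = lin (*) (\<lambda>a. lin (*) (\<lambda>b. F (p a \<otimes>\<^bsub>N\<^esub> p b)) g) f"
        using * p by (auto intro!: field_lin_cong simp: hom_def support_closed)
      also have "\<dots> = lin (*) F (pushforward p f \<otimes>\<^bsub>?S\<^esub> pushforward p g)"
        using * by (simp add: lin_alg_mult[OF vector_space_field closed closed] field_lin_pushforward[OF finite_support[of _ M]])
      finally show "lin (*) F (pushforward p (f \<otimes>\<^bsub>?R\<^esub> g)) = lin (*) F (pushforward p f \<otimes>\<^bsub>?S\<^esub> pushforward p g)" .
    qed (use * closed in simp_all)
    show "pushforward p (f \<oplus>\<^bsub>?R\<^esub> g) = pushforward p f \<oplus>\<^bsub>?S\<^esub> pushforward p g"
      using * closed by (intro lin_eqI[of _ N])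
        (simp_all add: lin_alg_add[OF vector_space_field closed closed] lin_alg_add[OF vector_space_field]
          field_lin_pushforward[OF finite_support[of _ M]])
  qed (use closed in \<open>auto simp: monoid_algebra_simps(2) pushforward_single one\<close>)
  show "pushforward p (c \<odot>\<^bsub>?R\<^esub> f) = c \<odot>\<^bsub>?S\<^esub> pushforward p f" if "f \<in> carrier ?R"
    using that closed by (intro lin_eqI[of _ N]) (simp_all add: lin(2) field_lin_pushforward[OF finite_support[of _ M]])
qed

text \<open>Multiplying by an element \<open>x\<close> replaces \<open>F\<close> by a linear combination of translates of \<open>F\<close>.\<close>

lemma (in monoid) annihilator_ideal:
  fixes s :: "'k::field \<Rightarrow> 'v::ab_group_add \<Rightarrow> 'v"
  assumes s: "vector_space s"
    and left: "\<And>F a. F \<in> \<F> \<Longrightarrow> a \<in> carrier G \<Longrightarrow> (\<lambda>m. F (a \<otimes> m)) \<in> \<F>"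
    and right: "\<And>F a. F \<in> \<F> \<Longrightarrow> a \<in> carrier G \<Longrightarrow> (\<lambda>m. F (m \<otimes> a)) \<in> \<F>"
  shows "ideal {f \<in> carrier (monoid_algebra G). \<forall>F\<in>\<F>. lin s F f = 0} (monoid_algebra G)" (is "ideal ?J ?R")
proof -
  interpret vector_space s by fact
  interpret R: field_algebra "monoid_algebra G :: ('k, _) module" by (rule field_algebra_monoid_algebra)
  note lin = lin_alg_add[OF s] lin_alg_smult[OF s] lin_alg_mult[OF s]
  show ?thesis
  proof (rule idealI[OF R.ring_axioms])
    show "subgroup ?J (add_monoid ?R)"
    proof (rule R.add.subgroupI)
      show "?J \<noteq> {}"
        using R.zero_closed lin_zero by (auto simp: monoid_algebra_simps(3))
      fix f assume f: "f \<in> ?J"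
      then have "\<ominus>\<^bsub>?R\<^esub> f = (- 1) \<odot>\<^bsub>?R\<^esub> f" by (simp add: R.smult_minus_one)
      with f show "\<ominus>\<^bsub>?R\<^esub> f \<in> ?J" by (simp add: lin)
    qed (auto simp: lin)
  next
    fix f x assume f: "f \<in> ?J" and x: "x \<in> carrier ?R"
    show "x \<otimes>\<^bsub>?R\<^esub> f \<in> ?J"
    proof (intro CollectI conjI ballI)
      fix F assume F: "F \<in> \<F>"
      have "lin s F (x \<otimes>\<^bsub>?R\<^esub> f) = lin s (\<lambda>a. 0) x"
        using f x left[OF F] by (simp add: lin) (auto intro!: lin_cong simp: support_closed)
      then show "lin s F (x \<otimes>\<^bsub>?R\<^esub> f) = 0" by (simp add: lin_def)
    qed (use f x in simp)
    show "f \<otimes>\<^bsub>?R\<^esub> x \<in> ?J"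
    proof (intro CollectI conjI ballI)
      fix F assume F: "F \<in> \<F>"
      have "lin s F (f \<otimes>\<^bsub>?R\<^esub> x) = lin s (\<lambda>b. lin s (\<lambda>a. F (a \<otimes> b)) f) x"
        using f x by (simp add: lin lin_swap[of _ x])
      also have "\<dots> = lin s (\<lambda>a. 0) x"
        using f x right[OF F] by (auto intro!: lin_cong simp: support_closed)
      finally show "lin s F (f \<otimes>\<^bsub>?R\<^esub> x) = 0" by (simp add: lin_def)
    qed (use f x in simp)
  qed
qed

section \<open>Quotient algebras\<close>

lemma alg_quot_simps:
  "carrier (alg_quot A I) = a_rcosets\<^bsub>A\<^esub> I"
  "X \<otimes>\<^bsub>alg_quot A I\<^esub> Y = rcoset_mult A I X Y"
  "\<one>\<^bsub>alg_quot A I\<^esub> = I +>\<^bsub>A\<^esub> \<one>\<^bsub>A\<^esub>"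
  "\<zero>\<^bsub>alg_quot A I\<^esub> = I"
  "X \<oplus>\<^bsub>alg_quot A I\<^esub> Y = X <+>\<^bsub>A\<^esub> Y"
  "c \<odot>\<^bsub>alg_quot A I\<^esub> X = (\<Union>x\<in>X. I +>\<^bsub>A\<^esub> (c \<odot>\<^bsub>A\<^esub> x))"
  by (simp_all add: alg_quot_def FactRing_def ring.defs module.defs)

locale algebra_ideal = field_algebra A + ideal I A for A :: "('k::field, 'a) module" (structure) and I
begin

lemma coset_closed: "x \<in> carrier A \<Longrightarrow> I +> x \<in> carrier (alg_quot A I)"
  unfolding alg_quot_simps by (rule a_rcosetsI[OF a_subset])

lemma coset_cases:
  assumes "X \<in> carrier (alg_quot A I)"
  obtains x where "x \<in> carrier A" "X = I +> x"
  using assms unfolding alg_quot_simps A_RCOSETS_def' a_r_coset_def' by blast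

lemma coset_add:
  "x \<in> carrier A \<Longrightarrow> y \<in> carrier A \<Longrightarrow> (I +> x) \<oplus>\<^bsub>alg_quot A I\<^esub> (I +> y) = I +> (x \<oplus> y)"
  unfolding alg_quot_simps by (rule a_rcos_sum)

lemma coset_mult:
  "x \<in> carrier A \<Longrightarrow> y \<in> carrier A \<Longrightarrow> (I +> x) \<otimes>\<^bsub>alg_quot A I\<^esub> (I +> y) = I +> (x \<otimes> y)"
  unfolding alg_quot_simps by (rule rcoset_mult_add)

lemma coset_zero: "\<zero>\<^bsub>alg_quot A I\<^esub> = I +> \<zero>"
  unfolding alg_quot_simps by (rule a_coset_add_zero[OF a_subset, symmetric])

lemma coset_one: "\<one>\<^bsub>alg_quot A I\<^esub> = I +> \<one>"
  by (rule alg_quot_simps)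

lemma coset_eq_iff: "x \<in> carrier A \<Longrightarrow> y \<in> carrier A \<Longrightarrow> I +> x = I +> y \<longleftrightarrow> x \<ominus> y \<in> I"
  using quotient_eq_iff_same_a_r_cos[OF is_ideal] by simp

lemma smult_ideal: "i \<in> I \<Longrightarrow> c \<odot> i \<in> I"
  using I_l_closed[of i "c \<odot> \<one>"] by (simp add: smult_mult_left)

lemma coset_member: "x \<in> carrier A \<Longrightarrow> y \<in> I +> x \<Longrightarrow> y \<in> carrier A \<and> I +> y = I +> x"
  using a_repr_independence' a_elemrcos_carrier by metis

text \<open>Operations on cosets are defined as unions over all representatives; the union is a single coset
as soon as all representatives give the same one.\<close>

lemma Union_coset_const:
  assumes "x \<in> carrier A" "\<And>y. y \<in> carrier A \<Longrightarrow> I +> y = I +> x \<Longrightarrow> F y = F x"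
  shows "(\<Union>y\<in>I +> x. F y) = F x"
  using assms a_rcos_self[OF assms(1)] coset_member[OF assms(1)] by blast

lemma coset_smult:
  assumes x: "x \<in> carrier A"
  shows "c \<odot>\<^bsub>alg_quot A I\<^esub> (I +> x) = I +> (c \<odot> x)"
  unfolding alg_quot_simps
proof (rule Union_coset_const[OF x])
  fix y assume y: "y \<in> carrier A" and "I +> y = I +> x"
  then have "y \<oplus> (- 1) \<odot> x \<in> I" using x by (simp add: coset_eq_iff a_minus_def smult_minus_one)
  then have "c \<odot> (y \<oplus> (- 1) \<odot> x) \<in> I" by (rule smult_ideal)
  moreover have "c \<odot> (y \<oplus> (- 1) \<odot> x) = c \<odot> y \<oplus> (- 1) \<odot> (c \<odot> x)"
    using x y by (simp add: smult_add_right smult_smult)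
  ultimately show "I +> c \<odot> y = I +> c \<odot> x"
    using x y by (simp add: coset_eq_iff a_minus_def smult_minus_one)
qed

theorem field_algebra_quot: "field_algebra (alg_quot A I)"
proof -
  let ?Q = "alg_quot A I"
  note coset = coset_add coset_mult coset_smult coset_zero coset_one
  have ring: "ring ?Q"
  proof (rule ringI)
    show "abelian_group ?Q"
    proof (rule abelian_groupI)
      fix X assume "X \<in> carrier ?Q"
      then obtain x where x: "x \<in> carrier A" "X = I +> x" by (rule coset_cases)
      then show "\<exists>Y\<in>carrier ?Q. Y \<oplus>\<^bsub>?Q\<^esub> X = \<zero>\<^bsub>?Q\<^esub>"
        by (intro bexI[of _ "I +> (\<ominus> x)"]) (simp_all add: coset l_neg coset_closed)
    qed (auto elim!: coset_cases simp: coset coset_closed a_ac)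
    show "Group.monoid ?Q"
      by (rule monoidI) (auto elim!: coset_cases simp: coset coset_closed m_assoc)
  qed (auto elim!: coset_cases simp: coset coset_closed l_distr r_distr)
  show ?thesis
    by (intro field_algebra.intro ring field_algebra_axioms.intro)
      (auto elim!: coset_cases simp: coset coset_closed smult_add_left smult_add_right smult_smult
        smult_mult_left smult_mult_right)
qed

end

text \<open>The map on a quotient that is induced by a map which is constant on cosets.\<close>

definition coset_lift :: "('a \<Rightarrow> 'v) \<Rightarrow> 'a set \<Rightarrow> 'v" where
  "coset_lift \<phi> X = \<phi> (SOME x. x \<in> X)"

lemma (in algebra_ideal) coset_lift:
  assumes minus: "\<And>x y. x \<in> carrier A \<Longrightarrow> y \<in> carrier A \<Longrightarrow> \<phi> (x \<ominus> y) = \<phi> x - (\<phi> y :: 'v::ab_group_add)"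
    and kills: "\<And>x. x \<in> I \<Longrightarrow> \<phi> x = 0" and x: "x \<in> carrier A"
  shows "coset_lift \<phi> (I +> x) = \<phi> x"
proof -
  define y where "y = (SOME y. y \<in> I +> x)"
  have "y \<in> I +> x" unfolding y_def by (rule someI[of _ x]) (rule a_rcos_self[OF x])
  then have y: "y \<in> carrier A" "I +> y = I +> x" using coset_member[OF x] by auto
  then have "y \<ominus> x \<in> I" using coset_eq_iff[OF y(1) x] by simp
  then have "\<phi> y - \<phi> x = 0" using minus[OF y(1) x] kills by metis
  then show ?thesis by (simp add: coset_lift_def y_def)
qed

lemma (in algebra_ideal) coset_minus:
  assumes "x \<in> carrier A" "y \<in> carrier A"
  shows "(I +> x) \<ominus>\<^bsub>alg_quot A I\<^esub> (I +> y) = I +> (x \<ominus> y)"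
proof -
  interpret Q: field_algebra "alg_quot A I" by (rule field_algebra_quot)
  show ?thesis using assms
    by (simp add: a_minus_def coset_add coset_closed coset_smult flip: smult_minus_one Q.smult_minus_one)
qed

lemma (in algebra_ideal) coset_commutator:
  "x \<in> carrier A \<Longrightarrow> y \<in> carrier A \<Longrightarrow>
    commutator (alg_quot A I) (I +> x) (I +> y) = I +> commutator A x y"
  by (simp add: commutator_def coset_mult coset_minus)

section \<open>The universal enveloping algebra\<close>

interpretation words: Group.monoid word_monoid
  by (rule monoidI) (simp_all add: word_monoid_def)

lemma word_monoid_simps:
  "carrier word_monoid = UNIV" "u \<otimes>\<^bsub>word_monoid\<^esub> v = u @ v" "\<one>\<^bsub>word_monoid\<^esub> = []"
  by (simp_all add: word_monoid_def)

interpretation free: field_algebra "free_algebra :: ('k::field, 'd list \<Rightarrow> 'k) module"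
  by (rule words.field_algebra_monoid_algebra)

lemma single_word_closed [simp]: "single w \<in> carrier free_algebra"
  by (rule single_closed) (simp add: word_monoid_simps)

lemma single_word_mult:
  "single u \<otimes>\<^bsub>free_algebra\<^esub> single v = (single (u @ v) :: _ \<Rightarrow> 'k::field)"
  using words.single_mult[of u v] by (simp add: word_monoid_simps)

lemma env_relations_closed:
  "env_relations scale bracket \<subseteq> carrier (free_algebra :: ('k::field, 'd::ab_group_add list \<Rightarrow> 'k) module)"
  unfolding env_relations_def by auto

lemma algebra_ideal_env: "algebra_ideal free_algebra (env_ideal scale bracket)"
  unfolding env_ideal_def
  by (intro algebra_ideal.intro free.field_algebra_axioms free.genideal_ideal env_relations_closed)

lemmas env_coset_add = algebra_ideal.coset_add[OF algebra_ideal_env]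
lemmas env_coset_cases = algebra_ideal.coset_cases[OF algebra_ideal_env]
lemmas env_coset_closed = algebra_ideal.coset_closed[OF algebra_ideal_env]
lemmas env_coset_commutator = algebra_ideal.coset_commutator[OF algebra_ideal_env]
lemmas env_coset_eq_iff = algebra_ideal.coset_eq_iff[OF algebra_ideal_env]
lemmas env_coset_lift = algebra_ideal.coset_lift[OF algebra_ideal_env]
lemmas env_coset_smult = algebra_ideal.coset_smult[OF algebra_ideal_env]

interpretation H: field_algebra "env_algebra scale bracket" for scale bracket
  unfolding env_algebra_def by (rule algebra_ideal.field_algebra_quot[OF algebra_ideal_env])

lemma env_relations_in_ideal: "env_relations scale bracket \<subseteq> env_ideal scale bracket"
  unfolding env_ideal_def by (rule free.genideal_self[OF env_relations_closed])

lemma env_emb_closed [simp]: "env_emb scale bracket a \<in> carrier (env_algebra scale bracket)"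
  unfolding env_emb_def env_algebra_def by (rule env_coset_closed) simp

lemma env_emb_add:
  "env_emb scale bracket (a + b) = env_emb scale bracket a \<oplus>\<^bsub>env_algebra scale bracket\<^esub> env_emb scale bracket b"
proof -
  have "single [a + b] \<ominus>\<^bsub>free_algebra\<^esub> (single [a] \<oplus>\<^bsub>free_algebra\<^esub> single [b]) \<in> env_ideal scale bracket"
    using env_relations_in_ideal unfolding env_relations_def by blast
  then show ?thesis
    unfolding env_emb_def env_algebra_def by (simp add: env_coset_add env_coset_eq_iff)
qed

lemma env_emb_scale:
  "env_emb scale bracket (scale c a) = c \<odot>\<^bsub>env_algebra scale bracket\<^esub> env_emb scale bracket a"
proof -
  have "single [scale c a] \<ominus>\<^bsub>free_algebra\<^esub> (c \<odot>\<^bsub>free_algebra\<^esub> single [a]) \<in> env_ideal scale bracket"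
    using env_relations_in_ideal unfolding env_relations_def by blast
  then show ?thesis
    unfolding env_emb_def env_algebra_def by (simp add: env_coset_smult env_coset_eq_iff)
qed

lemma commutator_env_emb:
  "commutator (env_algebra scale bracket) (env_emb scale bracket a) (env_emb scale bracket b) = env_emb scale bracket (bracket a b)"
proof -
  have "commutator free_algebra (single [a]) (single [b]) \<ominus>\<^bsub>free_algebra\<^esub> single [bracket a b] \<in> env_ideal scale bracket"
    using env_relations_in_ideal unfolding env_relations_def by blast
  then show ?thesis
    unfolding env_emb_def env_algebra_def by (simp add: env_coset_commutator env_coset_eq_iff)
qed

context based_lie_algebra
begin

definition env_proj :: "('d list \<Rightarrow> 'k) set \<Rightarrow> 'd" where
  "env_proj = coset_lift (lin scale word_retract)"

text \<open>The translates of \<open>word_retract\<close> by words on both sides still satisfy linearity in the remaining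
letters and the exchange rule, that is, they vanish on the defining relations.\<close>

lemma lin_retract_kills: 
  assumes "f \<in> env_ideal scale bracket"
  shows "lin scale word_retract f = 0"
proof -
  define \<F> where "\<F> = {\<lambda>w. word_retract (u @ w @ v) | u v. True}"
  let ?J = "{f \<in> carrier free_algebra. \<forall>F\<in>\<F>. lin scale F f = 0}"
  note lin = lin_alg_minus[OF vector_space_axioms words.monoid_axioms]
    lin_alg_add[OF vector_space_axioms] lin_alg_smult[OF vector_space_axioms] lin_single
  have "ideal ?J free_algebra"
  proof (rule words.annihilator_ideal[OF vector_space_axioms])
    fix F a assume "F \<in> \<F>"
    then obtain u v where F: "F = (\<lambda>w. word_retract (u @ w @ v))" unfolding \<F>_def by blast
    show "(\<lambda>m. F (a \<otimes>\<^bsub>word_monoid\<^esub> m)) \<in> \<F>"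
      unfolding F \<F>_def by (rule CollectI, rule exI[of _ "u @ a"], rule exI[of _ v]) (simp add: word_monoid_simps)
    show "(\<lambda>m. F (m \<otimes>\<^bsub>word_monoid\<^esub> a)) \<in> \<F>"
      unfolding F \<F>_def by (rule CollectI, rule exI[of _ u], rule exI[of _ "a @ v"]) (simp add: word_monoid_simps)
  qed
  moreover have "env_relations scale bracket \<subseteq> ?J"
  proof -
    have "lin scale F f = 0" if F_mem: "F \<in> \<F>" and f: "f \<in> env_relations scale bracket" for F f
    proof -
      obtain u v where F: "F = (\<lambda>w. word_retract (u @ w @ v))" using F_mem unfolding \<F>_def by blast
      have 1: "F [a + b] = F [a] + F [b]" "F [scale c a] = scale c (F [a])" for a b c
        using word_retract_linear[of u v] unfolding F Vector_Spaces.linear_iff by simp_all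
      have 2: "F [a, b] - F [b, a] = F [bracket a b]" for a b
        using word_retract_exchange[of u a b v] unfolding F by simp
      show ?thesis
        using f unfolding env_relations_def commutator_def
        by (auto simp: lin single_word_mult 1 2)
    qed
    then show ?thesis using env_relations_closed by blast
  qed
  ultimately have "env_ideal scale bracket \<subseteq> ?J"
    unfolding env_ideal_def by (rule free.genideal_minimal)
  moreover have "word_retract \<in> \<F>"
    unfolding \<F>_def by (auto intro!: exI[of _ "[]"])
  ultimately show ?thesis using assms by blast
qed

lemma env_proj_coset:
  assumes "f \<in> carrier free_algebra"
  shows "env_proj (env_ideal scale bracket +>\<^bsub>free_algebra\<^esub> f) = lin scale word_retract f"
  unfolding env_proj_def
  by (rule env_coset_lift)
    (simp_all add: assms lin_retract_kills lin_alg_minus[OF vector_space_axioms words.monoid_axioms])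

lemma env_proj_emb [simp]: "env_proj (env_emb scale bracket a) = a"
  by (simp add: env_emb_def env_proj_coset lin_single word_retract_single)

lemma env_proj_add:
  assumes "X \<in> carrier (env_algebra scale bracket)" "Y \<in> carrier (env_algebra scale bracket)"
  shows "env_proj (X \<oplus>\<^bsub>env_algebra scale bracket\<^esub> Y) = env_proj X + env_proj Y"
  using assms unfolding env_algebra_def
  by (auto elim!: env_coset_cases simp: env_coset_add env_proj_coset lin_alg_add[OF vector_space_axioms])

lemma env_proj_smult:
  assumes "X \<in> carrier (env_algebra scale bracket)"
  shows "env_proj (c \<odot>\<^bsub>env_algebra scale bracket\<^esub> X) = scale c (env_proj X)"
  using assms unfolding env_algebra_def
  by (auto elim!: env_coset_cases simp: env_coset_smult env_proj_coset lin_alg_smult[OF vector_space_axioms])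

end

section \<open>Tensor powers\<close>

lemma tuple_monoid_simps:
  "xs \<otimes>\<^bsub>tuple_monoid A n\<^esub> ys = map2 (\<lambda>x y. x \<otimes>\<^bsub>A\<^esub> y) xs ys"
  "\<one>\<^bsub>tuple_monoid A n\<^esub> = replicate n \<one>\<^bsub>A\<^esub>"
  by (simp_all add: tuple_monoid_def)

lemma tuple_carrier_iff:
  "xs \<in> carrier (tuple_monoid A n) \<longleftrightarrow> length xs = n \<and> (\<forall>i<n. xs ! i \<in> carrier A)"
  by (auto simp: tuple_monoid_def subset_iff in_set_conv_nth)

lemma tuple_update_closed:
  "xs \<in> carrier (tuple_monoid A n) \<Longrightarrow> x \<in> carrier A \<Longrightarrow> xs[i := x] \<in> carrier (tuple_monoid A n)"
  by (auto simp: tuple_carrier_iff) (metis nth_list_update_eq nth_list_update_neq)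

lemma map2_update_right:
  "length a = length xs \<Longrightarrow> i < length xs \<Longrightarrow> map2 f a (xs[i := x]) = (map2 f a xs)[i := f (a ! i) x]"
  by (intro nth_equalityI) (simp_all add: nth_list_update)

lemma map2_update_left:
  "length a = length xs \<Longrightarrow> i < length xs \<Longrightarrow> map2 f (xs[i := x]) a = (map2 f xs a)[i := f x (a ! i)]"
  by (intro nth_equalityI) (simp_all add: nth_list_update)

context field_algebra
begin

lemma monoid_tuple: "Group.monoid (tuple_monoid A n)"
proof (rule monoidI)
  fix xs ys zs
  assume "xs \<in> carrier (tuple_monoid A n)" "ys \<in> carrier (tuple_monoid A n)" "zs \<in> carrier (tuple_monoid A n)"
  then show "xs \<otimes>\<^bsub>tuple_monoid A n\<^esub> ys \<otimes>\<^bsub>tuple_monoid A n\<^esub> zs = xs \<otimes>\<^bsub>tuple_monoid A n\<^esub> (ys \<otimes>\<^bsub>tuple_monoid A n\<^esub> zs)"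
    unfolding tuple_carrier_iff tuple_monoid_simps by (intro nth_equalityI) (simp_all add: m_assoc)
next
  fix xs assume "xs \<in> carrier (tuple_monoid A n)"
  then show "\<one>\<^bsub>tuple_monoid A n\<^esub> \<otimes>\<^bsub>tuple_monoid A n\<^esub> xs = xs" "xs \<otimes>\<^bsub>tuple_monoid A n\<^esub> \<one>\<^bsub>tuple_monoid A n\<^esub> = xs"
    unfolding tuple_carrier_iff tuple_monoid_simps by (auto intro!: nth_equalityI)
qed (auto simp: tuple_carrier_iff tuple_monoid_simps)

lemma field_algebra_tuple: "field_algebra (tuple_algebra A n)"
  unfolding tuple_algebra_def by (rule monoid.field_algebra_monoid_algebra[OF monoid_tuple])

lemma single_tuple_closed: "xs \<in> carrier (tuple_monoid A n) \<Longrightarrow> single xs \<in> carrier (tuple_algebra A n)"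
  unfolding tuple_algebra_def by (rule single_closed)

lemma tensor_relations_addI:
  assumes "xs \<in> carrier (tuple_monoid A n)" "i < n" "x \<in> carrier A" "y \<in> carrier A"
  shows "single (xs[i := x \<oplus> y]) \<ominus>\<^bsub>tuple_algebra A n\<^esub>
        (single (xs[i := x]) \<oplus>\<^bsub>tuple_algebra A n\<^esub> single (xs[i := y])) \<in> tensor_relations A n"
  unfolding tensor_relations_def
  by (rule UnI1, rule CollectI, intro exI conjI, rule refl) (use assms in auto)

lemma tensor_relations_smultI:
  assumes "xs \<in> carrier (tuple_monoid A n)" "i < n" "x \<in> carrier A"
  shows "single (xs[i := c \<odot> x]) \<ominus>\<^bsub>tuple_algebra A n\<^esub>
        (c \<odot>\<^bsub>tuple_algebra A n\<^esub> single (xs[i := x])) \<in> tensor_relations A n"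
  unfolding tensor_relations_def
  by (rule UnI2, rule CollectI, intro exI conjI, rule refl) (use assms in auto)

lemma tensor_relations_closed: "tensor_relations A n \<subseteq> carrier (tuple_algebra A n)"
proof -
  interpret T: field_algebra "tuple_algebra A n" by (rule field_algebra_tuple)
  show ?thesis
    unfolding tensor_relations_def by (auto simp: single_tuple_closed tuple_update_closed)
qed

lemma algebra_ideal_tensor: "algebra_ideal (tuple_algebra A n) (tensor_ideal A n)"
proof -
  interpret T: field_algebra "tuple_algebra A n" by (rule field_algebra_tuple)
  show ?thesis
    unfolding tensor_ideal_def
    by (intro algebra_ideal.intro T.field_algebra_axioms T.genideal_ideal tensor_relations_closed)
qed

lemma field_algebra_tensor: "field_algebra (tensor_power A n)"
  unfolding tensor_power_def by (rule algebra_ideal.field_algebra_quot[OF algebra_ideal_tensor])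

lemma tensor_relations_in_ideal: "tensor_relations A n \<subseteq> tensor_ideal A n"
proof -
  interpret T: field_algebra "tuple_algebra A n" by (rule field_algebra_tuple)
  show ?thesis unfolding tensor_ideal_def by (rule T.genideal_self[OF tensor_relations_closed])
qed

lemmas tensor_coset = algebra_ideal.coset_add[OF algebra_ideal_tensor]
  algebra_ideal.coset_smult[OF algebra_ideal_tensor] algebra_ideal.coset_mult[OF algebra_ideal_tensor]
lemmas tensor_coset_eq_iff = algebra_ideal.coset_eq_iff[OF algebra_ideal_tensor]
lemmas tensor_coset_closed = algebra_ideal.coset_closed[OF algebra_ideal_tensor]
lemmas tensor_coset_cases = algebra_ideal.coset_cases[OF algebra_ideal_tensor]

lemma pure_coset:
  "xs \<in> carrier (tuple_monoid A n) \<Longrightarrow> pure A xs = tensor_ideal A n +>\<^bsub>tuple_algebra A n\<^esub> single xs"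
  unfolding pure_def tuple_carrier_iff by simp

lemma pure_closed: "xs \<in> carrier (tuple_monoid A n) \<Longrightarrow> pure A xs \<in> carrier (tensor_power A n)"
  unfolding tensor_power_def by (simp add: pure_coset tensor_coset_closed single_tuple_closed)

lemma pure_mult:
  assumes "xs \<in> carrier (tuple_monoid A n)" "ys \<in> carrier (tuple_monoid A n)"
  shows "pure A xs \<otimes>\<^bsub>tensor_power A n\<^esub> pure A ys = pure A (map2 (\<lambda>x y. x \<otimes> y) xs ys)"
proof -
  interpret M: Group.monoid "tuple_monoid A n" by (rule monoid_tuple)
  have "single xs \<otimes>\<^bsub>tuple_algebra A n\<^esub> single ys = single (xs \<otimes>\<^bsub>tuple_monoid A n\<^esub> ys)"
    unfolding tuple_algebra_def by (rule M.single_mult[OF assms])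
  moreover have "xs \<otimes>\<^bsub>tuple_monoid A n\<^esub> ys \<in> carrier (tuple_monoid A n)" using assms by simp
  ultimately show ?thesis
    using assms unfolding tensor_power_def
    by (simp add: pure_coset[of _ n] tensor_coset single_tuple_closed tuple_monoid_simps(1))
qed

lemma pure_add:
  assumes "xs \<in> carrier (tuple_monoid A n)" "i < n" "x \<in> carrier A" "y \<in> carrier A"
  shows "pure A (xs[i := x \<oplus> y]) = pure A (xs[i := x]) \<oplus>\<^bsub>tensor_power A n\<^esub> pure A (xs[i := y])"
proof -
  interpret T: field_algebra "tuple_algebra A n" by (rule field_algebra_tuple)
  have "single (xs[i := x \<oplus> y]) \<ominus>\<^bsub>tuple_algebra A n\<^esub>
        (single (xs[i := x]) \<oplus>\<^bsub>tuple_algebra A n\<^esub> single (xs[i := y])) \<in> tensor_ideal A n"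
    by (rule subsetD[OF tensor_relations_in_ideal tensor_relations_addI[OF assms]])
  with assms show ?thesis unfolding tensor_power_def
    by (simp add: pure_coset[of _ n] tensor_coset tensor_coset_eq_iff single_tuple_closed tuple_update_closed)
qed

lemma pure_smult:
  assumes "xs \<in> carrier (tuple_monoid A n)" "i < n" "x \<in> carrier A"
  shows "pure A (xs[i := c \<odot> x]) = c \<odot>\<^bsub>tensor_power A n\<^esub> pure A (xs[i := x])"
proof -
  interpret T: field_algebra "tuple_algebra A n" by (rule field_algebra_tuple)
  have "single (xs[i := c \<odot> x]) \<ominus>\<^bsub>tuple_algebra A n\<^esub>
        (c \<odot>\<^bsub>tuple_algebra A n\<^esub> single (xs[i := x])) \<in> tensor_ideal A n"
    by (rule subsetD[OF tensor_relations_in_ideal tensor_relations_smultI[OF assms]])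
  with assms show ?thesis unfolding tensor_power_def
    by (simp add: pure_coset[of _ n] tensor_coset tensor_coset_eq_iff single_tuple_closed tuple_update_closed)
qed

lemma pure_linear:
  assumes "xs \<in> carrier (tuple_monoid A n)" "i < n"
  shows "algebra_linear A (tensor_power A n) (\<lambda>x. pure A (xs[i := x]))"
  unfolding algebra_linear_def
  using assms by (auto simp: pure_add pure_smult intro: pure_closed tuple_update_closed)

text \<open>Multilinearity is expressed by updating one entry of a tuple, as in the relations of the tensor
power.\<close>

definition multilinear_tuple :: "nat \<Rightarrow> ('a list \<Rightarrow> 'k) \<Rightarrow> bool" where
  "multilinear_tuple n M \<longleftrightarrow> (\<forall>xs\<in>carrier (tuple_monoid A n). \<forall>i<n.
     (\<forall>x\<in>carrier A. \<forall>y\<in>carrier A. M (xs[i := x \<oplus> y]) = M (xs[i := x]) + M (xs[i := y])) \<and>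
     (\<forall>x\<in>carrier A. \<forall>c. M (xs[i := c \<odot> x]) = c * M (xs[i := x])))"

definition tensor_functional :: "('a list \<Rightarrow> 'k) \<Rightarrow> ('a list \<Rightarrow> 'k) set \<Rightarrow> 'k" where
  "tensor_functional M = coset_lift (lin (*) M)"

text \<open>A product of tuples is taken entrywise, and the multiplication of an entry by a fixed element is
linear. Hence multilinear functionals are closed under translation.\<close>

lemma multilinear_kills:
  assumes M: "multilinear_tuple n M" and f: "f \<in> tensor_ideal A n"
  shows "lin (*) M f = 0"
proof -
  let ?T = "tuple_algebra A n" and ?N = "tuple_monoid A n"
  interpret T: field_algebra ?T by (rule field_algebra_tuple)
  interpret N: Group.monoid ?N by (rule monoid_tuple)
  let ?J = "{f \<in> carrier (monoid_algebra ?N). \<forall>F\<in>Collect (multilinear_tuple n). lin (*) F f = 0}"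
  have "ideal ?J (monoid_algebra ?N)"
  proof (rule N.annihilator_ideal[OF vector_space_field])
    fix F a assume F: "F \<in> Collect (multilinear_tuple n)" and a: "a \<in> carrier ?N"
    have "multilinear_tuple n (\<lambda>m. F (a \<otimes>\<^bsub>?N\<^esub> m))"
      unfolding multilinear_tuple_def
    proof (intro ballI allI impI conjI)
      fix xs i x assume *: "xs \<in> carrier ?N" "i < n" "x \<in> carrier A"
      have ax: "a \<otimes>\<^bsub>?N\<^esub> xs[i := x] = (a \<otimes>\<^bsub>?N\<^esub> xs)[i := (a ! i) \<otimes> x]" for x
        using a * unfolding tuple_carrier_iff tuple_monoid_simps by (intro map2_update_right) auto
      have **: "a \<otimes>\<^bsub>?N\<^esub> xs \<in> carrier ?N" "a ! i \<in> carrier A"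
        using a * by (auto simp: tuple_carrier_iff[of a])
      show "F (a \<otimes>\<^bsub>?N\<^esub> xs[i := x \<oplus> y]) = F (a \<otimes>\<^bsub>?N\<^esub> xs[i := x]) + F (a \<otimes>\<^bsub>?N\<^esub> xs[i := y])"
        if "y \<in> carrier A" for y
        using F * ** that unfolding ax by (simp add: r_distr multilinear_tuple_def)
      show "F (a \<otimes>\<^bsub>?N\<^esub> xs[i := c \<odot> x]) = c * F (a \<otimes>\<^bsub>?N\<^esub> xs[i := x])" for c
        using F * ** unfolding ax by (simp add: smult_mult_right multilinear_tuple_def)
    qed
    then show "(\<lambda>m. F (a \<otimes>\<^bsub>?N\<^esub> m)) \<in> Collect (multilinear_tuple n)" by simp
    have "multilinear_tuple n (\<lambda>m. F (m \<otimes>\<^bsub>?N\<^esub> a))"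
      unfolding multilinear_tuple_def
    proof (intro ballI allI impI conjI)
      fix xs i x assume *: "xs \<in> carrier ?N" "i < n" "x \<in> carrier A"
      have ax: "xs[i := x] \<otimes>\<^bsub>?N\<^esub> a = (xs \<otimes>\<^bsub>?N\<^esub> a)[i := x \<otimes> (a ! i)]" for x
        using a * unfolding tuple_carrier_iff tuple_monoid_simps by (intro map2_update_left) auto
      have **: "xs \<otimes>\<^bsub>?N\<^esub> a \<in> carrier ?N" "a ! i \<in> carrier A"
        using a * by (auto simp: tuple_carrier_iff[of a])
      show "F (xs[i := x \<oplus> y] \<otimes>\<^bsub>?N\<^esub> a) = F (xs[i := x] \<otimes>\<^bsub>?N\<^esub> a) + F (xs[i := y] \<otimes>\<^bsub>?N\<^esub> a)"
        if "y \<in> carrier A" for y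
        using F * ** that unfolding ax by (simp add: l_distr multilinear_tuple_def)
      show "F (xs[i := c \<odot> x] \<otimes>\<^bsub>?N\<^esub> a) = c * F (xs[i := x] \<otimes>\<^bsub>?N\<^esub> a)" for c
        using F * ** unfolding ax by (simp add: smult_mult_left multilinear_tuple_def)
    qed
    then show "(\<lambda>m. F (m \<otimes>\<^bsub>?N\<^esub> a)) \<in> Collect (multilinear_tuple n)" by simp
  qed
  then have "ideal ?J ?T" unfolding tuple_algebra_def .
  moreover have "tensor_relations A n \<subseteq> ?J"
  proof -
    note single = single_closed[OF tuple_update_closed]
    note lin = lin_alg_minus[OF vector_space_field monoid_tuple] lin_alg_add[OF vector_space_field]
      lin_alg_smult[OF vector_space_field] field_lin_single
    have "lin (*) F f = 0" if F: "multilinear_tuple n F" and f: "f \<in> tensor_relations A n" for F f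
      using f F T.add.m_closed T.smult_closed unfolding tensor_relations_def tuple_algebra_def
      by (auto simp: lin single multilinear_tuple_def)
    then show ?thesis using tensor_relations_closed[of n] unfolding tuple_algebra_def by blast
  qed
  ultimately have "tensor_ideal A n \<subseteq> ?J"
    unfolding tensor_ideal_def by (rule T.genideal_minimal)
  then show ?thesis using M f by blast
qed

lemma tensor_functional_coset:
  assumes "multilinear_tuple n M" "f \<in> carrier (tuple_algebra A n)"
  shows "tensor_functional M (tensor_ideal A n +>\<^bsub>tuple_algebra A n\<^esub> f) = lin (*) M f"
  unfolding tensor_functional_def using assms
  by (intro algebra_ideal.coset_lift[OF algebra_ideal_tensor] multilinear_kills)
    (auto simp: tuple_algebra_def lin_alg_minus[OF vector_space_field monoid_tuple])

lemma tensor_functional_pure: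
  "multilinear_tuple n M \<Longrightarrow> xs \<in> carrier (tuple_monoid A n) \<Longrightarrow> tensor_functional M (pure A xs) = M xs"
  by (simp add: pure_coset[of _ n] tensor_functional_coset single_tuple_closed field_lin_single)

lemma tensor_functional_add:
  assumes "multilinear_tuple n M" "X \<in> carrier (tensor_power A n)" "Y \<in> carrier (tensor_power A n)"
  shows "tensor_functional M (X \<oplus>\<^bsub>tensor_power A n\<^esub> Y) = tensor_functional M X + tensor_functional M Y"
proof -
  interpret T: field_algebra "tuple_algebra A n" by (rule field_algebra_tuple)
  show ?thesis using assms unfolding tensor_power_def
    by (auto elim!: tensor_coset_cases simp: tensor_coset tensor_functional_coset)
      (simp add: tuple_algebra_def lin_alg_add[OF vector_space_field])
qed

lemma tensor_functional_smult:
  assumes "multilinear_tuple n M" "X \<in> carrier (tensor_power A n)"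
  shows "tensor_functional M (c \<odot>\<^bsub>tensor_power A n\<^esub> X) = c * tensor_functional M X"
proof -
  interpret T: field_algebra "tuple_algebra A n" by (rule field_algebra_tuple)
  show ?thesis using assms unfolding tensor_power_def
    by (auto elim!: tensor_coset_cases simp: tensor_coset tensor_functional_coset)
      (simp add: tuple_algebra_def lin_alg_smult[OF vector_space_field])
qed

lemma tensor_functional_finsum:
  assumes M: "multilinear_tuple n M" and "finite S" "f \<in> S \<rightarrow> carrier (tensor_power A n)"
  shows "tensor_functional M (\<Oplus>\<^bsub>tensor_power A n\<^esub>i\<in>S. f i) = (\<Sum>i\<in>S. tensor_functional M (f i))"
proof -
  interpret P: field_algebra "tensor_power A n" by (rule field_algebra_tensor)
  have "tensor_functional M \<zero>\<^bsub>tensor_power A n\<^esub> = 0"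
    using tensor_functional_smult[OF M P.zero_closed, of 0] by simp
  with assms(2,3) show ?thesis
    by (induction S rule: finite_induct) (simp_all add: tensor_functional_add[OF M] Pi_def)
qed

text \<open>The condition on updates says that each entry of the tuple turns up in exactly one place of its
image. It makes the multilinearity relations go to multilinearity relations; being a homomorphism
of monoids makes the linear extension a homomorphism of algebras, so that ideals pull back to ideals.\<close>

definition tuple_hom :: "nat \<Rightarrow> nat \<Rightarrow> ('a list \<Rightarrow> 'a list) \<Rightarrow> bool" where
  "tuple_hom n m p \<longleftrightarrow> p \<in> hom (tuple_monoid A n) (tuple_monoid A m) \<and>
     p (replicate n \<one>) = replicate m \<one> \<and>
     (\<forall>i<n. \<exists>j<m. \<forall>xs\<in>carrier (tuple_monoid A n). \<forall>x\<in>carrier A. p (xs[i := x]) = (p xs)[j := x])"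

context
  fixes n m p
  assumes p: "tuple_hom n m p"
begin

lemma tuple_hom_closed: "xs \<in> carrier (tuple_monoid A n) \<Longrightarrow> p xs \<in> carrier (tuple_monoid A m)"
  using p unfolding tuple_hom_def by (auto simp: hom_def)

lemma pushforward_tuple:
  "pushforward p \<in> Ring.ring_hom (tuple_algebra A n) (tuple_algebra A m)"
  "f \<in> carrier (tuple_algebra A n) \<Longrightarrow>
    pushforward p (c \<odot>\<^bsub>tuple_algebra A n\<^esub> f) = c \<odot>\<^bsub>tuple_algebra A m\<^esub> pushforward p f"
proof -
  have hom: "p \<in> hom (tuple_monoid A n) (tuple_monoid A m)"
    and one: "p \<one>\<^bsub>tuple_monoid A n\<^esub> = \<one>\<^bsub>tuple_monoid A m\<^esub>"
    using p unfolding tuple_hom_def tuple_monoid_simps by blast+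
  show "pushforward p \<in> Ring.ring_hom (tuple_algebra A n) (tuple_algebra A m)"
    unfolding tuple_algebra_def by (rule pushforward_hom(1)[OF hom one monoid_tuple monoid_tuple])
  show "f \<in> carrier (tuple_algebra A n) \<Longrightarrow>
    pushforward p (c \<odot>\<^bsub>tuple_algebra A n\<^esub> f) = c \<odot>\<^bsub>tuple_algebra A m\<^esub> pushforward p f"
    unfolding tuple_algebra_def by (rule pushforward_hom(2)[OF hom one monoid_tuple monoid_tuple])
qed

lemma pushforward_tensor_ideal:
  assumes "f \<in> tensor_ideal A n"
  shows "pushforward p f \<in> tensor_ideal A m"
proof -
  let ?S = "tuple_algebra A n" and ?T = "tuple_algebra A m"
  interpret S: field_algebra ?S by (rule field_algebra_tuple)
  interpret T: field_algebra ?T by (rule field_algebra_tuple)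
  interpret P: ring_hom_ring ?S ?T "pushforward p"
    by (intro ring_hom_ring.intro S.ring_axioms T.ring_axioms ring_hom_ring_axioms.intro pushforward_tuple)
  let ?J = "{f \<in> carrier ?S. pushforward p f \<in> tensor_ideal A m}"
  have "ideal ?J ?S"
    by (rule P.ideal_vimage) (rule ideal.axioms algebra_ideal.axioms(2)[OF algebra_ideal_tensor])+
  moreover have "tensor_relations A n \<subseteq> ?J"
  proof -
    have "pushforward p f \<in> tensor_relations A m" if "f \<in> tensor_relations A n" for f
      using that unfolding tensor_relations_def[of A n]
    proof (elim UnE CollectE exE conjE)
      fix xs i x y assume *: "xs \<in> carrier (tuple_monoid A n)" "i < n" "x \<in> carrier A" "y \<in> carrier A"
        and f: "f = single (xs[i := x \<oplus> y]) \<ominus>\<^bsub>?S\<^esub> (single (xs[i := x]) \<oplus>\<^bsub>?S\<^esub> single (xs[i := y]))"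
      obtain j where j: "j < m" "\<And>x. x \<in> carrier A \<Longrightarrow> p (xs[i := x]) = (p xs)[j := x]"
        using p * unfolding tuple_hom_def by blast
      have "pushforward p f = single ((p xs)[j := x \<oplus> y]) \<ominus>\<^bsub>?T\<^esub> (single ((p xs)[j := x]) \<oplus>\<^bsub>?T\<^esub> single ((p xs)[j := y]))"
        unfolding f a_minus_def using *
        by (simp add: single_tuple_closed tuple_update_closed pushforward_single j(2))
      then show ?thesis by (simp only: tensor_relations_addI[OF tuple_hom_closed[OF *(1)] j(1) *(3,4)])
    next
      fix xs i c x assume *: "xs \<in> carrier (tuple_monoid A n)" "i < n" "x \<in> carrier A"
        and f: "f = single (xs[i := c \<odot> x]) \<ominus>\<^bsub>?S\<^esub> (c \<odot>\<^bsub>?S\<^esub> single (xs[i := x]))"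
      obtain j where j: "j < m" "\<And>x. x \<in> carrier A \<Longrightarrow> p (xs[i := x]) = (p xs)[j := x]"
        using p * unfolding tuple_hom_def by blast
      have "pushforward p f = single ((p xs)[j := c \<odot> x]) \<ominus>\<^bsub>?T\<^esub> (c \<odot>\<^bsub>?T\<^esub> single ((p xs)[j := x]))"
        unfolding f a_minus_def using *
        by (simp add: single_tuple_closed tuple_update_closed pushforward_single pushforward_tuple(2) j(2))
      then show ?thesis by (simp only: tensor_relations_smultI[OF tuple_hom_closed[OF *(1)] j(1) *(3)])
    qed
    then show ?thesis using tensor_relations_closed tensor_relations_in_ideal by blast
  qed
  ultimately have "tensor_ideal A n \<subseteq> ?J"
    unfolding tensor_ideal_def[of A n] by (rule S.genideal_minimal)
  then show ?thesis using assms by blast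
qed

lemma tensor_map_coset:
  assumes f: "f \<in> carrier (tuple_algebra A n)"
  shows "tensor_map A m p (tensor_ideal A n +>\<^bsub>tuple_algebra A n\<^esub> f) = tensor_ideal A m +>\<^bsub>tuple_algebra A m\<^esub> pushforward p f"
  unfolding tensor_map_def
proof (rule algebra_ideal.Union_coset_const[OF algebra_ideal_tensor f])
  let ?S = "tuple_algebra A n" and ?T = "tuple_algebra A m"
  interpret S: field_algebra ?S by (rule field_algebra_tuple)
  interpret T: field_algebra ?T by (rule field_algebra_tuple)
  interpret P: ring_hom_ring ?S ?T "pushforward p"
    by (intro ring_hom_ring.intro S.ring_axioms T.ring_axioms ring_hom_ring_axioms.intro pushforward_tuple)
  fix g assume g: "g \<in> carrier ?S" and eq: "tensor_ideal A n +>\<^bsub>?S\<^esub> g = tensor_ideal A n +>\<^bsub>?S\<^esub> f"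
  have "pushforward p (g \<ominus>\<^bsub>?S\<^esub> f) \<in> tensor_ideal A m"
    using eq f g by (intro pushforward_tensor_ideal) (simp add: tensor_coset_eq_iff)
  then show "tensor_ideal A m +>\<^bsub>?T\<^esub> pushforward p g = tensor_ideal A m +>\<^bsub>?T\<^esub> pushforward p f"
    using f g by (simp add: tensor_coset_eq_iff a_minus_def)
qed

lemma tensor_map_pure: "xs \<in> carrier (tuple_monoid A n) \<Longrightarrow> tensor_map A m p (pure A xs) = pure A (p xs)"
  by (simp add: pure_coset[of _ n] pure_coset[of _ m] tuple_hom_closed tensor_map_coset single_tuple_closed pushforward_single)

text \<open>On linear extensions, composition with the pushforward along \<open>p\<close> is composition with \<open>p\<close> on tuples.\<close>

lemma tensor_functional_map:
  assumes M: "multilinear_tuple m M" and M': "multilinear_tuple n M'"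
    and eq: "\<And>xs. xs \<in> carrier (tuple_monoid A n) \<Longrightarrow> M (p xs) = M' xs"
    and X: "X \<in> carrier (tensor_power A n)"
  shows "tensor_functional M (tensor_map A m p X) = tensor_functional M' X"
proof -
  obtain f where f: "f \<in> carrier (tuple_algebra A n)" and X: "X = tensor_ideal A n +>\<^bsub>tuple_algebra A n\<^esub> f"
    using X unfolding tensor_power_def by (rule tensor_coset_cases)
  have "pushforward p f \<in> carrier (tuple_algebra A m)"
    using pushforward_tuple(1) f by (rule ring_hom_closed)
  then have "tensor_functional M (tensor_map A m p X) = lin (*) M (pushforward p f)"
    unfolding X tensor_map_coset[OF f] by (rule tensor_functional_coset[OF M])
  also have "\<dots> = lin (*) (\<lambda>xs. M (p xs)) f"
    using f unfolding tuple_algebra_def by (intro field_lin_pushforward finite_support)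
  also have "\<dots> = lin (*) M' f"
    using f eq unfolding tuple_algebra_def by (intro field_lin_cong) (auto dest: support_closed)
  also have "\<dots> = tensor_functional M' X"
    unfolding X by (rule tensor_functional_coset[OF M' f, symmetric])
  finally show ?thesis .
qed

lemma tensor_map_linear: "algebra_linear (tensor_power A n) (tensor_power A m) (tensor_map A m p)"
proof -
  let ?S = "tuple_algebra A n" and ?T = "tuple_algebra A m"
  interpret S: field_algebra ?S by (rule field_algebra_tuple)
  interpret T: field_algebra ?T by (rule field_algebra_tuple)
  interpret P: ring_hom_ring ?S ?T "pushforward p"
    by (intro ring_hom_ring.intro S.ring_axioms T.ring_axioms ring_hom_ring_axioms.intro pushforward_tuple)
  show ?thesis
    unfolding algebra_linear_def tensor_power_def
    by (auto elim!: tensor_coset_cases simp: tensor_coset tensor_coset_closed tensor_map_coset pushforward_tuple(2))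
qed

end

lemma tuple_homI:
  assumes "\<And>xs. xs \<in> carrier (tuple_monoid A n) \<Longrightarrow> p xs \<in> carrier (tuple_monoid A m)"
    and "\<And>xs ys. xs \<in> carrier (tuple_monoid A n) \<Longrightarrow> ys \<in> carrier (tuple_monoid A n) \<Longrightarrow>
      p (map2 (\<lambda>x y. x \<otimes> y) xs ys) = map2 (\<lambda>x y. x \<otimes> y) (p xs) (p ys)"
    and "p (replicate n \<one>) = replicate m \<one>"
    and "\<And>i. i < n \<Longrightarrow> \<exists>j<m. \<forall>xs\<in>carrier (tuple_monoid A n). \<forall>x\<in>carrier A. p (xs[i := x]) = (p xs)[j := x]"
  shows "tuple_hom n m p"
  using assms unfolding tuple_hom_def hom_def tuple_monoid_simps by auto

lemma tuple2_cases:
  assumes "xs \<in> carrier (tuple_monoid A 2)"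
  obtains x y where "xs = [x, y]" "x \<in> carrier A" "y \<in> carrier A"
  using assms unfolding tuple_carrier_iff
  by (auto simp: length_Suc_conv numeral_2_eq_2 less_Suc_eq all_conj_distrib)

lemma tuple3_cases:
  assumes "xs \<in> carrier (tuple_monoid A 3)"
  obtains x y z where "xs = [x, y, z]" "x \<in> carrier A" "y \<in> carrier A" "z \<in> carrier A"
  using assms unfolding tuple_carrier_iff
  by (auto simp: length_Suc_conv numeral_3_eq_3 less_Suc_eq all_conj_distrib)

lemma tuple2_closed: "x \<in> carrier A \<Longrightarrow> y \<in> carrier A \<Longrightarrow> [x, y] \<in> carrier (tuple_monoid A 2)"
  by (auto simp: tuple_carrier_iff less_Suc_eq numeral_2_eq_2)

lemma tuple3_closed:
  "x \<in> carrier A \<Longrightarrow> y \<in> carrier A \<Longrightarrow> z \<in> carrier A \<Longrightarrow> [x, y, z] \<in> carrier (tuple_monoid A 3)"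
  by (auto simp: tuple_carrier_iff less_Suc_eq numeral_3_eq_3)

lemma tuple_hom_rev2: "tuple_hom 2 2 rev"
proof (rule tuple_homI)
  fix i :: nat assume "i < 2"
  then show "\<exists>j<2. \<forall>xs\<in>carrier (tuple_monoid A 2). \<forall>x\<in>carrier A. rev (xs[i := x]) = (rev xs)[j := x]"
    by (intro exI[of _ "1 - i"]) (auto elim!: tuple2_cases simp: less_2_cases_iff)
qed (auto elim!: tuple2_cases intro!: tuple2_closed, (simp_all add: numeral_2_eq_2)?)

lemma tuple_hom_12: "tuple_hom 2 3 (\<lambda>xs. [xs ! 0, xs ! 1, \<one>])"
proof (rule tuple_homI)
  fix i :: nat assume "i < 2"
  then show "\<exists>j<3. \<forall>xs\<in>carrier (tuple_monoid A 2). \<forall>x\<in>carrier A.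
      [xs[i := x] ! 0, xs[i := x] ! 1, \<one>] = [xs ! 0, xs ! 1, \<one>][j := x]"
    by (intro exI[of _ i]) (auto elim!: tuple2_cases simp: less_2_cases_iff)
qed (auto elim!: tuple2_cases intro!: tuple3_closed, (simp_all add: numeral_2_eq_2 numeral_3_eq_3)?)

lemma tuple_hom_13: "tuple_hom 2 3 (\<lambda>xs. [xs ! 0, \<one>, xs ! 1])"
proof (rule tuple_homI)
  fix i :: nat assume "i < 2"
  then show "\<exists>j<3. \<forall>xs\<in>carrier (tuple_monoid A 2). \<forall>x\<in>carrier A.
      [xs[i := x] ! 0, \<one>, xs[i := x] ! 1] = [xs ! 0, \<one>, xs ! 1][j := x]"
    by (intro exI[of _ "2 * i"]) (auto elim!: tuple2_cases simp: less_2_cases_iff)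
qed (auto elim!: tuple2_cases intro!: tuple3_closed, (simp_all add: numeral_2_eq_2 numeral_3_eq_3)?)

lemma tuple_hom_rotate1: "tuple_hom 3 3 rotate1"
proof (rule tuple_homI)
  fix i :: nat assume "i < 3"
  then have "i = 0 \<or> i = 1 \<or> i = 2" by auto
  then show "\<exists>j<3. \<forall>xs\<in>carrier (tuple_monoid A 3). \<forall>x\<in>carrier A. rotate1 (xs[i := x]) = (rotate1 xs)[j := x]"
    by (intro exI[of _ "(i + 2) mod 3"]) (auto elim!: tuple3_cases)
qed (auto elim!: tuple3_cases intro!: tuple3_closed, (simp_all add: numeral_3_eq_3)?)

lemma tuple_hom_rotate2: "tuple_hom 3 3 (rotate 2)"
proof (rule tuple_homI)
  fix i :: nat assume "i < 3"
  then have "i = 0 \<or> i = 1 \<or> i = 2" by auto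
  then show "\<exists>j<3. \<forall>xs\<in>carrier (tuple_monoid A 3). \<forall>x\<in>carrier A. rotate 2 (xs[i := x]) = (rotate 2 xs)[j := x]"
    by (intro exI[of _ "(i + 1) mod 3"]) (auto elim!: tuple3_cases simp: numeral_2_eq_2)
qed (auto elim!: tuple3_cases intro!: tuple3_closed simp: numeral_2_eq_2, (simp_all add: numeral_3_eq_3)?)

lemma pure2_minus:
  assumes "x \<in> carrier A" "x' \<in> carrier A" "y \<in> carrier A"
  shows "pure A [x \<ominus> x', y] = pure A [x, y] \<ominus>\<^bsub>tensor_power A 2\<^esub> pure A [x', y]"
    and "pure A [y, x \<ominus> x'] = pure A [y, x] \<ominus>\<^bsub>tensor_power A 2\<^esub> pure A [y, x']"
  using algebra_linear_minus[OF field_algebra_axioms field_algebra_tensor pure_linear[OF tuple2_closed[of x y], of 0] assms(1,2)]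
    algebra_linear_minus[OF field_algebra_axioms field_algebra_tensor pure_linear[OF tuple2_closed[of y x], of 1] assms(1,2)]
    assms by simp_all

lemma pure3_minus:
  assumes "x \<in> carrier A" "x' \<in> carrier A" "y \<in> carrier A" "z \<in> carrier A"
  shows "pure A [x \<ominus> x', y, z] = pure A [x, y, z] \<ominus>\<^bsub>tensor_power A 3\<^esub> pure A [x', y, z]"
  using algebra_linear_minus[OF field_algebra_axioms field_algebra_tensor pure_linear[OF tuple3_closed[of x y z], of 0] assms(1,2)]
    assms by simp

text \<open>The factors with a unit commute, and the commutator happens in the remaining factor.\<close>

lemma commutator_pure2:
  assumes "x \<in> carrier A" "y \<in> carrier A" "z \<in> carrier A"
  shows "commutator (tensor_power A 2) (pure A [x, y]) (pure A [z, \<one>]) = pure A [commutator A x z, y]"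
    and "commutator (tensor_power A 2) (pure A [x, y]) (pure A [\<one>, z]) = pure A [x, commutator A y z]"
  using assms unfolding commutator_def
  by (simp_all add: pure_mult[OF tuple2_closed tuple2_closed] pure2_minus)

lemma commutator_pure3:
  assumes "x \<in> carrier A" "y \<in> carrier A" "z \<in> carrier A" "w \<in> carrier A"
  shows "commutator (tensor_power A 3) (pure A [x, y, \<one>]) (pure A [z, \<one>, w]) = pure A [commutator A x z, y, w]"
  using assms unfolding commutator_def
  by (simp add: pure_mult[OF tuple3_closed tuple3_closed] pure3_minus)

end

section \<open>Evaluating tensors on one-forms\<close>

context based_lie_algebra
begin

abbreviation "H \<equiv> env_algebra scale bracket"
abbreviation "emb \<equiv> env_emb scale bracket"
abbreviation "T N \<equiv> tensor_power H N"

definition form_product :: "('d \<Rightarrow> 'k) list \<Rightarrow> ('d list \<Rightarrow> 'k) set list \<Rightarrow> 'k" where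
  "form_product \<alpha>s xs = (\<Prod>i<length \<alpha>s. (\<alpha>s ! i) (env_proj (xs ! i)))"

definition eval_forms :: "('d \<Rightarrow> 'k) list \<Rightarrow> (('d list \<Rightarrow> 'k) set list \<Rightarrow> 'k) set \<Rightarrow> 'k" where
  "eval_forms \<alpha>s = H.tensor_functional (form_product \<alpha>s)"

abbreviation "one_forms \<alpha>s \<equiv> (\<forall>\<alpha>\<in>set \<alpha>s. one_form scale \<alpha>)"

lemma one_formD:
  assumes "one_form scale \<alpha>"
  shows "\<alpha> (x + y) = \<alpha> x + \<alpha> y" "\<alpha> (scale c x) = c * \<alpha> x"
  using assms unfolding one_form_def Vector_Spaces.linear_iff by blast+

lemma one_formI:
  assumes "\<And>x y. \<alpha> (x + y) = \<alpha> x + \<alpha> y" "\<And>c x. \<alpha> (scale c x) = c * \<alpha> x"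
  shows "one_form scale \<alpha>"
  unfolding one_form_def using assms vector_space_field vector_space_axioms by (intro vector_space_linearI)

lemma one_form_coord: "one_form scale (\<lambda>x. coord x i)"
  by (rule one_formI) (simp_all add: coord_add coord_scale)

lemma multilinear_form_product:
  assumes "one_forms \<alpha>s"
  shows "field_algebra.multilinear_tuple H (length \<alpha>s) (form_product \<alpha>s)"
  unfolding H.multilinear_tuple_def
proof (intro ballI allI impI conjI)
  let ?n = "length \<alpha>s"
  fix xs i x assume xs: "xs \<in> carrier (tuple_monoid H ?n)" and i: "i < ?n" and x: "x \<in> carrier H"
  have form: "one_form scale (\<alpha>s ! i)" using assms i by simp
  have upd: "form_product \<alpha>s (xs[i := x]) = (\<alpha>s ! i) (env_proj x) * (\<Prod>k\<in>{..<?n} - {i}. (\<alpha>s ! k) (env_proj (xs ! k)))" for x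
    using xs i unfolding form_product_def by (subst prod.remove[of _ i]) (auto simp: tuple_carrier_iff intro!: prod.cong)
  show "form_product \<alpha>s (xs[i := x \<oplus>\<^bsub>H\<^esub> y]) = form_product \<alpha>s (xs[i := x]) + form_product \<alpha>s (xs[i := y])"
    if "y \<in> carrier H" for y
    unfolding upd using x that form by (simp add: env_proj_add one_formD distrib_right)
  show "form_product \<alpha>s (xs[i := c \<odot>\<^bsub>H\<^esub> x]) = c * form_product \<alpha>s (xs[i := x])" for c
    unfolding upd using x form by (simp add: env_proj_smult one_formD mult.assoc)
qed

lemma emb_tuple_closed [simp]: "length xs = N \<Longrightarrow> map emb xs \<in> carrier (tuple_monoid H N)"
  by (simp add: tuple_carrier_iff)

lemma eval_forms_add:
  "one_forms \<alpha>s \<Longrightarrow> X \<in> carrier (T (length \<alpha>s)) \<Longrightarrow> Y \<in> carrier (T (length \<alpha>s)) \<Longrightarrow>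
    eval_forms \<alpha>s (X \<oplus>\<^bsub>T (length \<alpha>s)\<^esub> Y) = eval_forms \<alpha>s X + eval_forms \<alpha>s Y"
  unfolding eval_forms_def by (rule H.tensor_functional_add[OF multilinear_form_product])

lemma eval_forms_smult:
  "one_forms \<alpha>s \<Longrightarrow> X \<in> carrier (T (length \<alpha>s)) \<Longrightarrow>
    eval_forms \<alpha>s (c \<odot>\<^bsub>T (length \<alpha>s)\<^esub> X) = c * eval_forms \<alpha>s X"
  unfolding eval_forms_def by (rule H.tensor_functional_smult[OF multilinear_form_product])

lemma eval_forms_finsum:
  "one_forms \<alpha>s \<Longrightarrow> finite S \<Longrightarrow> f \<in> S \<rightarrow> carrier (T (length \<alpha>s)) \<Longrightarrow>
    eval_forms \<alpha>s (\<Oplus>\<^bsub>T (length \<alpha>s)\<^esub>i\<in>S. f i) = (\<Sum>i\<in>S. eval_forms \<alpha>s (f i))"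
  unfolding eval_forms_def by (rule H.tensor_functional_finsum[OF multilinear_form_product])

lemma eval_forms_pure:
  assumes "one_forms \<alpha>s" "length xs = length \<alpha>s"
  shows "eval_forms \<alpha>s (pure H (map emb xs)) = (\<Prod>i<length \<alpha>s. (\<alpha>s ! i) (xs ! i))"
  unfolding eval_forms_def using assms
  by (subst H.tensor_functional_pure[OF multilinear_form_product]) (simp_all add: form_product_def)

section \<open>Tensors of Lie algebra elements\<close>

definition index_words :: "nat \<Rightarrow> nat list set" where
  "index_words N = {w. set w \<subseteq> {..<n} \<and> length w = N}"

lemma finite_index_words: "finite (index_words N)"
  unfolding index_words_def by (rule finite_lists_length_eq) simp

definition dual_word :: "nat list \<Rightarrow> ('d \<Rightarrow> 'k) list" where
  "dual_word w = map (\<lambda>i x. coord x i) w"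

lemma one_forms_dual_word: "one_forms (dual_word w)" "length (dual_word w) = length w"
  by (auto simp: dual_word_def one_form_coord)

text \<open>The span of the tensors of \<open>N\<close> Lie algebra elements, described by the fact that its members can be
recovered from their coordinates. The coordinates are values of products of one-forms, so in this
description an element on which all of these vanish is visibly zero.\<close>

definition lie_part :: "nat \<Rightarrow> (('d list \<Rightarrow> 'k) set list \<Rightarrow> 'k) set set" where
  "lie_part N = {X \<in> carrier (T N).
     X = (\<Oplus>\<^bsub>T N\<^esub>w\<in>index_words N. eval_forms (dual_word w) X \<odot>\<^bsub>T N\<^esub> pure H (map emb (map e w)))}"

lemma lie_part_carrier: "X \<in> lie_part N \<Longrightarrow> X \<in> carrier (T N)"
  unfolding lie_part_def by simp

lemma pure_emb_closed [simp]: "length xs = N \<Longrightarrow> pure H (map emb xs) \<in> carrier (T N)"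
  by (rule H.pure_closed) simp

lemma lie_part_eq_zero:
  assumes "X \<in> lie_part N" "\<And>\<alpha>s. one_forms \<alpha>s \<Longrightarrow> length \<alpha>s = N \<Longrightarrow> eval_forms \<alpha>s X = 0"
  shows "X = \<zero>\<^bsub>T N\<^esub>"
proof -
  interpret P: field_algebra "T N" by (rule H.field_algebra_tensor)
  have "X = (\<Oplus>\<^bsub>T N\<^esub>w\<in>index_words N. eval_forms (dual_word w) X \<odot>\<^bsub>T N\<^esub> pure H (map emb (map e w)))"
    using assms(1) unfolding lie_part_def by simp
  also have "\<dots> = (\<Oplus>\<^bsub>T N\<^esub>w\<in>index_words N. \<zero>\<^bsub>T N\<^esub>)"
    using assms(2)[OF one_forms_dual_word(1)] one_forms_dual_word(2)
    by (intro P.finsum_cong') (auto simp: index_words_def simp del: map_map)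
  finally show ?thesis by simp
qed

lemma lie_part_add:
  assumes "X \<in> lie_part N" "Y \<in> lie_part N"
  shows "X \<oplus>\<^bsub>T N\<^esub> Y \<in> lie_part N"
proof -
  interpret P: field_algebra "T N" by (rule H.field_algebra_tensor)
  let ?p = "\<lambda>w. pure H (map emb (map e w))"
  have p: "?p w \<in> carrier (T N)" if "w \<in> index_words N" for w
    using that by (simp add: index_words_def del: map_map)
  have XY: "X \<in> carrier (T N)" "Y \<in> carrier (T N)" using assms lie_part_carrier by auto
  have eval: "eval_forms (dual_word w) (X \<oplus>\<^bsub>T N\<^esub> Y) = eval_forms (dual_word w) X + eval_forms (dual_word w) Y"
    if "w \<in> index_words N" for w
    using that XY eval_forms_add[OF one_forms_dual_word(1)[of w]] one_forms_dual_word(2)[of w]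
    by (auto simp: index_words_def)
  have "(\<Oplus>\<^bsub>T N\<^esub>w\<in>index_words N. eval_forms (dual_word w) (X \<oplus>\<^bsub>T N\<^esub> Y) \<odot>\<^bsub>T N\<^esub> ?p w)
      = (\<Oplus>\<^bsub>T N\<^esub>w\<in>index_words N. eval_forms (dual_word w) X \<odot>\<^bsub>T N\<^esub> ?p w \<oplus>\<^bsub>T N\<^esub> eval_forms (dual_word w) Y \<odot>\<^bsub>T N\<^esub> ?p w)"
    using p XY eval by (intro P.finsum_cong') (auto simp: P.smult_add_left simp del: map_map)
  also have "\<dots> = X \<oplus>\<^bsub>T N\<^esub> Y"
    using assms p by (subst P.finsum_addf) (auto simp: lie_part_def simp del: map_map)
  finally show ?thesis using XY unfolding lie_part_def by simp
qed

lemma lie_part_smult: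
  assumes "X \<in> lie_part N"
  shows "c \<odot>\<^bsub>T N\<^esub> X \<in> lie_part N"
proof -
  interpret P: field_algebra "T N" by (rule H.field_algebra_tensor)
  let ?p = "\<lambda>w. pure H (map emb (map e w))"
  have p: "?p w \<in> carrier (T N)" if "w \<in> index_words N" for w
    using that by (simp add: index_words_def del: map_map)
  have X: "X \<in> carrier (T N)" using assms lie_part_carrier by auto
  have "(\<Oplus>\<^bsub>T N\<^esub>w\<in>index_words N. eval_forms (dual_word w) (c \<odot>\<^bsub>T N\<^esub> X) \<odot>\<^bsub>T N\<^esub> ?p w)
      = (\<Oplus>\<^bsub>T N\<^esub>w\<in>index_words N. c \<odot>\<^bsub>T N\<^esub> (eval_forms (dual_word w) X \<odot>\<^bsub>T N\<^esub> ?p w))"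
    using p X eval_forms_smult[OF one_forms_dual_word(1)] one_forms_dual_word(2)
    by (intro P.finsum_cong') (auto simp: P.smult_smult index_words_def simp del: map_map)
  also have "\<dots> = c \<odot>\<^bsub>T N\<^esub> X"
    using assms p finite_index_words
    by (subst P.smult_finsum[symmetric]) (auto simp: lie_part_def simp del: map_map)
  finally show ?thesis using X unfolding lie_part_def by simp
qed

lemma lie_part_zero: "\<zero>\<^bsub>T N\<^esub> \<in> lie_part N"
proof -
  interpret P: field_algebra "T N" by (rule H.field_algebra_tensor)
  let ?p = "\<lambda>w. pure H (map emb (map e w))"
  have "eval_forms (dual_word w) \<zero>\<^bsub>T N\<^esub> = 0" if "w \<in> index_words N" for w
    using eval_forms_smult[OF one_forms_dual_word(1)[of w], of "\<zero>\<^bsub>T N\<^esub>" 0] one_forms_dual_word(2)[of w] that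
    by (simp add: index_words_def)
  then have "(\<Oplus>\<^bsub>T N\<^esub>w\<in>index_words N. eval_forms (dual_word w) \<zero>\<^bsub>T N\<^esub> \<odot>\<^bsub>T N\<^esub> ?p w)
      = (\<Oplus>\<^bsub>T N\<^esub>w\<in>index_words N. \<zero>\<^bsub>T N\<^esub>)"
    by (intro P.finsum_cong') (auto simp: index_words_def simp del: map_map)
  then show ?thesis unfolding lie_part_def by simp
qed

lemma lie_part_finsum:
  assumes "finite S" "\<And>i. i \<in> S \<Longrightarrow> f i \<in> lie_part N"
  shows "(\<Oplus>\<^bsub>T N\<^esub>i\<in>S. f i) \<in> lie_part N"
proof -
  interpret P: field_algebra "T N" by (rule H.field_algebra_tensor)
  show ?thesis using assms
  proof (induction S rule: finite_induct)
    case (insert i S)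
    then have "(\<Oplus>\<^bsub>T N\<^esub>i\<in>insert i S. f i) = f i \<oplus>\<^bsub>T N\<^esub> (\<Oplus>\<^bsub>T N\<^esub>i\<in>S. f i)"
      by (intro P.finsum_insert) (auto intro: lie_part_carrier)
    then show ?case using insert lie_part_add by simp
  qed (simp add: lie_part_zero)
qed

text \<open>Products of dual basis vectors are dual to the tensors of basis vectors.\<close>

lemma lie_part_pure_basis:
  assumes v: "v \<in> index_words N"
  shows "pure H (map emb (map e v)) \<in> lie_part N"
proof -
  interpret P: field_algebra "T N" by (rule H.field_algebra_tensor)
  let ?p = "\<lambda>w. pure H (map emb (map e w))"
  have eval: "eval_forms (dual_word w) (?p v) = (if v = w then 1 else 0)" if w: "w \<in> index_words N" for w
  proof -
    have len: "length v = N" "length w = N" using v w by (auto simp: index_words_def)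
    have "eval_forms (dual_word w) (?p v) = (\<Prod>i<N. coord (e (v ! i)) (w ! i))"
      using eval_forms_pure[OF one_forms_dual_word(1), of "map e v" w] len
      by (simp add: one_forms_dual_word(2) dual_word_def del: map_map)
    also have "\<dots> = (\<Prod>i<N. if v ! i = w ! i then 1 else 0)"
    proof (rule prod.cong)
      fix i assume "i \<in> {..<N}"
      then have "v ! i \<in> set v" "w ! i \<in> set w" using len by auto
      then show "coord (e (v ! i)) (w ! i) = (if v ! i = w ! i then 1 else 0)"
        using v w by (intro coord_basis) (auto simp: index_words_def)
    qed simp
    also have "\<dots> = (if v = w then 1 else 0)"
    proof (cases "v = w")
      case False
      then obtain i where "i < N" "v ! i \<noteq> w ! i" using len nth_equalityI by metis
      then show ?thesis using False by (simp add: prod_zero_iff) (auto simp: Bex_def)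
    qed simp
    finally show ?thesis .
  qed
  have p: "?p w \<in> carrier (T N)" if "w \<in> index_words N" for w
    using that by (simp add: index_words_def del: map_map)
  have "(\<Oplus>\<^bsub>T N\<^esub>w\<in>index_words N. eval_forms (dual_word w) (?p v) \<odot>\<^bsub>T N\<^esub> ?p w)
      = (\<Oplus>\<^bsub>T N\<^esub>w\<in>index_words N. if v = w then ?p w else \<zero>\<^bsub>T N\<^esub>)"
    using p by (intro P.finsum_cong') (auto simp: eval simp del: map_map)
  also have "\<dots> = ?p v"
    using v finite_index_words p by (intro P.finsum_singleton) (auto simp del: map_map)
  finally show ?thesis using p[OF v] unfolding lie_part_def by simp
qed

lemma pure_emb_expand:
  assumes "length u + length v + 1 = N"
  shows "pure H (map emb (u @ x # v)) = (\<Oplus>\<^bsub>T N\<^esub>i\<in>{..<n}. coord x i \<odot>\<^bsub>T N\<^esub> pure H (map emb (u @ e i # v)))"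
proof -
  interpret P: field_algebra "T N" by (rule H.field_algebra_tensor)
  have emb: "emb (\<Sum>i\<in>S. scale (c i) (e i)) = (\<Oplus>\<^bsub>H\<^esub>i\<in>S. c i \<odot>\<^bsub>H\<^esub> emb (e i))" if "finite S" for S c
    using that
  proof (induction S rule: finite_induct)
    case empty
    have "emb 0 = emb (scale 0 0)" by simp
    also have "\<dots> = \<zero>\<^bsub>H\<^esub>" by (simp only: env_emb_scale H.smult_zero_left env_emb_closed)
    finally show ?case by simp
  qed (simp add: env_emb_add env_emb_scale)
  define xs where "xs = map emb (u @ x # v)"
  have xs: "xs \<in> carrier (tuple_monoid H N)" using assms unfolding xs_def by (intro emb_tuple_closed) simp
  have upd: "xs[length u := emb y] = map emb (u @ y # v)" for y
    unfolding xs_def by (simp add: list_update_append)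
  have lin: "algebra_linear H (T N) (\<lambda>y. pure H (xs[length u := y]))"
    using xs assms by (intro H.pure_linear) simp_all
  have "pure H (map emb (u @ x # v)) = pure H (xs[length u := emb (\<Sum>i<n. scale (coord x i) (e i))])"
    unfolding upd using coord_expand[of x] by simp
  also have "\<dots> = (\<Oplus>\<^bsub>T N\<^esub>i\<in>{..<n}. pure H (xs[length u := coord x i \<odot>\<^bsub>H\<^esub> emb (e i)]))"
    unfolding emb[OF finite_lessThan]
    by (rule algebra_linear_finsum[OF H.field_algebra_axioms H.field_algebra_tensor lin]) auto
  also have "\<dots> = (\<Oplus>\<^bsub>T N\<^esub>i\<in>{..<n}. coord x i \<odot>\<^bsub>T N\<^esub> pure H (map emb (u @ e i # v)))"
    using assms by (intro P.finsum_cong') (auto simp: algebra_linearD(3)[OF lin] upd simp del: map_append list.map)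
  finally show ?thesis .
qed

text \<open>The factors are expanded in the basis one after the other; \<open>u\<close> collects those already expanded.\<close>

lemma lie_part_pure:
  assumes "length xs = N"
  shows "pure H (map emb xs) \<in> lie_part N"
proof -
  have "pure H (map emb (map e u @ v)) \<in> lie_part N"
    if "length u + length v = N" "set u \<subseteq> {..<n}" for u v
    using that
  proof (induction v arbitrary: u)
    case Nil
    then show ?case using lie_part_pure_basis[of u N] by (simp add: index_words_def)
  next
    case (Cons x v)
    have "pure H (map emb (map e u @ e i # v)) \<in> lie_part N" if "i < n" for i
      using Cons.IH[of "u @ [i]"] Cons.prems that by simp
    then show ?case
      using Cons.prems by (subst pure_emb_expand[of _ _ N]) (auto intro!: lie_part_finsum lie_part_smult simp del: map_append list.map)
  qed
  from this[of "[]" xs] assms show ?thesis by simp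
qed

lemma lie_part_linear_image:
  assumes "algebra_linear (T N) (T M) F"
    and "\<And>xs. length xs = N \<Longrightarrow> F (pure H (map emb xs)) \<in> lie_part M"
    and "X \<in> lie_part N"
  shows "F X \<in> lie_part M"
proof -
  let ?p = "\<lambda>w. pure H (map emb (map e w))"
  let ?c = "\<lambda>w. eval_forms (dual_word w) X"
  interpret P: field_algebra "T N" by (rule H.field_algebra_tensor)
  have p: "?p w \<in> carrier (T N)" "F (?p w) \<in> lie_part M" if "w \<in> index_words N" for w
    using that assms(2)[of "map e w"] by (simp_all add: index_words_def del: map_map)
  have "F X = F (\<Oplus>\<^bsub>T N\<^esub>w\<in>index_words N. ?c w \<odot>\<^bsub>T N\<^esub> ?p w)"
    using assms(3) unfolding lie_part_def by simp
  also have "\<dots> = (\<Oplus>\<^bsub>T M\<^esub>w\<in>index_words N. F (?c w \<odot>\<^bsub>T N\<^esub> ?p w))"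
    using p finite_index_words
    by (intro algebra_linear_finsum[OF H.field_algebra_tensor H.field_algebra_tensor assms(1)]) auto
  also have "\<dots> \<in> lie_part M"
    using p by (intro lie_part_finsum finite_index_words)
      (auto simp: algebra_linearD(3)[OF assms(1)] intro!: lie_part_smult simp del: map_map)
  finally show ?thesis .
qed

lemma eval_forms_zero:
  assumes "one_forms \<alpha>s" "length \<alpha>s = N"
  shows "eval_forms \<alpha>s \<zero>\<^bsub>T N\<^esub> = 0"
proof -
  interpret P: field_algebra "T N" by (rule H.field_algebra_tensor)
  show ?thesis using eval_forms_smult[OF assms(1), of "\<zero>\<^bsub>T N\<^esub>" 0] assms(2) by simp
qed

lemma lie_part_eq_zero_iff:
  "X \<in> lie_part N \<Longrightarrow> X = \<zero>\<^bsub>T N\<^esub> \<longleftrightarrow> (\<forall>\<alpha>s. one_forms \<alpha>s \<and> length \<alpha>s = N \<longrightarrow> eval_forms \<alpha>s X = 0)"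
  using lie_part_eq_zero[of X N] eval_forms_zero[of _ N] by blast

section \<open>Tensors with coordinates\<close>

definition tensor2 :: "'d \<Rightarrow> 'd \<Rightarrow> (('d list \<Rightarrow> 'k) set list \<Rightarrow> 'k) set" where
  "tensor2 a b = pure H [emb a, emb b]"

definition tensor3 :: "'d \<Rightarrow> 'd \<Rightarrow> 'd \<Rightarrow> (('d list \<Rightarrow> 'k) set list \<Rightarrow> 'k) set" where
  "tensor3 a b c = pure H [emb a, emb b, emb c]"

lemma tensor2_lie_part: "tensor2 a b \<in> lie_part 2"
  using lie_part_pure[of "[a, b]" 2] by (simp add: tensor2_def)

lemma tensor3_lie_part: "tensor3 a b c \<in> lie_part 3"
  using lie_part_pure[of "[a, b, c]" 3] by (simp add: tensor3_def)

lemmas tensor2_closed = lie_part_carrier[OF tensor2_lie_part]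

lemma eval_tensor2:
  "one_form scale \<alpha> \<Longrightarrow> one_form scale \<beta> \<Longrightarrow> eval_forms [\<alpha>, \<beta>] (tensor2 a b) = \<alpha> a * \<beta> b"
  using eval_forms_pure[of "[\<alpha>, \<beta>]" "[a, b]"] by (simp add: tensor2_def lessThan_Suc mult.commute)

lemma eval_tensor3:
  "one_form scale \<alpha> \<Longrightarrow> one_form scale \<beta> \<Longrightarrow> one_form scale \<gamma> \<Longrightarrow>
    eval_forms [\<alpha>, \<beta>, \<gamma>] (tensor3 a b c) = \<alpha> a * \<beta> b * \<gamma> c"
  using eval_forms_pure[of "[\<alpha>, \<beta>, \<gamma>]" "[a, b, c]"] by (simp add: tensor3_def lessThan_Suc ac_simps)

text \<open>The value of the bilinear form \<open>F\<close> on the tensor with matrix \<open>R\<close>.\<close>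

definition pairing :: "'k mat \<Rightarrow> ('d \<Rightarrow> 'd \<Rightarrow> 'k) \<Rightarrow> 'k" where
  "pairing R F = (\<Sum>p\<in>{..<n} \<times> {..<n}. R $$ p * F (e (fst p)) (e (snd p)))"

abbreviation "coords \<equiv> has_coords scale bracket n e"

lemma coords_sum:
  "coords r R \<Longrightarrow> r = (\<Oplus>\<^bsub>T 2\<^esub>p\<in>{..<n} \<times> {..<n}. R $$ p \<odot>\<^bsub>T 2\<^esub> tensor2 (e (fst p)) (e (snd p)))"
  unfolding has_coords_def tensor2_def by blast

text \<open>Both equations are built from \<open>r\<close> by linear maps, which therefore need only be computed on the
tensors \<open>a \<otimes> b\<close>.\<close>

lemma linear_image_coords:
  assumes r: "coords r R" and F: "algebra_linear (T 2) (T N) F"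
    and lie: "\<And>a b. F (tensor2 a b) \<in> lie_part N"
  shows "F r \<in> lie_part N"
    and "one_forms \<alpha>s \<Longrightarrow> length \<alpha>s = N \<Longrightarrow> eval_forms \<alpha>s (F r) = pairing R (\<lambda>a b. eval_forms \<alpha>s (F (tensor2 a b)))"
proof -
  interpret P: field_algebra "T 2" by (rule H.field_algebra_tensor)
  interpret Q: field_algebra "T N" by (rule H.field_algebra_tensor)
  let ?I = "{..<n} \<times> {..<n}"
  have Fr: "F r = (\<Oplus>\<^bsub>T N\<^esub>p\<in>?I. F (R $$ p \<odot>\<^bsub>T 2\<^esub> tensor2 (e (fst p)) (e (snd p))))"
    unfolding coords_sum[OF r]
    by (rule algebra_linear_finsum[OF H.field_algebra_tensor H.field_algebra_tensor F])
      (auto simp: tensor2_closed)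
  also have "\<dots> = (\<Oplus>\<^bsub>T N\<^esub>p\<in>?I. R $$ p \<odot>\<^bsub>T N\<^esub> F (tensor2 (e (fst p)) (e (snd p))))"
    by (rule Q.finsum_cong')
      (auto simp: algebra_linearD(3)[OF F] tensor2_closed intro: lie_part_carrier lie)
  finally have Fr: "F r = \<dots>" .
  show "F r \<in> lie_part N"
    unfolding Fr by (intro lie_part_finsum lie_part_smult lie) auto
  show "eval_forms \<alpha>s (F r) = pairing R (\<lambda>a b. eval_forms \<alpha>s (F (tensor2 a b)))"
    if \<alpha>s: "one_forms \<alpha>s" "length \<alpha>s = N"
  proof -
    note c = lie_part_carrier[OF lie]
    have "eval_forms \<alpha>s (F r) = (\<Sum>p\<in>?I. eval_forms \<alpha>s (R $$ p \<odot>\<^bsub>T N\<^esub> F (tensor2 (e (fst p)) (e (snd p)))))"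
      unfolding Fr using \<alpha>s c by (intro eval_forms_finsum[OF \<alpha>s(1), unfolded \<alpha>s(2)]) auto
    then show ?thesis
      unfolding pairing_def using eval_forms_smult[OF \<alpha>s(1), unfolded \<alpha>s(2)] c by simp
  qed
qed

lemma coords_lie_part: "coords r R \<Longrightarrow> r \<in> lie_part 2"
  by (rule linear_image_coords(1)[OF _ algebra_linear_id tensor2_lie_part])

lemma coords_eval:
  "coords r R \<Longrightarrow> one_form scale \<alpha> \<Longrightarrow> one_form scale \<beta> \<Longrightarrow>
    eval_forms [\<alpha>, \<beta>] r = pairing R (\<lambda>a b. \<alpha> a * \<beta> b)"
  using linear_image_coords(2)[OF _ algebra_linear_id tensor2_lie_part, of r R "[\<alpha>, \<beta>]"]
  by (simp add: eval_tensor2)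

lemma pairing_coord:
  assumes "i < n" "j < n"
  shows "pairing R (\<lambda>a b. coord a i * coord b j) = R $$ (i, j)"
proof -
  have "pairing R (\<lambda>a b. coord a i * coord b j) = (\<Sum>p\<in>{..<n} \<times> {..<n}. if p = (i, j) then R $$ p else 0)"
    unfolding pairing_def by (intro sum.cong) (auto simp: coord_basis assms split: if_splits)
  then show ?thesis using assms by simp
qed

lemma coords_unique:
  assumes "coords r R" "coords r R'"
  shows "R = R'"
proof (rule eq_matI)
  have dims: "R \<in> carrier_mat n n" "R' \<in> carrier_mat n n" using assms by (auto simp: has_coords_def)
  then show "dim_row R = dim_row R'" "dim_col R = dim_col R'" by auto
  fix i j assume "i < dim_row R'" "j < dim_col R'"
  then have "i < n" "j < n" using dims by auto
  then show "R $$ (i, j) = R' $$ (i, j)"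
    using coords_eval[OF assms(1) one_form_coord one_form_coord] coords_eval[OF assms(2) one_form_coord one_form_coord]
      pairing_coord by metis
qed

text \<open>The sum of \<open>r\<close> and its flip is tested on all pairs of one-forms. Pairs of coordinates give the
entries of the symmetric part of \<open>R\<close>.\<close>

lemma tensor_map_rev_iff:
  assumes r: "coords r R"
  shows "tensor_map H 2 rev r = \<ominus>\<^bsub>T 2\<^esub> r \<longleftrightarrow> (\<forall>i<n. \<forall>j<n. R $$ (j, i) = - R $$ (i, j))"
proof -
  interpret P: field_algebra "T 2" by (rule H.field_algebra_tensor)
  let ?F = "\<lambda>X. tensor_map H 2 rev X \<oplus>\<^bsub>T 2\<^esub> X"
  have rev: "tensor_map H 2 rev (tensor2 a b) = tensor2 b a" for a b
    unfolding tensor2_def by (subst H.tensor_map_pure[OF H.tuple_hom_rev2]) (simp_all add: H.tuple2_closed)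
  note lin_rev = H.tensor_map_linear[OF H.tuple_hom_rev2, of scale bracket]
  have lin: "algebra_linear (T 2) (T 2) ?F"
    by (rule algebra_linear_add[OF H.field_algebra_tensor lin_rev algebra_linear_id])
  have lie: "?F (tensor2 a b) \<in> lie_part 2" for a b
    by (simp add: rev lie_part_add tensor2_lie_part)
  have eval: "eval_forms [\<alpha>, \<beta>] (?F r) = pairing R (\<lambda>a b. \<alpha> b * \<beta> a + \<alpha> a * \<beta> b)"
    if "one_form scale \<alpha>" "one_form scale \<beta>" for \<alpha> \<beta>
    using that eval_forms_add[of "[\<alpha>, \<beta>]" "tensor2 b a" "tensor2 a b" for a b]
    by (subst linear_image_coords(2)[OF r lin lie]) (simp_all add: rev eval_tensor2 tensor2_closed numeral_2_eq_2[symmetric])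
  have pair_sym: "pairing R (\<lambda>a b. \<alpha> b * \<beta> a + \<alpha> a * \<beta> b) = pairing R (\<lambda>a b. \<beta> a * \<alpha> b) + pairing R (\<lambda>a b. \<alpha> a * \<beta> b)"
    for \<alpha> \<beta>
    unfolding pairing_def by (simp add: distrib_left sum.distrib mult.commute mult.left_commute)
  have rc: "r \<in> carrier (T 2)" "tensor_map H 2 rev r \<in> carrier (T 2)"
    using coords_lie_part[OF r] lie_part_carrier algebra_linearD(1)[OF lin_rev] by auto
  then have "tensor_map H 2 rev r = \<ominus>\<^bsub>T 2\<^esub> r \<longleftrightarrow> ?F r = \<zero>\<^bsub>T 2\<^esub>"
    by (metis P.minus_equality P.l_neg)
  also have "\<dots> \<longleftrightarrow> (\<forall>\<alpha>s. one_forms \<alpha>s \<and> length \<alpha>s = 2 \<longrightarrow> eval_forms \<alpha>s (?F r) = 0)"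
    by (rule lie_part_eq_zero_iff[OF linear_image_coords(1)[OF r lin lie]])
  also have "\<dots> \<longleftrightarrow> (\<forall>\<alpha> \<beta>. one_form scale \<alpha> \<and> one_form scale \<beta> \<longrightarrow> eval_forms [\<alpha>, \<beta>] (?F r) = 0)"
    by (auto simp: length_Suc_conv numeral_2_eq_2)
  also have "\<dots> \<longleftrightarrow> (\<forall>i<n. \<forall>j<n. R $$ (j, i) = - R $$ (i, j))"
  proof (intro iffI allI impI)
    fix i j assume *: "\<forall>\<alpha> \<beta>. one_form scale \<alpha> \<and> one_form scale \<beta> \<longrightarrow> eval_forms [\<alpha>, \<beta>] (?F r) = 0" and ij: "i < n" "j < n"
    have "R $$ (j, i) + R $$ (i, j) = 0"
      using * eval[OF one_form_coord one_form_coord, of i j] ij one_form_coord by (simp add: pair_sym pairing_coord)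
    then show "R $$ (j, i) = - R $$ (i, j)" by (simp add: eq_neg_iff_add_eq_0)
  next
    fix \<alpha> \<beta> assume skew: "\<forall>i<n. \<forall>j<n. R $$ (j, i) = - R $$ (i, j)" and form: "one_form scale \<alpha> \<and> one_form scale \<beta>"
    have "pairing R (\<lambda>a b. \<beta> a * \<alpha> b) = (\<Sum>i<n. \<Sum>j<n. R $$ (i, j) * (\<beta> (e i) * \<alpha> (e j)))"
      unfolding pairing_def by (simp add: sum.cartesian_product split_beta)
    also have "\<dots> = (\<Sum>i<n. \<Sum>j<n. R $$ (j, i) * (\<beta> (e j) * \<alpha> (e i)))"
      by (rule sum.swap)
    also have "\<dots> = (\<Sum>i<n. \<Sum>j<n. - (R $$ (i, j) * (\<alpha> (e i) * \<beta> (e j))))"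
    proof (intro sum.cong refl)
      fix i j assume "i \<in> {..<n}" "j \<in> {..<n}"
      then have "R $$ (j, i) = - R $$ (i, j)" using skew by blast
      then show "R $$ (j, i) * (\<beta> (e j) * \<alpha> (e i)) = - (R $$ (i, j) * (\<alpha> (e i) * \<beta> (e j)))"
        by (simp only: mult_minus_left mult.commute[of "\<beta> (e j)"])
    qed
    also have "\<dots> = - pairing R (\<lambda>a b. \<alpha> a * \<beta> b)"
      unfolding pairing_def by (simp add: sum.cartesian_product split_beta sum_negf)
    finally show "eval_forms [\<alpha>, \<beta>] (?F r) = 0" using form by (simp add: eval pair_sym)
  qed
  finally show ?thesis .
qed

section \<open>The equations evaluated on one-forms\<close>

abbreviation "Delta \<equiv> coproduct scale bracket"
abbreviation "r12 \<equiv> place12 scale bracket"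
abbreviation "r13 \<equiv> place13 scale bracket"
abbreviation "s3 \<equiv> place3 scale bracket"

lemma commutator_coproduct:
  assumes r: "coords r R"
  shows "commutator (T 2) r (Delta s) \<in> lie_part 2"
    and "one_form scale \<alpha> \<Longrightarrow> one_form scale \<beta> \<Longrightarrow> eval_forms [\<alpha>, \<beta>] (commutator (T 2) r (Delta s))
      = pairing R (\<lambda>a b. \<alpha> (bracket a s) * \<beta> b + \<alpha> a * \<beta> (bracket b s))"
proof -
  interpret P: field_algebra "T 2" by (rule H.field_algebra_tensor)
  have c1: "pure H [emb s, \<one>\<^bsub>H\<^esub>] \<in> carrier (T 2)" and c2: "pure H [\<one>\<^bsub>H\<^esub>, emb s] \<in> carrier (T 2)"
    by (auto intro!: H.pure_closed H.tuple2_closed)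
  have \<Delta>: "Delta s \<in> carrier (T 2)" unfolding coproduct_def using c1 c2 by simp
  have val: "commutator (T 2) (tensor2 a b) (Delta s) = tensor2 (bracket a s) b \<oplus>\<^bsub>T 2\<^esub> tensor2 a (bracket b s)" for a b
    unfolding coproduct_def algebra_linearD(2)[OF P.commutator_linear_right[OF tensor2_closed] c1 c2]
    unfolding tensor2_def by (simp add: H.commutator_pure2 commutator_env_emb)
  have lie: "commutator (T 2) (tensor2 a b) (Delta s) \<in> lie_part 2" for a b
    unfolding val by (intro lie_part_add tensor2_lie_part)
  note img = linear_image_coords[OF r P.commutator_linear_left[OF \<Delta>] lie]
  show "commutator (T 2) r (Delta s) \<in> lie_part 2" by (rule img(1))
  show "eval_forms [\<alpha>, \<beta>] (commutator (T 2) r (Delta s))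
      = pairing R (\<lambda>a b. \<alpha> (bracket a s) * \<beta> b + \<alpha> a * \<beta> (bracket b s))"
    if "one_form scale \<alpha>" "one_form scale \<beta>"
    using that eval_forms_add[of "[\<alpha>, \<beta>]" "tensor2 (bracket a s) b" "tensor2 a (bracket b s)" for a b]
    by (subst img(2)) (simp_all add: val eval_tensor2 tensor2_closed numeral_2_eq_2[symmetric])
qed

text \<open>The element whose cyclic sum is the second equation.\<close>

definition cubic :: "(('d list \<Rightarrow> 'k) set list \<Rightarrow> 'k) set \<Rightarrow> 'd \<Rightarrow> (('d list \<Rightarrow> 'k) set list \<Rightarrow> 'k) set" where
  "cubic r s = commutator (T 3) (r12 r) (r13 r) \<oplus>\<^bsub>T 3\<^esub> (r12 r \<otimes>\<^bsub>T 3\<^esub> s3 s)"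

lemma place_linear: "algebra_linear (T 2) (T 3) r12" "algebra_linear (T 2) (T 3) r13"
  unfolding place12_def place13_def
  by (rule H.tensor_map_linear[OF H.tuple_hom_12] H.tensor_map_linear[OF H.tuple_hom_13])+

lemma place_tensor2:
  "r12 (tensor2 a b) = pure H [emb a, emb b, \<one>\<^bsub>H\<^esub>]" "r13 (tensor2 a b) = pure H [emb a, \<one>\<^bsub>H\<^esub>, emb b]"
  unfolding place12_def place13_def tensor2_def
  using H.tensor_map_pure[OF H.tuple_hom_12 H.tuple2_closed, of "emb a" scale bracket "emb b"]
    H.tensor_map_pure[OF H.tuple_hom_13 H.tuple2_closed, of "emb a" scale bracket "emb b"] by simp_all

text \<open>The commutator is linear in each of its two occurrences of \<open>r\<close>, which gives the nested pairing.\<close>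

lemma cubic:
  assumes r: "coords r R"
  shows "cubic r s \<in> lie_part 3"
    and "one_form scale \<alpha> \<Longrightarrow> one_form scale \<beta> \<Longrightarrow> one_form scale \<gamma> \<Longrightarrow> eval_forms [\<alpha>, \<beta>, \<gamma>] (cubic r s)
      = pairing R (\<lambda>a b. pairing R (\<lambda>c d. \<alpha> (bracket a c) * \<beta> b * \<gamma> d)) + pairing R (\<lambda>a b. \<alpha> a * \<beta> b * \<gamma> s)"
proof -
  interpret P: field_algebra "T 3" by (rule H.field_algebra_tensor)
  have rc: "r \<in> carrier (T 2)" by (rule lie_part_carrier[OF coords_lie_part[OF r]])
  have s3: "s3 s \<in> carrier (T 3)" unfolding place3_def by (intro H.pure_closed H.tuple3_closed) simp_all
  have pl: "r12 X \<in> carrier (T 3)" "r13 X \<in> carrier (T 3)" if "X \<in> carrier (T 2)" for X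
    using algebra_linearD(1)[OF place_linear(1) that] algebra_linearD(1)[OF place_linear(2) that] .
  have val: "commutator (T 3) (r12 (tensor2 a b)) (r13 (tensor2 c d)) = tensor3 (bracket a c) b d" for a b c d
    unfolding place_tensor2 tensor3_def by (simp add: H.commutator_pure3 commutator_env_emb)
  have lin1: "algebra_linear (T 2) (T 3) (\<lambda>Y. commutator (T 3) (r12 (tensor2 a b)) (r13 Y))" for a b
    by (rule algebra_linear_compose[OF place_linear(2) P.commutator_linear_right[OF pl(1)[OF tensor2_closed]]])
  have lin2: "algebra_linear (T 2) (T 3) (\<lambda>X. commutator (T 3) (r12 X) (r13 r))"
    by (rule algebra_linear_compose[OF place_linear(1) P.commutator_linear_left[OF pl(2)[OF rc]]])
  have lin3: "algebra_linear (T 2) (T 3) (\<lambda>X. r12 X \<otimes>\<^bsub>T 3\<^esub> s3 s)"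
    by (rule algebra_linear_compose[OF place_linear(1) P.mult_linear_left[OF s3]])
  have val3: "r12 (tensor2 a b) \<otimes>\<^bsub>T 3\<^esub> s3 s = tensor3 a b s" for a b
    unfolding place_tensor2 place3_def tensor3_def
    by (simp add: H.pure_mult[OF H.tuple3_closed H.tuple3_closed])
  note img1 = linear_image_coords[OF r lin1, unfolded val, OF tensor3_lie_part]
  note img2 = linear_image_coords[OF r lin2 img1(1)]
  note img3 = linear_image_coords[OF r lin3, unfolded val3, OF tensor3_lie_part]
  show "cubic r s \<in> lie_part 3"
    unfolding cubic_def by (rule lie_part_add[OF img2(1) img3(1)])
  show "eval_forms [\<alpha>, \<beta>, \<gamma>] (cubic r s)
      = pairing R (\<lambda>a b. pairing R (\<lambda>c d. \<alpha> (bracket a c) * \<beta> b * \<gamma> d)) + pairing R (\<lambda>a b. \<alpha> a * \<beta> b * \<gamma> s)"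
    if \<alpha>\<beta>\<gamma>: "one_form scale \<alpha>" "one_form scale \<beta>" "one_form scale \<gamma>"
  proof -
    have forms: "one_forms [\<alpha>, \<beta>, \<gamma>]" "length [\<alpha>, \<beta>, \<gamma>] = 3" using \<alpha>\<beta>\<gamma> by auto
    have "eval_forms [\<alpha>, \<beta>, \<gamma>] (cubic r s) = eval_forms [\<alpha>, \<beta>, \<gamma>] (commutator (T 3) (r12 r) (r13 r))
        + eval_forms [\<alpha>, \<beta>, \<gamma>] (r12 r \<otimes>\<^bsub>T 3\<^esub> s3 s)"
      unfolding cubic_def
      by (rule eval_forms_add[OF forms(1), unfolded forms(2)]) (rule lie_part_carrier img2(1) img3(1))+
    then show ?thesis
      unfolding img2(2)[OF forms] img1(2)[OF forms] img3(2)[OF forms] using \<alpha>\<beta>\<gamma> by (simp add: eval_tensor3)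
  qed
qed

text \<open>Rotating the factors of a tensor rotates the forms it is evaluated on in the opposite direction.\<close>

lemma plus_cyclic_lie_part:
  assumes X: "X \<in> lie_part 3"
  shows "plus_cyclic scale bracket X \<in> lie_part 3"
    and "one_form scale \<alpha> \<Longrightarrow> one_form scale \<beta> \<Longrightarrow> one_form scale \<gamma> \<Longrightarrow>
      eval_forms [\<alpha>, \<beta>, \<gamma>] (plus_cyclic scale bracket X)
        = eval_forms [\<alpha>, \<beta>, \<gamma>] X + eval_forms [\<gamma>, \<alpha>, \<beta>] X + eval_forms [\<beta>, \<gamma>, \<alpha>] X"
proof -
  interpret P: field_algebra "T 3" by (rule H.field_algebra_tensor)
  let ?X1 = "tensor_map H 3 rotate1 X" and ?X2 = "tensor_map H 3 (rotate 2) X"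
  have X1: "?X1 \<in> lie_part 3"
    by (rule lie_part_linear_image[OF H.tensor_map_linear[OF H.tuple_hom_rotate1] _ X])
      (simp add: H.tensor_map_pure[OF H.tuple_hom_rotate1] rotate1_map lie_part_pure)
  have X2: "?X2 \<in> lie_part 3"
    by (rule lie_part_linear_image[OF H.tensor_map_linear[OF H.tuple_hom_rotate2] _ X])
      (simp add: H.tensor_map_pure[OF H.tuple_hom_rotate2] rotate_map lie_part_pure)
  show "plus_cyclic scale bracket X \<in> lie_part 3"
    unfolding plus_cyclic_def by (intro lie_part_add X X1 X2)
  show "eval_forms [\<alpha>, \<beta>, \<gamma>] (plus_cyclic scale bracket X)
      = eval_forms [\<alpha>, \<beta>, \<gamma>] X + eval_forms [\<gamma>, \<alpha>, \<beta>] X + eval_forms [\<beta>, \<gamma>, \<alpha>] X"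
    if \<alpha>\<beta>\<gamma>: "one_form scale \<alpha>" "one_form scale \<beta>" "one_form scale \<gamma>"
  proof -
    have forms: "one_forms [\<alpha>, \<beta>, \<gamma>]" "length [\<alpha>, \<beta>, \<gamma>] = 3" using \<alpha>\<beta>\<gamma> by auto
    have ml: "field_algebra.multilinear_tuple H 3 (form_product [\<alpha>, \<beta>, \<gamma>])"
      if "one_form scale \<alpha>" "one_form scale \<beta>" "one_form scale \<gamma>" for \<alpha> \<beta> \<gamma>
      using multilinear_form_product[of "[\<alpha>, \<beta>, \<gamma>]"] that by (simp add: numeral_3_eq_3)
    have prod: "form_product [\<alpha>, \<beta>, \<gamma>] [x, y, z] = \<alpha> (env_proj x) * \<beta> (env_proj y) * \<gamma> (env_proj z)" for \<alpha> \<beta> \<gamma> x y z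
      by (simp add: form_product_def lessThan_Suc ac_simps)
    have "eval_forms [\<alpha>, \<beta>, \<gamma>] ?X1 = eval_forms [\<gamma>, \<alpha>, \<beta>] X"
      unfolding eval_forms_def
      by (rule H.tensor_functional_map[OF H.tuple_hom_rotate1 ml ml _ lie_part_carrier[OF X]])
        (auto elim!: H.tuple3_cases simp: prod \<alpha>\<beta>\<gamma>)
    moreover have "eval_forms [\<alpha>, \<beta>, \<gamma>] ?X2 = eval_forms [\<beta>, \<gamma>, \<alpha>] X"
      unfolding eval_forms_def
      by (rule H.tensor_functional_map[OF H.tuple_hom_rotate2 ml ml _ lie_part_carrier[OF X]])
        (auto elim!: H.tuple3_cases simp: prod \<alpha>\<beta>\<gamma> numeral_2_eq_2)
    moreover have "eval_forms [\<alpha>, \<beta>, \<gamma>] (plus_cyclic scale bracket X)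
        = eval_forms [\<alpha>, \<beta>, \<gamma>] X + eval_forms [\<alpha>, \<beta>, \<gamma>] ?X1 + eval_forms [\<alpha>, \<beta>, \<gamma>] ?X2"
      unfolding plus_cyclic_def using X X1 X2 lie_part_carrier
      by (simp add: eval_forms_add[OF forms(1), unfolded forms(2)])
    ultimately show ?thesis by simp
  qed
qed

theorem rs_equations_iff:
  assumes r: "coords r R"
  shows "rs_equations scale bracket r s \<longleftrightarrow>
    (\<forall>\<alpha> \<beta>. one_form scale \<alpha> \<and> one_form scale \<beta> \<longrightarrow>
       pairing R (\<lambda>a b. \<alpha> (bracket a s) * \<beta> b + \<alpha> a * \<beta> (bracket b s)) = 0) \<and>
    (\<forall>\<alpha> \<beta> \<gamma>. one_form scale \<alpha> \<and> one_form scale \<beta> \<and> one_form scale \<gamma> \<longrightarrow>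
       eval_forms [\<alpha>, \<beta>, \<gamma>] (cubic r s) + eval_forms [\<gamma>, \<alpha>, \<beta>] (cubic r s) + eval_forms [\<beta>, \<gamma>, \<alpha>] (cubic r s) = 0)"
proof -
  have two: "(\<forall>\<alpha>s. one_forms \<alpha>s \<and> length \<alpha>s = 2 \<longrightarrow> P \<alpha>s) \<longleftrightarrow>
      (\<forall>\<alpha> \<beta>. one_form scale \<alpha> \<and> one_form scale \<beta> \<longrightarrow> P [\<alpha>, \<beta>])" for P
    by (auto simp: length_Suc_conv numeral_2_eq_2)
  have three: "(\<forall>\<alpha>s. one_forms \<alpha>s \<and> length \<alpha>s = 3 \<longrightarrow> P \<alpha>s) \<longleftrightarrow>
      (\<forall>\<alpha> \<beta> \<gamma>. one_form scale \<alpha> \<and> one_form scale \<beta> \<and> one_form scale \<gamma> \<longrightarrow> P [\<alpha>, \<beta>, \<gamma>])" for P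
    by (auto simp: length_Suc_conv numeral_3_eq_3)
  show ?thesis
    unfolding rs_equations_def cubic_def[symmetric]
      lie_part_eq_zero_iff[OF commutator_coproduct(1)[OF r]]
      lie_part_eq_zero_iff[OF plus_cyclic_lie_part(1)[OF cubic(1)[OF r]]] two three
    using commutator_coproduct(2)[OF r] plus_cyclic_lie_part(2)[OF cubic(1)[OF r]] by simp
qed

end

section \<open>The inverse form\<close>

lemma inverse_skew:
  fixes A B :: "'a::field mat"
  assumes A: "A \<in> carrier_mat n n" and B: "B \<in> carrier_mat n n"
    and BA: "B * A = 1\<^sub>m n" and AB: "A * B = 1\<^sub>m n" and skew: "A\<^sup>T = - A"
  shows "B\<^sup>T = - B"
proof -
  have "B\<^sup>T * A\<^sup>T = 1\<^sub>m n" using transpose_mult[OF A B] AB by simp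
  then have "- (B\<^sup>T) * A = 1\<^sub>m n" unfolding skew using A B by simp
  then have "- (B\<^sup>T) * A * B = B" using B by simp
  moreover have "- (B\<^sup>T) * A * B = - (B\<^sup>T) * (A * B)" using A B by (intro assoc_mult_mat) auto
  ultimately have "- (B\<^sup>T) = B" using AB B by simp
  then show ?thesis using B by (metis uminus_uminus_mat)
qed

lemma skew_mat_iff:
  "A \<in> carrier_mat n n \<Longrightarrow> A\<^sup>T = - A \<longleftrightarrow> (\<forall>i<n. \<forall>j<n. A $$ (j, i) = - A $$ (i, j))"
  by (auto simp: mat_eq_iff)

context based_lie_algebra
begin

lemma two_formD:
  assumes "two_form scale \<omega>"
  shows "one_form scale (\<omega> a)" "one_form scale (\<lambda>a. \<omega> a b)" "\<omega> a a = 0" "\<omega> a b = - \<omega> b a"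
proof -
  show *: "one_form scale (\<omega> a)" "one_form scale (\<lambda>a. \<omega> a b)" "\<omega> a a = 0" for a b
    using assms unfolding alternating_form_def one_form_def by blast+
  have "\<omega> (a + b) (a + b) = \<omega> a a + \<omega> b b + (\<omega> a b + \<omega> b a)"
    by (simp add: one_formD(1)[OF *(1)] one_formD(1)[OF *(2)])
  then show "\<omega> a b = - \<omega> b a" by (simp add: *(3) eq_neg_iff_add_eq_0)
qed

lemma one_form_bracket: "one_form scale \<alpha> \<Longrightarrow> one_form scale (\<lambda>x. \<alpha> (bracket x c))" "one_form scale \<alpha> \<Longrightarrow> one_form scale (\<lambda>x. \<alpha> (bracket c x))"
  by (rule one_formI; simp add: bracket_add_left bracket_add_right bracket_scale_left bracket_scale_right one_formD)+

lemma one_form_times: "one_form scale \<alpha> \<Longrightarrow> one_form scale (\<lambda>x. \<alpha> x * c)"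
  by (rule one_formI) (simp_all add: one_formD algebra_simps)

lemma one_form_uminus: "one_form scale \<alpha> \<Longrightarrow> one_form scale (\<lambda>x. - \<alpha> x)"
  by (rule one_formI) (simp_all add: one_formD)

lemma one_form_expand: "one_form scale \<alpha> \<Longrightarrow> \<alpha> x = (\<Sum>i<n. coord x i * \<alpha> (e i))"
  unfolding one_form_def by (rule linear_expand)

lemma one_form_sum:
  assumes "one_form scale \<alpha>"
  shows "\<alpha> (\<Sum>i\<in>S. scale (c i) (f i)) = (\<Sum>i\<in>S. c i * \<alpha> (f i))"
proof -
  interpret f: Vector_Spaces.linear scale "(*)" \<alpha> using assms unfolding one_form_def .
  show ?thesis by (simp add: f.sum f.scale)
qed

lemma one_form_eqI:
  "one_form scale \<alpha> \<Longrightarrow> one_form scale \<beta> \<Longrightarrow> (\<And>i. i < n \<Longrightarrow> \<alpha> (e i) = \<beta> (e i)) \<Longrightarrow> \<alpha> x = \<beta> x"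
  unfolding one_form_def by (rule linear_eq_on_basis)

definition gram :: "('d \<Rightarrow> 'd \<Rightarrow> 'k) \<Rightarrow> 'k mat" where
  "gram \<omega> = mat n n (\<lambda>(i, j). \<omega> (e i) (e j))"

lemma gram_closed: "gram \<omega> \<in> carrier_mat n n"
  by (simp add: gram_def)

lemma two_form_eqI:
  assumes "two_form scale \<omega>" "two_form scale \<omega>'" "gram \<omega> = gram \<omega>'"
  shows "\<omega> = \<omega>'"
proof (intro ext)
  fix a b
  show "\<omega> a b = \<omega>' a b"
  proof (rule one_form_eqI[OF two_formD(1)[OF assms(1)] two_formD(1)[OF assms(2)]])
    fix j assume j: "j < n"
    show "\<omega> a (e j) = \<omega>' a (e j)"
    proof (rule one_form_eqI[OF two_formD(2)[OF assms(1)] two_formD(2)[OF assms(2)]])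
      fix i assume "i < n"
      then have "gram \<omega> $$ (i, j) = gram \<omega>' $$ (i, j)" using assms(3) by simp
      then show "\<omega> (e i) (e j) = \<omega>' (e i) (e j)" using \<open>i < n\<close> j by (simp add: gram_def)
    qed
  qed
qed

lemma gram_skew: "two_form scale \<omega> \<Longrightarrow> (gram \<omega>)\<^sup>T = - gram \<omega>"
  unfolding skew_mat_iff[OF gram_closed] using two_formD(4) by (auto simp: gram_def)

lemma pairing_double_sum: "pairing R F = (\<Sum>i<n. \<Sum>j<n. R $$ (i, j) * F (e i) (e j))"
  unfolding pairing_def by (simp add: sum.cartesian_product split_beta)

lemma pairing_add: "pairing R (\<lambda>x y. F x y + G x y) = pairing R F + pairing R G"
  unfolding pairing_def by (simp add: distrib_left sum.distrib)

lemma pairing_cong: "(\<And>x y. F x y = G x y) \<Longrightarrow> pairing R F = pairing R G"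
  by (simp add: pairing_def)

context
  fixes \<omega> R
  assumes \<omega>: "two_form scale \<omega>" and R: "R \<in> carrier_mat n n"
    and RW: "R * gram \<omega> = 1\<^sub>m n" and WR: "gram \<omega> * R = 1\<^sub>m n"
begin

lemma sum_form_inverse: 
  "j < n \<Longrightarrow> (\<Sum>i<n. \<omega> a (e i) * R $$ (i, j)) = coord a j"
proof -
  assume j: "j < n"
  have basis: "(\<Sum>i<n. \<omega> (e m) (e i) * R $$ (i, j)) = coord (e m) j" if m: "m < n" for m
  proof -
    have "(gram \<omega> * R) $$ (m, j) = (\<Sum>i<n. \<omega> (e m) (e i) * R $$ (i, j))"
      using R m j by (simp add: gram_def scalar_prod_def atLeast0LessThan)
    then show ?thesis using WR m j by (simp add: coord_basis)
  qed
  show ?thesis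
    by (rule one_form_eqI[OF _ one_form_coord basis], rule one_formI)
      (simp_all add: one_formD[OF two_formD(2)[OF \<omega>]] distrib_right sum.distrib sum_distrib_left mult.assoc)
qed

lemma sum_inverse_form: 
  "i < n \<Longrightarrow> (\<Sum>j<n. R $$ (i, j) * \<omega> (e j) b) = coord b i"
proof -
  assume i: "i < n"
  have basis: "(\<Sum>j<n. R $$ (i, j) * \<omega> (e j) (e m)) = coord (e m) i" if m: "m < n" for m
  proof -
    have "(R * gram \<omega>) $$ (i, m) = (\<Sum>j<n. R $$ (i, j) * \<omega> (e j) (e m))"
      using R m i by (simp add: gram_def scalar_prod_def atLeast0LessThan)
    then show ?thesis using RW m i by (simp add: coord_basis eq_commute)
  qed
  show ?thesis
    by (rule one_form_eqI[OF _ one_form_coord basis], rule one_formI)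
      (simp_all add: one_formD[OF two_formD(1)[OF \<omega>]] distrib_left sum.distrib sum_distrib_left mult.left_commute)
qed

text \<open>Contracting the first factor of \<open>r\<close> with the form \<open>\<omega> a\<close> leaves the vector \<open>a\<close>.\<close>

lemma pairing_form_left:
  assumes L: "one_form scale L"
  shows "pairing R (\<lambda>x y. \<omega> a x * L y) = L a"
proof -
  have "pairing R (\<lambda>x y. \<omega> a x * L y) = (\<Sum>j<n. \<Sum>i<n. \<omega> a (e i) * R $$ (i, j) * L (e j))"
    unfolding pairing_double_sum by (subst sum.swap) (simp add: ac_simps)
  also have "\<dots> = (\<Sum>j<n. coord a j * L (e j))"
    by (intro sum.cong refl) (simp add: sum_form_inverse flip: sum_distrib_right)
  finally show ?thesis using one_form_expand[OF L, of a] by simp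
qed

text \<open>Contracting the second factor of \<open>r\<close> with the form \<open>\<omega> b\<close> leaves the vector \<open>- b\<close>.\<close>

lemma pairing_form_right:
  assumes L: "one_form scale L"
  shows "pairing R (\<lambda>x y. L x * \<omega> b y) = - L b"
proof -
  have "pairing R (\<lambda>x y. L x * \<omega> b y) = (\<Sum>i<n. \<Sum>j<n. - (R $$ (i, j) * \<omega> (e j) b * L (e i)))"
    unfolding pairing_double_sum
    by (intro sum.cong refl, subst two_formD(4)[OF \<omega>, of b]) (simp add: mult.assoc mult.commute)
  also have "\<dots> = - (\<Sum>i<n. coord b i * L (e i))"
    by (simp add: sum_negf sum_inverse_form flip: sum_distrib_right)
  finally show ?thesis using one_form_expand[OF L, of b] by simp
qed

text \<open>The representing vector is the contraction of the first factor of \<open>r\<close> with \<open>L\<close>.\<close>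

lemma form_represents:
  assumes L: "one_form scale L"
  shows "\<exists>a. L = \<omega> a"
proof
  let ?a = "\<Sum>p\<in>{..<n} \<times> {..<n}. scale (R $$ p * L (e (fst p))) (e (snd p))"
  show "L = \<omega> ?a"
  proof
    fix x
    have "\<omega> ?a x = (\<Sum>p\<in>{..<n} \<times> {..<n}. R $$ p * L (e (fst p)) * \<omega> (e (snd p)) x)"
      by (rule one_form_sum[OF two_formD(2)[OF \<omega>]])
    also have "\<dots> = - pairing R (\<lambda>y z. L y * \<omega> x z)"
      unfolding pairing_def sum_negf[symmetric]
      by (intro sum.cong refl, subst two_formD(4)[OF \<omega>]) (simp add: mult.assoc)
    finally show "L x = \<omega> ?a x" using pairing_form_right[OF L] by simp
  qed
qed

lemma nondegenerate: "nondegenerate_form \<omega>"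
  unfolding nondegenerate_form_def
proof (intro allI impI)
  fix a assume "\<forall>b. \<omega> a b = 0"
  then have "coord a j = 0" if "j < n" for j using sum_form_inverse[OF that, of a] by simp
  then show "a = 0" using coord_expand[of a] by simp
qed

theorem rs_equations_iff_form_equations:
  assumes r: "coords r R"
  shows "rs_equations scale bracket r s \<longleftrightarrow> form_equations bracket \<omega> (contract s \<omega>)"
proof -
  note f = two_formD(1)[OF \<omega>]
  have eq1: "pairing R (\<lambda>u v. \<omega> a (bracket u s) * \<omega> b v + \<omega> a u * \<omega> b (bracket v s))
      = \<omega> b (bracket a s) - \<omega> a (bracket b s)" for a b
    by (simp add: pairing_add pairing_form_left[OF one_form_bracket(1)[OF f]] pairing_form_right[OF one_form_bracket(1)[OF f]])
  have eq2: "eval_forms [\<omega> a, \<omega> b, \<omega> c] (cubic r s) = \<omega> a (bracket b c) + \<omega> b a * \<omega> c s" for a b c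
  proof -
    have "pairing R (\<lambda>u v. pairing R (\<lambda>x y. \<omega> a (bracket u x) * \<omega> b v * \<omega> c y))
        = pairing R (\<lambda>u v. - \<omega> a (bracket u c) * \<omega> b v)"
      by (intro pairing_cong, subst pairing_form_right[OF one_form_times[OF one_form_bracket(2)[OF f]]]) simp
    also have "\<dots> = \<omega> a (bracket b c)"
      by (subst pairing_form_right[OF one_form_uminus[OF one_form_bracket(1)[OF f]]]) simp
    moreover have "pairing R (\<lambda>u v. \<omega> a u * \<omega> b v * \<omega> c s) = \<omega> b a * \<omega> c s"
      using pairing_form_left[OF one_form_times[OF f[of b], of "\<omega> c s"], of a] by (simp add: mult.assoc)
    ultimately show ?thesis by (simp add: cubic(2)[OF r f f f])
  qed
  \<comment> \<open>Every one-form is \<open>\<omega> a\<close> for some \<open>a\<close>, so testing on one-forms is testing on vectors.\<close>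
  have E1: "(\<forall>\<alpha> \<beta>. one_form scale \<alpha> \<and> one_form scale \<beta> \<longrightarrow> Q \<alpha> \<beta>) \<longleftrightarrow> (\<forall>a b. Q (\<omega> a) (\<omega> b))" for Q
    using form_represents f by metis
  have E2: "(\<forall>\<alpha> \<beta> \<gamma>. one_form scale \<alpha> \<and> one_form scale \<beta> \<and> one_form scale \<gamma> \<longrightarrow> Q \<alpha> \<beta> \<gamma>) \<longleftrightarrow> (\<forall>a b c. Q (\<omega> a) (\<omega> b) (\<omega> c))" for Q
    using form_represents f by metis
  \<comment> \<open>The right hand side is the cyclic sum of the values of \<open>cubic r s\<close>.\<close>
  have form: "diff2 bracket \<omega> a b c + wedge12 (contract s \<omega>) \<omega> a b c
      = (\<omega> a (bracket b c) + \<omega> b a * \<omega> c s) + (\<omega> c (bracket a b) + \<omega> a c * \<omega> b s)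
        + (\<omega> b (bracket c a) + \<omega> c b * \<omega> a s)" for a b c
    unfolding diff2_def wedge12_def contract_def
      two_formD(4)[OF \<omega>, of "bracket a b" c] two_formD(4)[OF \<omega>, of "bracket b c" a] two_formD(4)[OF \<omega>, of "bracket c a" b]
      two_formD(4)[OF \<omega>, of s] two_formD(4)[OF \<omega>, of b c] two_formD(4)[OF \<omega>, of c a] two_formD(4)[OF \<omega>, of a b]
    by (simp add: algebra_simps)
  \<comment> \<open>Evaluation at \<open>s, a, b\<close>: the terms of \<open>\<chi> \<and> \<omega>\<close> cancel because \<open>\<chi> = \<omega> s\<close> and \<open>\<chi> s = 0\<close>.\<close>
  have closed: "\<omega> b (bracket a s) - \<omega> a (bracket b s) = \<omega> s (bracket a b)"
    if "\<forall>a b c. diff2 bracket \<omega> a b c + wedge12 (contract s \<omega>) \<omega> a b c = 0" for a b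
  proof -
    have "diff2 bracket \<omega> s a b + wedge12 (contract s \<omega>) \<omega> s a b = 0" using that by blast
    moreover have "\<omega> b (bracket s a) = - \<omega> b (bracket a s)"
      using one_formD(2)[OF f, of b "- 1" "bracket a s"] bracket_swap[of s a] by simp
    moreover have "\<omega> b s * \<omega> a s = \<omega> a s * \<omega> b s" by (rule mult.commute)
    ultimately show ?thesis
      unfolding form two_formD(3)[OF \<omega>, of s] two_formD(4)[OF \<omega>, of s b] by (simp add: algebra_simps)
  qed
  have "rs_equations scale bracket r s \<longleftrightarrow>
      (\<forall>a b. \<omega> b (bracket a s) - \<omega> a (bracket b s) = 0) \<and>
      (\<forall>a b c. diff2 bracket \<omega> a b c + wedge12 (contract s \<omega>) \<omega> a b c = 0)"
    unfolding rs_equations_iff[OF r] E1 E2 eq1 eq2 form ..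
  also have "\<dots> \<longleftrightarrow> form_equations bracket \<omega> (contract s \<omega>)"
    unfolding form_equations_def diff1_def using closed by (auto simp: contract_def)
  finally show ?thesis .
qed

end

text \<open>In a one-dimensional module the action is commutative, so that the module law says that \<open>\<chi>\<close>
vanishes on brackets. The cocycle condition is \<open>d\<omega> + \<chi> \<and> \<omega> = 0\<close> up to the skew symmetry of \<open>\<omega>\<close>
and of the bracket.\<close>

lemma form_equations_iff_cocycle:
  assumes \<omega>: "two_form scale \<omega>" and \<chi>: "one_form scale \<chi>"
  shows "form_equations bracket \<omega> \<chi> \<longleftrightarrow>
    lie_module scale bracket (*) (\<lambda>a v. \<chi> a * v) \<and> two_cocycle scale bracket (*) (\<lambda>a v. \<chi> a * v) \<omega>"
proof -
  have "Vector_Spaces.linear scale (*) (\<lambda>a. \<chi> a * v)" for v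
    using vector_space_axioms vector_space_field by (intro vector_space_linearI) (simp_all add: one_formD[OF \<chi>] algebra_simps)
  moreover have "Vector_Spaces.linear (*) (*) (\<lambda>v. \<chi> a * v)" for a
    using vector_space_field by (intro vector_space_linearI) (simp_all add: algebra_simps)
  moreover have "(\<forall>a b v. \<chi> (bracket a b) * v = \<chi> a * (\<chi> b * v) - \<chi> b * (\<chi> a * v)) \<longleftrightarrow> (\<forall>a b. diff1 bracket \<chi> a b = 0)"
  proof -
    have "\<chi> a * (\<chi> b * v) - \<chi> b * (\<chi> a * v) = 0" for a b v by (simp add: mult.left_commute)
    then show ?thesis by (simp add: diff1_def) (metis mult_1_right mult_zero_left)
  qed
  ultimately have mod: "lie_module scale bracket (*) (\<lambda>a v. \<chi> a * v) \<longleftrightarrow> (\<forall>a b. diff1 bracket \<chi> a b = 0)"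
    unfolding lie_module_def by simp
  have ac: "\<omega> (bracket a c) b = - \<omega> (bracket c a) b" for a b c
    using one_formD(2)[OF two_formD(2)[OF \<omega>], of "- 1" "bracket c a" b] bracket_swap[of a c] by simp
  have "\<chi> a * \<omega> b c - \<chi> b * \<omega> a c + \<chi> c * \<omega> a b - \<omega> (bracket a b) c + \<omega> (bracket a c) b - \<omega> (bracket b c) a
      = diff2 bracket \<omega> a b c + wedge12 \<chi> \<omega> a b c" for a b c
    unfolding diff2_def wedge12_def two_formD(4)[OF \<omega>, of a c] ac[of a c b] by (simp add: algebra_simps)
  then show ?thesis
    unfolding form_equations_def mod two_cocycle_def using \<omega> by auto
qed

abbreviation "inverse_forms \<equiv> is_inverse_form scale bracket n e"

lemma is_inverse_form_iff:
  "inverse_forms r \<omega> \<longleftrightarrow> two_form scale \<omega> \<and> (\<exists>R. coords r R \<and> R * gram \<omega> = 1\<^sub>m n \<and> gram \<omega> * R = 1\<^sub>m n)"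
  unfolding is_inverse_form_def inverts_mat_def gram_def[symmetric] using gram_closed[of \<omega>]
  by (auto simp: has_coords_def)

lemma inverse_form_unique:
  assumes "inverse_forms r \<omega>" "inverse_forms r \<omega>'"
  shows "\<omega> = \<omega>'"
proof -
  obtain R R' where R: "coords r R" "R * gram \<omega> = 1\<^sub>m n" "gram \<omega> * R = 1\<^sub>m n"
    and R': "coords r R'" "R' * gram \<omega>' = 1\<^sub>m n"
    using assms unfolding is_inverse_form_iff by blast
  have "R \<in> carrier_mat n n" "R' = R" using R(1) coords_unique[OF R'(1) R(1)] by (auto simp: has_coords_def)
  then have Rc: "R \<in> carrier_mat n n" and RW': "R * gram \<omega>' = 1\<^sub>m n" using R'(2) by simp_all
  have "gram \<omega>' = (gram \<omega> * R) * gram \<omega>'" using R(3) gram_closed[of \<omega>'] by simp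
  also have "\<dots> = gram \<omega> * (R * gram \<omega>')" by (rule assoc_mult_mat[OF gram_closed Rc gram_closed])
  also have "\<dots> = gram \<omega>" unfolding RW' using gram_closed[of \<omega>] by simp
  finally have "gram \<omega> = gram \<omega>'" by simp
  then show ?thesis using assms unfolding is_inverse_form_iff by (blast intro: two_form_eqI)
qed

lemma inverse_form_eq: "inverse_forms r \<omega> \<Longrightarrow> inverse_form scale bracket n e r = \<omega>"
  unfolding inverse_form_def by (rule the_equality) (auto intro: inverse_form_unique)

text \<open>The inverse of the skew-symmetric matrix of \<open>r\<close> is skew-symmetric, and is the matrix of an
alternating form because \<open>2\<close> is invertible.\<close>

lemma inverse_form_exists:
  assumes two: "(2::'k) \<noteq> 0" and r: "r \<in> skew_tensors scale bracket" "nondegenerate_tensor scale bracket n e r"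
  obtains \<omega> where "inverse_forms r \<omega>"
proof -
  obtain R where R: "coords r R" "invertible_mat R" using r(2) unfolding nondegenerate_tensor_def by blast
  have Rc: "R \<in> carrier_mat n n" using R(1) by (simp add: has_coords_def)
  obtain W where W: "R * W = 1\<^sub>m n" "W * R = 1\<^sub>m (dim_row W)"
    using R(2) Rc unfolding invertible_mat_def inverts_mat_def by auto
  have "dim_row W = n" "dim_col W = n"
    using arg_cong[OF W(1), of dim_col] arg_cong[OF W(2), of dim_col] Rc by auto
  then have Wc: "W \<in> carrier_mat n n" by auto
  have "R\<^sup>T = - R"
    unfolding skew_mat_iff[OF Rc] using tensor_map_rev_iff[OF R(1)] r(1) unfolding skew_tensors_def by blast
  then have "W\<^sup>T = - W" using inverse_skew[OF Rc Wc] W \<open>dim_row W = n\<close> by simp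
  then have skew: "W $$ (j, i) = - W $$ (i, j)" if "i < n" "j < n" for i j
    using that unfolding skew_mat_iff[OF Wc] by blast
  define \<omega> where "\<omega> a b = (\<Sum>i<n. \<Sum>j<n. W $$ (i, j) * (coord a i * coord b j))" for a b
  have lin: "one_form scale (\<lambda>a. \<omega> a b)" "one_form scale (\<omega> b)" for b
    unfolding \<omega>_def
    by (rule one_formI; simp add: coord_add coord_scale algebra_simps sum.distrib sum_distrib_left)+
  have swap: "\<omega> a b = - \<omega> b a" for a b
  proof -
    have "\<omega> a b = (\<Sum>i<n. \<Sum>j<n. W $$ (j, i) * (coord a j * coord b i))"
      unfolding \<omega>_def by (rule sum.swap)
    also have "\<dots> = (\<Sum>i<n. \<Sum>j<n. - (W $$ (i, j) * (coord b i * coord a j)))"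
    proof (intro sum.cong refl)
      fix i j assume "i \<in> {..<n}" "j \<in> {..<n}"
      then have "W $$ (j, i) = - W $$ (i, j)" using skew by blast
      then show "W $$ (j, i) * (coord a j * coord b i) = - (W $$ (i, j) * (coord b i * coord a j))"
        by (simp only: mult_minus_left mult.commute[of "coord a j"])
    qed
    finally show ?thesis unfolding \<omega>_def by (simp add: sum_negf)
  qed
  have "\<omega> a a = 0" for a
  proof -
    have "2 * \<omega> a a = \<omega> a a + - \<omega> a a" unfolding mult_2 by (rule arg_cong[OF swap])
    then have "2 * \<omega> a a = 0" by simp
    then show ?thesis using two by simp
  qed
  then have "two_form scale \<omega>" using lin unfolding alternating_form_def one_form_def by blast
  moreover have "gram \<omega> = W"
  proof (rule eq_matI)
    fix i j assume "i < dim_row W" "j < dim_col W"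
    then have ij: "i < n" "j < n" using Wc by auto
    have "\<omega> (e i) (e j) = (\<Sum>k<n. if k = i then (\<Sum>l<n. if l = j then W $$ (i, l) else 0) else 0)"
      unfolding \<omega>_def
    proof (intro sum.cong refl)
      fix k assume k: "k \<in> {..<n}"
      have "(\<Sum>l<n. W $$ (k, l) * (coord (e i) k * coord (e j) l)) = (\<Sum>l<n. if k = i then (if l = j then W $$ (i, l) else 0) else 0)"
        using ij k by (intro sum.cong refl) (simp add: coord_basis)
      then show "(\<Sum>l<n. W $$ (k, l) * (coord (e i) k * coord (e j) l)) = (if k = i then (\<Sum>l<n. if l = j then W $$ (i, l) else 0) else 0)"
        by (cases "k = i") simp_all
    qed
    also have "\<dots> = W $$ (i, j)" using ij by simp
    finally show "gram \<omega> $$ (i, j) = W $$ (i, j)" using ij by (simp add: gram_def)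
  qed (use Wc in \<open>auto simp: gram_def\<close>)
  ultimately have "inverse_forms r \<omega>"
    unfolding is_inverse_form_iff using R(1) W \<open>dim_row W = n\<close> by auto
  then show thesis by (rule that)
qed

text \<open>A vector in the kernel of the matrix of \<open>\<omega>\<close> is the coordinate vector of an element of the radical.\<close>

lemma gram_inverse:
  assumes \<omega>: "two_form scale \<omega>" and nondeg: "nondegenerate_form \<omega>"
  obtains R where "R \<in> carrier_mat n n" "R * gram \<omega> = 1\<^sub>m n" "gram \<omega> * R = 1\<^sub>m n"
proof -
  have "det (gram \<omega>) \<noteq> 0"
  proof
    assume "det (gram \<omega>) = 0"
    then obtain v where v: "v \<in> carrier_vec n" "v \<noteq> 0\<^sub>v n" "gram \<omega> *\<^sub>v v = 0\<^sub>v n"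
      using det_0_iff_vec_prod_zero_field[OF gram_closed] by blast
    define b where "b = (\<Sum>j<n. scale (v $ j) (e j))"
    have "\<omega> (e i) b = 0" if i: "i < n" for i
    proof -
      have "\<omega> (e i) b = (\<Sum>j<n. v $ j * \<omega> (e i) (e j))"
        unfolding b_def by (rule one_form_sum[OF two_formD(1)[OF \<omega>]])
      also have "\<dots> = (gram \<omega> *\<^sub>v v) $ i"
        using i v(1) by (simp add: gram_def scalar_prod_def atLeast0LessThan mult.commute)
      finally show ?thesis using v(3) i by simp
    qed
    then have "\<omega> b a = 0" for a
      using one_form_expand[OF two_formD(2)[OF \<omega>], of a b] two_formD(4)[OF \<omega>, of b a] by simp
    then have "b = 0" using nondeg unfolding nondegenerate_form_def by blast
    have "v $ i = 0" if i: "i < n" for i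
    proof -
      have "coord b i = (\<Sum>j<n. v $ j * coord (e j) i)"
        unfolding b_def by (rule one_form_sum[OF one_form_coord])
      also have "\<dots> = (\<Sum>j<n. if j = i then v $ j else 0)"
        by (intro sum.cong refl) (use i in \<open>auto simp: coord_basis\<close>)
      finally show ?thesis using i coord_scale[of 0 0 i] by (simp add: \<open>b = 0\<close>)
    qed
    then have "v = 0\<^sub>v n" using v(1) by (intro eq_vecI) auto
    then show False using v(2) by simp
  qed
  then have "gram \<omega> \<in> Units (ring_mat TYPE('k) n ())" by (rule det_non_zero_imp_unit[OF gram_closed])
  then show thesis unfolding Units_def ring_mat_simps using that by auto
qed

text \<open>The sums in \<open>lie_tensors\<close> have no coefficients and are indexed by an initial segment of the natural
numbers. So the entries of \<open>R\<close> are moved into the first factor, and the index pairs are enumerated.\<close>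

lemma skew_tensor_exists:
  assumes R: "R \<in> carrier_mat n n" and skew: "R\<^sup>T = - R"
  obtains r where "r \<in> skew_tensors scale bracket" "coords r R"
proof -
  interpret P: field_algebra "T 2" by (rule H.field_algebra_tensor)
  let ?I = "{..<n} \<times> {..<n}"
  define r where "r = (\<Oplus>\<^bsub>T 2\<^esub>p\<in>?I. R $$ p \<odot>\<^bsub>T 2\<^esub> tensor2 (e (fst p)) (e (snd p)))"
  have coords: "coords r R"
    unfolding has_coords_def r_def tensor2_def using R by simp
  have "R $$ p \<odot>\<^bsub>T 2\<^esub> tensor2 a b = tensor2 (scale (R $$ p) a) b" for p a b
    unfolding tensor2_def
    using H.pure_smult[OF H.tuple2_closed, of "emb a" scale bracket "emb b" 0 "emb a" "R $$ p"] by (simp add: env_emb_scale)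
  then have r: "r = (\<Oplus>\<^bsub>T 2\<^esub>p\<in>?I. tensor2 (scale (R $$ p) (e (fst p))) (e (snd p)))"
    unfolding r_def by simp
  obtain h where h: "bij_betw h {0..<card ?I} ?I" using ex_bij_betw_nat_finite[of ?I] by blast
  then have h': "inj_on h {..<card ?I}" "h ` {..<card ?I} = ?I"
    unfolding bij_betw_def atLeast0LessThan by auto
  have "r = (\<Oplus>\<^bsub>T 2\<^esub>i\<in>{..<card ?I}. tensor2 (scale (R $$ h i) (e (fst (h i)))) (e (snd (h i))))"
    unfolding r using h' P.finsum_reindex[of "\<lambda>p. tensor2 (scale (R $$ p) (e (fst p))) (e (snd p))" h "{..<card ?I}"]
    by (simp add: tensor2_closed)
  then have "r \<in> lie_tensors scale bracket"
    unfolding lie_tensors_def tensor2_def by (intro CollectI exI conjI TrueI)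
  moreover have "tensor_map H 2 rev r = \<ominus>\<^bsub>T 2\<^esub> r"
    using tensor_map_rev_iff[OF coords] skew unfolding skew_mat_iff[OF R] by blast
  ultimately show thesis using coords by (intro that[of r]) (simp_all add: skew_tensors_def)
qed

end

section \<open>The correspondence\<close>

theorem lemma8p11:
  fixes scale :: "'k::{alg_closed_field, field_char_0} \<Rightarrow> 'd::ab_group_add \<Rightarrow> 'd"
    and bracket :: "'d \<Rightarrow> 'd \<Rightarrow> 'd"
    and n :: nat
    and e :: "nat \<Rightarrow> 'd"
  assumes "lie_algebra scale bracket"
    and "finite_basis scale n e"
  shows
    "(\<forall>r \<in> skew_tensors scale bracket. nondegenerate_tensor scale bracket n e r \<longrightarrow>
        (\<exists>!\<omega>. is_inverse_form scale bracket n e r \<omega>) \<and>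
        (\<forall>s. let \<omega> = inverse_form scale bracket n e r; \<chi> = contract s \<omega> in
           (rs_equations scale bracket r s \<longleftrightarrow> form_equations bracket \<omega> \<chi>) \<and>
           (form_equations bracket \<omega> \<chi> \<longleftrightarrow>
              lie_module scale bracket (*) (\<lambda>a v. \<chi> a * v) \<and>
              two_cocycle scale bracket (*) (\<lambda>a v. \<chi> a * v) \<omega>)))
     \<and> bij_betw
         (\<lambda>(r, s). (inverse_form scale bracket n e r, contract s (inverse_form scale bracket n e r)))
         {(r, s). r \<in> skew_tensors scale bracket \<and> nondegenerate_tensor scale bracket n e r \<and>
            rs_equations scale bracket r s}
         {(\<omega>, \<chi>). two_form scale \<omega> \<and> nondegenerate_form \<omega> \<and> one_form scale \<chi> \<and>
            form_equations bracket \<omega> \<chi>}"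
proof -
  interpret lie_algebra scale bracket by fact
  interpret based_lie_algebra scale bracket n e by unfold_locales fact
  let ?inv = "inverse_form scale bracket n e"
  define S where "S = {(r, s). r \<in> skew_tensors scale bracket \<and> nondegenerate_tensor scale bracket n e r \<and>
            rs_equations scale bracket r s}"
  define U where "U = {(\<omega>, \<chi>). two_form scale \<omega> \<and> nondegenerate_form \<omega> \<and> one_form scale \<chi> \<and>
            form_equations bracket \<omega> \<chi>}"
  have inv: "inverse_forms r (?inv r)"
    if "r \<in> skew_tensors scale bracket" "nondegenerate_tensor scale bracket n e r" for r
    using inverse_form_exists[OF _ that] inverse_form_eq by (metis zero_neq_numeral)
  have equations: "rs_equations scale bracket r s \<longleftrightarrow> form_equations bracket \<omega> (contract s \<omega>)"
    if "inverse_forms r \<omega>" for r s \<omega>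
  proof -
    obtain R where R: "coords r R" "R * gram \<omega> = 1\<^sub>m n" "gram \<omega> * R = 1\<^sub>m n" and tf: "two_form scale \<omega>"
      using \<open>inverse_forms r \<omega>\<close> unfolding is_inverse_form_iff by blast
    have "R \<in> carrier_mat n n" using R(1) by (simp add: has_coords_def)
    then show ?thesis by (rule rs_equations_iff_form_equations[OF tf _ R(2,3) R(1)])
  qed
  have one: "one_form scale (contract s \<omega>)" if "two_form scale \<omega>" for s \<omega>
    unfolding contract_def by (rule two_formD(1)[OF that])
  have "(\<exists>!\<omega>. inverse_forms r \<omega>) \<and>
        (\<forall>s. let \<omega> = ?inv r; \<chi> = contract s \<omega> in
           (rs_equations scale bracket r s \<longleftrightarrow> form_equations bracket \<omega> \<chi>) \<and>
           (form_equations bracket \<omega> \<chi> \<longleftrightarrow>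
              lie_module scale bracket (*) (\<lambda>a v. \<chi> a * v) \<and>
              two_cocycle scale bracket (*) (\<lambda>a v. \<chi> a * v) \<omega>))"
    if r: "r \<in> skew_tensors scale bracket" "nondegenerate_tensor scale bracket n e r" for r
  proof -
    have tf: "two_form scale (?inv r)" using inv[OF r] unfolding is_inverse_form_iff by blast
    have "\<exists>!\<omega>. inverse_forms r \<omega>" by (rule ex1I, rule inv[OF r]) (rule inverse_form_unique[OF _ inv[OF r]])
    then show ?thesis
      unfolding Let_def using equations[OF inv[OF r]] form_equations_iff_cocycle[OF tf one[OF tf]] by blast
  qed
  moreover have "bij_betw (\<lambda>(r, s). (?inv r, contract s (?inv r))) S U"
  proof (rule bij_betw_imageI)
    show "inj_on (\<lambda>(r, s). (?inv r, contract s (?inv r))) S"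
    proof (rule inj_onI, clarify)
      fix r s r' s' assume rs: "(r, s) \<in> S" "(r', s') \<in> S"
        and \<omega>: "?inv r = ?inv r'" and \<chi>: "contract s (?inv r) = contract s' (?inv r')"
      have inv_r: "inverse_forms r (?inv r)" "inverse_forms r' (?inv r)"
        using rs inv[of r] inv[of r'] \<omega> unfolding S_def by auto
      obtain R R' where R: "coords r R" "R * gram (?inv r) = 1\<^sub>m n" "gram (?inv r) * R = 1\<^sub>m n"
        and R': "coords r' R'" "R' * gram (?inv r) = 1\<^sub>m n" and tf: "two_form scale (?inv r)"
        using inv_r unfolding is_inverse_form_iff by blast
      have Rc: "R \<in> carrier_mat n n" "R' \<in> carrier_mat n n" using R(1) R'(1) by (auto simp: has_coords_def)
      have "R' = R' * (gram (?inv r) * R)" using R(3) Rc by simp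
      also have "\<dots> = R' * gram (?inv r) * R" by (rule assoc_mult_mat[OF Rc(2) gram_closed Rc(1), symmetric])
      also have "\<dots> = R" using R'(2) Rc by simp
      finally have "R' = R" .
      then have "r = r'" using R(1) R'(1) unfolding has_coords_def by metis
      have "?inv r (s - s') b = 0" for b
      proof -
        have "?inv r (s - s' + s') b = ?inv r (s - s') b + ?inv r s' b"
          by (rule one_formD(1)[OF two_formD(2)[OF tf]])
        moreover have "?inv r s b = ?inv r s' b" using \<chi> \<omega> unfolding contract_def by metis
        ultimately show ?thesis by simp
      qed
      then have "s - s' = 0"
        using nondegenerate[OF tf Rc(1) R(2,3)] unfolding nondegenerate_form_def by blast
      then show "r = r' \<and> s = s'" using \<open>r = r'\<close> by simp
    qed
    show "(\<lambda>(r, s). (?inv r, contract s (?inv r))) ` S = U"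
    proof (intro equalityI subsetI)
      fix x assume "x \<in> (\<lambda>(r, s). (?inv r, contract s (?inv r))) ` S"
      then obtain r s where rs: "r \<in> skew_tensors scale bracket" "nondegenerate_tensor scale bracket n e r"
        "rs_equations scale bracket r s" and x: "x = (?inv r, contract s (?inv r))" unfolding S_def by auto
      obtain R where R: "coords r R" "R * gram (?inv r) = 1\<^sub>m n" "gram (?inv r) * R = 1\<^sub>m n"
        and tf: "two_form scale (?inv r)"
        using inv[OF rs(1,2)] unfolding is_inverse_form_iff by blast
      have "R \<in> carrier_mat n n" using R(1) by (auto simp: has_coords_def)
      then show "x \<in> U"
        unfolding x U_def using tf one[OF tf] nondegenerate[OF tf _ R(2,3)] equations[OF inv[OF rs(1,2)]] rs(3) by simp
    next
      fix x assume "x \<in> U"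
      then obtain \<omega> \<chi> where x: "x = (\<omega>, \<chi>)" and tf: "two_form scale \<omega>" and nd: "nondegenerate_form \<omega>"
        and \<chi>: "one_form scale \<chi>" and eqs: "form_equations bracket \<omega> \<chi>" unfolding U_def by auto
      obtain R where R: "R \<in> carrier_mat n n" "R * gram \<omega> = 1\<^sub>m n" "gram \<omega> * R = 1\<^sub>m n"
        using gram_inverse[OF tf nd] .
      have "R\<^sup>T = - R" by (rule inverse_skew[OF gram_closed R(1,2,3) gram_skew[OF tf]])
      then obtain r where r: "r \<in> skew_tensors scale bracket" "coords r R" using skew_tensor_exists[OF R(1)] by blast
      obtain s where s: "\<chi> = \<omega> s" using form_represents[OF tf R \<chi>] by blast
      have inv_r: "inverse_forms r \<omega>" unfolding is_inverse_form_iff using tf r(2) R by blast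
      have "invertible_mat R"
        unfolding invertible_mat_def inverts_mat_def using R gram_closed[of \<omega>]
        by (intro conjI exI[of _ "gram \<omega>"]) auto
      then have "nondegenerate_tensor scale bracket n e r" unfolding nondegenerate_tensor_def using r(2) by blast
      moreover have "rs_equations scale bracket r s" using equations[OF inv_r] eqs s by (simp add: contract_def)
      ultimately have "(r, s) \<in> S" unfolding S_def using r(1) by simp
      moreover have "x = (?inv r, contract s (?inv r))"
        unfolding x inverse_form_eq[OF inv_r] s contract_def by simp
      ultimately show "x \<in> (\<lambda>(r, s). (?inv r, contract s (?inv r))) ` S" by force
    qed
  qed
  ultimately show ?thesis unfolding S_def U_def by blast
qed

end
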